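(* Let $\mathfrak g$ be a finite dimensional simple Lie algebra of rank $n$. Then $$\mathrm{Aut}_{\rm Hopf}\,U_q^+(\mathfrak g)\simeq(\Bbbk^\times)^n\rtimes\mathrm{Autdiagr}(\mathfrak g)\simeq\mathrm{Aut}_{\rm Hopf}\,U_q(\mathfrak b^+),$$ where the torus acts by $E_i\mapsto\alpha_iE_i$ (and $K_i\mapsto K_i$) and $\sigma\in\mathrm{Autdiagr}(\mathfrak g)$ acts by $E_i\mapsto E_{\sigma(i)}$ (and $K_i\mapsto K_{\sigma(i)}$).
   Context: $\Bbbk$ is a field of characteristic $0$ and $q\in\Bbbk^\times$ is not algebraic over $\mathbb Q$. $(a_{ij})_{1\le i,j\le n}$ is the Cartan matrix of $\mathfrak g$ and $d_1,\dots,d_n$ the relatively prime positive integers with $(d_ia_{ij})$ symmetric. $U_q^+(\mathfrak g)$ is the $\Bbbk$-algebra generated by $E_1,\dots,E_n$ with relations $\sum_{\nu=0}^{1-a_{ij}}\left[\begin{smallmatrix}1-a_{ij}\\ \nu\end{smallmatrix}\right]_{q^{d_i}}E_i^{1-a_{ij}-\nu}E_j(-E_i)^\nu=0$ for $i\neq j$ (Gaussian binomial coefficients). $U_q(\mathfrak b^+)$ is generated by $E_i,K_i^{\pm1}$ with these relations, the $K_i$ commuting invertible, and $K_iE_j=q^{d_ia_{ij}}E_jK_i$; it is a Hopf algebra with $\Delta(K_i)=K_i\otimes K_i$, $\Delta(E_i)=E_i\otimes1+K_i\otimes E_i$, $\varepsilon(K_i)=1,\varepsilon(E_i)=0$, $S(K_i)=K_i^{-1}$,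 $S(E_i)=-K_i^{-1}E_i$. $U_q^+(\mathfrak g)$ is regarded as a braided Hopf algebra: it is the Nichols algebra of $V=\bigoplus_i\Bbbk E_i$ with diagonal braiding $c(E_i\otimes E_j)=q^{d_ia_{ij}}E_j\otimes E_i$, with the $E_i$ primitive; $\mathrm{Aut}_{\rm Hopf}$ of it means linear bijections preserving product, unit, coproduct, counit and braiding. $\mathrm{Autdiagr}(\mathfrak g)$ is the group of automorphisms of the Dynkin diagram, i.e. permutations $\sigma$ of $\{1,\dots,n\}$ with $a_{\sigma(i)\sigma(j)}=a_{ij}$ for all $i,j$. *)

theory Defs
  imports Main "HOL-Library.FuncSet" "HOL-Library.Function_Algebras" "HOL-Combinatorics.Permutations"
          "HOL-Computational_Algebra.Polynomial"
begin

text \<open>An element of the free algebra k<x_0,...,x_{N-1}> is a finitely supported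
  function from words (lists of letters < N) to k.  Tensor products are modelled
  by finitely supported functions on pairs of words.\<close>

type_synonym 'k ncp = "nat list \<Rightarrow> 'k"
type_synonym 'k ncp2 = "nat list \<times> nat list \<Rightarrow> 'k"

definition supp :: "('a \<Rightarrow> 'k::zero) \<Rightarrow> 'a set" where
  "supp f = {x. f x \<noteq> 0}"

definition fs :: "nat \<Rightarrow> ('k::zero) ncp set" where
  "fs N = {f. finite (supp f) \<and> (\<forall>w\<in>supp f. set w \<subseteq> {..<N})}"

definition fs2 :: "nat \<Rightarrow> ('k::zero) ncp2 set" where
  "fs2 N = {F. finite (supp F) \<and> (\<forall>(u,v)\<in>supp F. set u \<subseteq> {..<N} \<and> set v \<subseteq> {..<N})}"

definition smul :: "'k::times \<Rightarrow> ('a \<Rightarrow> 'k) \<Rightarrow> 'a \<Rightarrow> 'k" where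
  "smul c f = (\<lambda>x. c * f x)"

definition ncmul :: "'k::comm_ring_1 ncp \<Rightarrow> 'k ncp \<Rightarrow> 'k ncp" where
  "ncmul f g = (\<lambda>w. \<Sum>k\<le>length w. f (take k w) * g (drop k w))"

definition ncone :: "'k::comm_ring_1 ncp" where
  "ncone = (\<lambda>w. if w = [] then 1 else 0)"

definition ncword :: "nat list \<Rightarrow> 'k::comm_ring_1 ncp" where
  "ncword u = (\<lambda>w. if w = u then 1 else 0)"

definition ncgen :: "nat \<Rightarrow> 'k::comm_ring_1 ncp" where
  "ncgen i = ncword [i]"

definition ncpow :: "'k::comm_ring_1 ncp \<Rightarrow> nat \<Rightarrow> 'k ncp" where
  "ncpow f k = (ncmul f ^^ k) ncone"

inductive_set ncideal :: "nat \<Rightarrow> 'k::field ncp set \<Rightarrow> 'k ncp set" for N R where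
  zero: "0 \<in> ncideal N R"
| gen: "u \<in> fs N \<Longrightarrow> r \<in> R \<Longrightarrow> v \<in> fs N \<Longrightarrow> ncmul (ncmul u r) v \<in> ncideal N R"
| add: "f \<in> ncideal N R \<Longrightarrow> g \<in> ncideal N R \<Longrightarrow> f + g \<in> ncideal N R"
| smul: "f \<in> ncideal N R \<Longrightarrow> smul c f \<in> ncideal N R"

definition cls :: "nat \<Rightarrow> 'k::field ncp set \<Rightarrow> 'k ncp \<Rightarrow> 'k ncp set" where
  "cls N R f = {g \<in> fs N. g - f \<in> ncideal N R}"

definition Qt :: "nat \<Rightarrow> 'k::field ncp set \<Rightarrow> 'k ncp set set" where
  "Qt N R = cls N R ` fs N"

definition rep :: "'a set \<Rightarrow> 'a" where
  "rep X = (SOME f. f \<in> X)"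

definition qadd :: "nat \<Rightarrow> 'k::field ncp set \<Rightarrow> 'k ncp set \<Rightarrow> 'k ncp set \<Rightarrow> 'k ncp set" where
  "qadd N R X Y = cls N R (rep X + rep Y)"

definition qsmul :: "nat \<Rightarrow> 'k::field ncp set \<Rightarrow> 'k \<Rightarrow> 'k ncp set \<Rightarrow> 'k ncp set" where
  "qsmul N R c X = cls N R (smul c (rep X))"

definition qmul :: "nat \<Rightarrow> 'k::field ncp set \<Rightarrow> 'k ncp set \<Rightarrow> 'k ncp set \<Rightarrow> 'k ncp set" where
  "qmul N R X Y = cls N R (ncmul (rep X) (rep Y))"

definition qone :: "nat \<Rightarrow> 'k::field ncp set \<Rightarrow> 'k ncp set" where
  "qone N R = cls N R ncone"

definition qgen :: "nat \<Rightarrow> 'k::field ncp set \<Rightarrow> nat \<Rightarrow> 'k ncp set" where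
  "qgen N R i = cls N R (ncgen i)"

definition tens :: "'k::times ncp \<Rightarrow> 'k ncp \<Rightarrow> 'k ncp2" where
  "tens f g = (\<lambda>(u,v). f u * g v)"

inductive_set ncideal2 :: "nat \<Rightarrow> 'k::field ncp set \<Rightarrow> 'k ncp2 set" for N R where
  zero: "0 \<in> ncideal2 N R"
| left: "f \<in> ncideal N R \<Longrightarrow> g \<in> fs N \<Longrightarrow> tens f g \<in> ncideal2 N R"
| right: "f \<in> fs N \<Longrightarrow> g \<in> ncideal N R \<Longrightarrow> tens f g \<in> ncideal2 N R"
| add: "F \<in> ncideal2 N R \<Longrightarrow> G \<in> ncideal2 N R \<Longrightarrow> F + G \<in> ncideal2 N R"
| smul: "F \<in> ncideal2 N R \<Longrightarrow> smul c F \<in> ncideal2 N R"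

definition cls2 :: "nat \<Rightarrow> 'k::field ncp set \<Rightarrow> 'k ncp2 \<Rightarrow> 'k ncp2 set" where
  "cls2 N R F = {G \<in> fs2 N. G - F \<in> ncideal2 N R}"

text \<open>(T/I) (x) (T/I) = (T (x) T)/(I (x) T + T (x) I).\<close>
definition Qt2 :: "nat \<Rightarrow> 'k::field ncp set \<Rightarrow> 'k ncp2 set set" where
  "Qt2 N R = cls2 N R ` fs2 N"

definition chiw :: "(nat \<Rightarrow> nat \<Rightarrow> 'k::comm_ring_1) \<Rightarrow> nat list \<Rightarrow> nat list \<Rightarrow> 'k" where
  "chiw chi a b = prod_list [chi x y. x \<leftarrow> a, y \<leftarrow> b]"

text \<open>Twisted (braided) product on T (x) T:
  (a (x) b)(c (x) d) = chi(deg b, deg c) ac (x) bd.  With chi = 1 this is the usual product.\<close>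
definition mul2 :: "(nat \<Rightarrow> nat \<Rightarrow> 'k::comm_ring_1) \<Rightarrow> 'k ncp2 \<Rightarrow> 'k ncp2 \<Rightarrow> 'k ncp2" where
  "mul2 chi F G = (\<lambda>(u,v). \<Sum>k\<le>length u. \<Sum>l\<le>length v.
      chiw chi (take l v) (drop k u) * F (take k u, take l v) * G (drop k u, drop l v))"

text \<open>Coproduct: the (braided) algebra map determined by its values D on the letters.\<close>
definition delta_word :: "(nat \<Rightarrow> nat \<Rightarrow> 'k::comm_ring_1) \<Rightarrow> (nat \<Rightarrow> 'k ncp2) \<Rightarrow> nat list \<Rightarrow> 'k ncp2" where
  "delta_word chi D w = foldr (\<lambda>x G. mul2 chi (D x) G) w (tens ncone ncone)"

definition ncDelta :: "(nat \<Rightarrow> nat \<Rightarrow> 'k::comm_ring_1) \<Rightarrow> (nat \<Rightarrow> 'k ncp2) \<Rightarrow> 'k ncp \<Rightarrow> 'k ncp2" where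
  "ncDelta chi D f = (\<lambda>p. \<Sum>w\<in>supp f. f w * delta_word chi D w p)"

definition ncEps :: "(nat \<Rightarrow> 'k::comm_ring_1) \<Rightarrow> 'k ncp \<Rightarrow> 'k" where
  "ncEps e f = (\<Sum>w\<in>supp f. f w * prod_list (map e w))"

text \<open>Braiding c(x (x) y) = chi(deg x, deg y) y (x) x on homogeneous elements.\<close>
definition braid :: "(nat \<Rightarrow> nat \<Rightarrow> 'k::comm_ring_1) \<Rightarrow> 'k ncp2 \<Rightarrow> 'k ncp2" where
  "braid chi F = (\<lambda>(u,v). chiw chi v u * F (v,u))"

text \<open>phi (x) phi on the tensor square, for a linear map phi on the quotient.\<close>
definition qmap2 :: "nat \<Rightarrow> 'k::field ncp set \<Rightarrow> ('k ncp set \<Rightarrow> 'k ncp set) \<Rightarrow> 'k ncp2 set \<Rightarrow> 'k ncp2 set" where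
  "qmap2 N R \<phi> Z = cls2 N R (\<lambda>p. \<Sum>(u,v)\<in>supp (rep Z).
      rep Z (u,v) * tens (rep (\<phi> (cls N R (ncword u)))) (rep (\<phi> (cls N R (ncword v)))) p)"

definition is_alg_aut :: "nat \<Rightarrow> 'k::field ncp set \<Rightarrow> ('k ncp set \<Rightarrow> 'k ncp set) \<Rightarrow> bool" where
  "is_alg_aut N R \<phi> \<longleftrightarrow> bij_betw \<phi> (Qt N R) (Qt N R)
     \<and> (\<forall>X\<in>Qt N R. \<forall>Y\<in>Qt N R. \<phi> (qadd N R X Y) = qadd N R (\<phi> X) (\<phi> Y)
                               \<and> \<phi> (qmul N R X Y) = qmul N R (\<phi> X) (\<phi> Y))
     \<and> (\<forall>c. \<forall>X\<in>Qt N R. \<phi> (qsmul N R c X) = qsmul N R c (\<phi> X))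
     \<and> \<phi> (qone N R) = qone N R"

definition is_coalg_map :: "nat \<Rightarrow> 'k::field ncp set \<Rightarrow> (nat \<Rightarrow> nat \<Rightarrow> 'k) \<Rightarrow> (nat \<Rightarrow> 'k ncp2)
    \<Rightarrow> (nat \<Rightarrow> 'k) \<Rightarrow> ('k ncp set \<Rightarrow> 'k ncp set) \<Rightarrow> bool" where
  "is_coalg_map N R chi D e \<phi> \<longleftrightarrow>
     (\<forall>X\<in>Qt N R. ncEps e (rep (\<phi> X)) = ncEps e (rep X)
        \<and> cls2 N R (ncDelta chi D (rep (\<phi> X))) = qmap2 N R \<phi> (cls2 N R (ncDelta chi D (rep X))))"

definition preserves_braiding :: "nat \<Rightarrow> 'k::field ncp set \<Rightarrow> (nat \<Rightarrow> nat \<Rightarrow> 'k)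
    \<Rightarrow> ('k ncp set \<Rightarrow> 'k ncp set) \<Rightarrow> bool" where
  "preserves_braiding N R chi \<phi> \<longleftrightarrow>
     (\<forall>Z\<in>Qt2 N R. qmap2 N R \<phi> (cls2 N R (braid chi (rep Z)))
                   = cls2 N R (braid chi (rep (qmap2 N R \<phi> Z))))"

text \<open>Indecomposable Cartan matrix of finite type (= Cartan matrix of a finite
  dimensional simple Lie algebra of rank n), indices 0..n-1.\<close>
definition simple_cartan :: "nat \<Rightarrow> (nat \<Rightarrow> nat \<Rightarrow> int) \<Rightarrow> bool" where
  "simple_cartan n a \<longleftrightarrow> n \<ge> 1
     \<and> (\<forall>i<n. a i i = 2)
     \<and> (\<forall>i<n. \<forall>j<n. i \<noteq> j \<longrightarrow> a i j \<le> 0 \<and> (a i j = 0 \<longleftrightarrow> a j i = 0))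
     \<and> (\<forall>S. S \<subseteq> {..<n} \<and> S \<noteq> {} \<and> S \<noteq> {..<n} \<longrightarrow> (\<exists>i\<in>S. \<exists>j\<in>{..<n} - S. a i j \<noteq> 0))
     \<and> (\<exists>e::nat \<Rightarrow> nat. (\<forall>i<n. e i > 0) \<and> (\<forall>i<n. \<forall>j<n. int (e i) * a i j = int (e j) * a j i)
          \<and> (\<forall>x::nat \<Rightarrow> real. (\<exists>i<n. x i \<noteq> 0) \<longrightarrow>
                (\<Sum>i<n. \<Sum>j<n. x i * of_int (int (e i) * a i j) * x j) > 0))"

definition symmetrizer :: "nat \<Rightarrow> (nat \<Rightarrow> nat \<Rightarrow> int) \<Rightarrow> (nat \<Rightarrow> nat) \<Rightarrow> bool" where
  "symmetrizer n a d \<longleftrightarrow> (\<forall>i<n. d i > 0) \<and> Gcd (d ` {..<n}) = 1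
     \<and> (\<forall>i<n. \<forall>j<n. int (d i) * a i j = int (d j) * a j i)"

definition autdiagr :: "nat \<Rightarrow> (nat \<Rightarrow> nat \<Rightarrow> int) \<Rightarrow> (nat \<Rightarrow> nat) set" where
  "autdiagr n a = {\<sigma>. \<sigma> permutes {..<n} \<and> (\<forall>i<n. \<forall>j<n. a (\<sigma> i) (\<sigma> j) = a i j)}"

definition torus :: "nat \<Rightarrow> (nat \<Rightarrow> 'k::field) set" where
  "torus n = {\<alpha>. \<alpha> \<in> extensional {..<n} \<and> (\<forall>i<n. \<alpha> i \<noteq> 0)}"

text \<open>Multiplication of the semidirect product (k^x)^n \<rtimes> Autdiagr, matching composition
  of the automorphisms E_i \<mapsto> alpha_i E_{sigma i}.\<close>
definition sdmul :: "nat \<Rightarrow> (nat \<Rightarrow> 'k::field) \<times> (nat \<Rightarrow> nat) \<Rightarrow> (nat \<Rightarrow> 'k) \<times> (nat \<Rightarrow> nat)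
    \<Rightarrow> (nat \<Rightarrow> 'k) \<times> (nat \<Rightarrow> nat)" where
  "sdmul n x y = (case x of (\<alpha>, \<sigma>) \<Rightarrow> case y of (\<beta>, \<tau>) \<Rightarrow>
      (\<lambda>i\<in>{..<n}. \<alpha> (\<tau> i) * \<beta> i, \<sigma> \<circ> \<tau>))"

definition qint :: "'k::field \<Rightarrow> nat \<Rightarrow> 'k" where
  "qint t k = (\<Sum>j<k. t powi (int k - 1 - 2 * int j))"

definition qfact :: "'k::field \<Rightarrow> nat \<Rightarrow> 'k" where
  "qfact t k = (\<Prod>j=1..k. qint t j)"

definition qbinom :: "'k::field \<Rightarrow> nat \<Rightarrow> nat \<Rightarrow> 'k" where
  "qbinom t m v = qfact t m / (qfact t v * qfact t (m - v))"

definition chiU :: "'k::field \<Rightarrow> (nat \<Rightarrow> nat \<Rightarrow> int) \<Rightarrow> (nat \<Rightarrow> nat) \<Rightarrow> nat \<Rightarrow> nat \<Rightarrow> 'k" where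
  "chiU q a d i j = q powi (int (d i) * a i j)"

definition serre :: "'k::field \<Rightarrow> (nat \<Rightarrow> nat \<Rightarrow> int) \<Rightarrow> (nat \<Rightarrow> nat) \<Rightarrow> nat \<Rightarrow> nat \<Rightarrow> 'k ncp" where
  "serre q a d i j = (let m = nat (1 - a i j) in
     (\<Sum>v\<le>m. smul (qbinom (q ^ d i) m v * (-1) ^ v)
        (ncmul (ncmul (ncpow (ncgen i) (m - v)) (ncgen j)) (ncpow (ncgen i) v))))"

definition relsU :: "nat \<Rightarrow> 'k::field \<Rightarrow> (nat \<Rightarrow> nat \<Rightarrow> int) \<Rightarrow> (nat \<Rightarrow> nat) \<Rightarrow> 'k ncp set" where
  "relsU n q a d = {serre q a d i j | i j. i < n \<and> j < n \<and> i \<noteq> j}"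

definition DU :: "nat \<Rightarrow> 'k::field ncp2" where
  "DU i = tens (ncgen i) ncone + tens ncone (ncgen i)"

definition epsU :: "nat \<Rightarrow> 'k::field" where
  "epsU i = 0"

definition Uplus :: "nat \<Rightarrow> 'k::field \<Rightarrow> (nat \<Rightarrow> nat \<Rightarrow> int) \<Rightarrow> (nat \<Rightarrow> nat) \<Rightarrow> 'k ncp set set" where
  "Uplus n q a d = Qt n (relsU n q a d)"

definition HopfAutU :: "nat \<Rightarrow> 'k::field \<Rightarrow> (nat \<Rightarrow> nat \<Rightarrow> int) \<Rightarrow> (nat \<Rightarrow> nat)
    \<Rightarrow> ('k ncp set \<Rightarrow> 'k ncp set) set" where
  "HopfAutU n q a d = {\<phi>. \<phi> \<in> extensional (Uplus n q a d)
      \<and> is_alg_aut n (relsU n q a d) \<phi>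
      \<and> is_coalg_map n (relsU n q a d) (chiU q a d) DU epsU \<phi>
      \<and> preserves_braiding n (relsU n q a d) (chiU q a d) \<phi>}"

subsection \<open>U_q(b^+): letters E_i = i, K_i = n+i, K_i^{-1} = 2n+i (i < n)\<close>

definition relsB :: "nat \<Rightarrow> 'k::field \<Rightarrow> (nat \<Rightarrow> nat \<Rightarrow> int) \<Rightarrow> (nat \<Rightarrow> nat) \<Rightarrow> 'k ncp set" where
  "relsB n q a d = relsU n q a d
     \<union> {ncmul (ncgen (n+i)) (ncgen (2*n+i)) - ncone | i. i < n}
     \<union> {ncmul (ncgen (2*n+i)) (ncgen (n+i)) - ncone | i. i < n}
     \<union> {ncmul (ncgen (n+i)) (ncgen (n+j)) - ncmul (ncgen (n+j)) (ncgen (n+i)) | i j. i < n \<and> j < n}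
     \<union> {ncmul (ncgen (n+i)) (ncgen j) - smul (q powi (int (d i) * a i j)) (ncmul (ncgen j) (ncgen (n+i)))
         | i j. i < n \<and> j < n}"

definition DB :: "nat \<Rightarrow> nat \<Rightarrow> 'k::field ncp2" where
  "DB n i = (if i < n then tens (ncgen i) ncone + tens (ncgen (n+i)) (ncgen i)
             else tens (ncgen i) (ncgen i))"

definition epsB :: "nat \<Rightarrow> nat \<Rightarrow> 'k::field" where
  "epsB n i = (if i < n then 0 else 1)"

definition chi1 :: "nat \<Rightarrow> nat \<Rightarrow> 'k::field" where
  "chi1 i j = 1"

definition Ub :: "nat \<Rightarrow> 'k::field \<Rightarrow> (nat \<Rightarrow> nat \<Rightarrow> int) \<Rightarrow> (nat \<Rightarrow> nat) \<Rightarrow> 'k ncp set set" where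
  "Ub n q a d = Qt (3*n) (relsB n q a d)"

definition HopfAutB :: "nat \<Rightarrow> 'k::field \<Rightarrow> (nat \<Rightarrow> nat \<Rightarrow> int) \<Rightarrow> (nat \<Rightarrow> nat)
    \<Rightarrow> ('k ncp set \<Rightarrow> 'k ncp set) set" where
  "HopfAutB n q a d = {\<phi>. \<phi> \<in> extensional (Ub n q a d)
      \<and> is_alg_aut (3*n) (relsB n q a d) \<phi>
      \<and> is_coalg_map (3*n) (relsB n q a d) chi1 (DB n) (epsB n) \<phi>}"

end

theory Submission
  imports Defs
begin

text \<open>
  An automorphism \<open>\<phi>\<close> of \<open>U\<^sub>q\<^sup>+\<close> that respects the braiding sends \<open>E\<^sub>i\<close> to an element whose homogeneous
  components satisfy \<open>(\<beta>, \<gamma>) = (\<alpha>\<^sub>i, \<alpha>\<^sub>j)\<close>, because \<open>q\<close> is transcendental.  Positive definiteness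
  leaves a single weight \<open>\<beta>\<^sub>i\<close> in the positive cone for each \<open>i\<close>.  In the Borel case the coactions of the torus
  obtained from the coproduct show that the images of the \<open>K\<^sub>i\<close> are monomials \<open>K\<^sup>\<beta>\<close> with \<open>\<beta> = \<beta>\<^sub>i\<close> and that
  \<open>\<phi>(E\<^sub>i)\<close> is homogeneous of the same weight \<open>\<beta>\<^sub>i\<close>.  By surjectivity every simple root is a sum of some
  of the \<open>\<beta>\<^sub>i\<close>, so the \<open>\<beta>\<^sub>i\<close> are the simple roots up to an isometric permutation, that is, a diagram
  automorphism.  No knowledge of the primitive elements of \<open>U\<^sub>q\<^sup>+\<close> is needed.  Conversely, the diagonal
  and diagram automorphisms are compatible with the coproduct because the quantum Serre elements
  generate a Hopf ideal.
\<close>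

text \<open>Nonvanishing in the quotients rests on functionals on words that kill the relators. One
  family gives the coefficient of a monomial \<open>K^\<mu>\<close> under the projection that kills
  every \<open>E_i\<close>; another is the corner entry of a triangular two-dimensional
  representation, which shows that each \<open>E_j\<close> survives in the Borel algebra and
  therefore in the positive part. The first family also produces the coactions. Applied to the right
  or the left leg of the coproduct it becomes the projection to a degree in which \<open>K_i\<close>
  has the simple root as weight, and \<open>E_i\<close> has weight 0 on the right and the simple
  root on the left. The difference of the two degrees is the root grading, so an image that is
  homogeneous for both is a weight vector. The main computation is the compatibility of the
  coproduct with the Serre relations. It avoids a binomial expansion of the coproduct: the Serre sum
  is factored into q-commutators, and the invariance of Gaussian binomials under \<open>t\<close> to
  \<open>inverse t\<close> allows the factors to be taken in either order.\<close>

lemma smul_apply: "smul c f x = c * f x"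
  by (simp add: smul_def)

declare plus_fun_apply [simp del] zero_fun_apply [simp del] minus_apply [simp del] uminus_apply [simp del]

lemmas fun_apply = plus_fun_apply zero_fun_apply minus_apply uminus_apply smul_apply

text \<open>Functions are treated as vectors. The pointwise simp rules are switched off above, so
  that the theory of abstract vector spaces applies, and \<open>fun_apply\<close> brings them back
  where a computation is pointwise.\<close>

interpretation fv: vector_space "smul :: 'k::field \<Rightarrow> ('x \<Rightarrow> 'k) \<Rightarrow> 'x \<Rightarrow> 'k"
  by unfold_locales (auto simp: fun_apply fun_eq_iff algebra_simps)

lemma sum_fun_apply: "(\<Sum>i\<in>A. f i) x = (\<Sum>i\<in>A. f i x)"
  by (induction A rule: infinite_finite_induct) (auto simp: fun_apply)

section \<open>Finitely supported functions as combinations of point masses\<close>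

definition kron :: "'x \<Rightarrow> 'x \<Rightarrow> 'k::zero_neq_one" where
  "kron x = (\<lambda>y. if y = x then 1 else 0)"

lemma ncword_kron: "ncword u = kron u"
  by (simp add: ncword_def kron_def)

lemma ncgen_kron: "ncgen i = kron [i]"
  by (simp add: ncgen_def ncword_kron)

lemma ncone_kron: "ncone = kron []"
  by (simp add: ncone_def kron_def)

lemma supp_kron [simp]: "supp (kron x :: 'x \<Rightarrow> 'k::zero_neq_one) = {x}"
  by (auto simp: supp_def kron_def)

definition fsupp :: "'x set \<Rightarrow> ('x \<Rightarrow> 'k::zero) set" where
  "fsupp A = {f. finite (supp f) \<and> supp f \<subseteq> A}"

definition words :: "nat \<Rightarrow> nat list set" where
  "words N = {w. set w \<subseteq> {..<N}}"

lemma words_simps [simp]: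
  "[] \<in> words N" "x # w \<in> words N \<longleftrightarrow> x < N \<and> w \<in> words N"
  "u @ v \<in> words N \<longleftrightarrow> u \<in> words N \<and> v \<in> words N"
  by (auto simp: words_def)

lemma fs_fsupp: "fs N = fsupp (words N)"
  unfolding fs_def fsupp_def words_def by blast

lemma fs2_fsupp: "fs2 N = fsupp (words N \<times> words N)"
  unfolding fs2_def fsupp_def words_def by (auto simp: subset_iff split: prod.splits)

lemma supp_add: "supp (f + g :: _ \<Rightarrow> 'k::field) \<subseteq> supp f \<union> supp g"
  by (auto simp: fun_apply supp_def)

lemma supp_smul: "supp (smul c f :: _ \<Rightarrow> 'k::field) \<subseteq> supp f"
  by (auto simp: fun_apply supp_def)

lemma subspace_fsupp [intro, simp]: "fv.subspace (fsupp A :: ('x \<Rightarrow> 'k::field) set)"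
proof (rule fv.subspaceI)
  show "(0 :: 'x \<Rightarrow> 'k) \<in> fsupp A" by (simp add: fun_apply fsupp_def supp_def)
  show "f + g \<in> fsupp A" if "f \<in> fsupp A" "g \<in> fsupp A" for f g :: "'x \<Rightarrow> 'k"
    using that supp_add[of f g] finite_subset[OF supp_add[of f g]] by (auto simp: fsupp_def)
  show "smul c f \<in> fsupp A" if "f \<in> fsupp A" for c and f :: "'x \<Rightarrow> 'k"
    using that supp_smul[of c f] finite_subset[OF supp_smul[of c f]] by (auto simp: fsupp_def)
qed

lemma kron_in_fsupp [simp]: "kron x \<in> fsupp A \<longleftrightarrow> x \<in> A"
  by (auto simp: fsupp_def)

lemma fsupp_eq_sum:
  fixes f :: "'x \<Rightarrow> 'k::field"
  assumes "f \<in> fsupp A"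
  shows "f = (\<Sum>x\<in>supp f. smul (f x) (kron x))"
proof
  fix y
  have fin: "finite (supp f)" using assms by (simp add: fsupp_def)
  have "(\<Sum>x\<in>supp f. smul (f x) (kron x)) y = (\<Sum>x\<in>supp f. if x = y then f x else 0)"
    by (auto simp: fun_apply sum_fun_apply kron_def intro!: sum.cong)
  also have "\<dots> = f y" using fin by (auto simp: fun_apply supp_def)
  finally show "f y = (\<Sum>x\<in>supp f. smul (f x) (kron x)) y" by simp
qed

lemma fsupp_in_subspace:
  assumes "f \<in> fsupp A" "fv.subspace S" "\<And>x. x \<in> A \<Longrightarrow> kron x \<in> S"
  shows "f \<in> (S :: ('x \<Rightarrow> 'k::field) set)"
proof -
  have "(\<Sum>x\<in>supp f. smul (f x) (kron x)) \<in> S"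
    using assms by (auto intro!: fv.subspace_sum fv.subspace_scale simp: fsupp_def)
  then show ?thesis using fsupp_eq_sum[OF assms(1)] by simp
qed

text \<open>The functions with \<open>P\<close> form a subspace that contains the point masses. Most
  linear and bilinear identities below are thereby reduced to words or pairs of words.\<close>

lemma fsupp_induct [consumes 1, case_names zero add smul kron]:
  fixes f :: "'x \<Rightarrow> 'k::field"
  assumes f: "f \<in> fsupp A" and z: "P 0"
    and add: "\<And>f g. f \<in> fsupp A \<Longrightarrow> g \<in> fsupp A \<Longrightarrow> P f \<Longrightarrow> P g \<Longrightarrow> P (f + g)"
    and smul: "\<And>c f. f \<in> fsupp A \<Longrightarrow> P f \<Longrightarrow> P (smul c f)"
    and kron: "\<And>x. x \<in> A \<Longrightarrow> P (kron x)"
  shows "P f"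
proof -
  have "f \<in> {f \<in> fsupp A. P f}"
    by (rule fsupp_in_subspace[OF f])
      (auto intro!: fv.subspaceI add smul kron z fv.subspace_0[OF subspace_fsupp]
        fv.subspace_add[OF subspace_fsupp] fv.subspace_scale[OF subspace_fsupp])
  then show ?thesis by simp
qed

section \<open>Linear extension\<close>

text \<open>The coproduct, the tensor square of a map, the slices and the lift of an automorphism
  are all instances of this operator and share its additivity lemmas.\<close>

definition lin :: "('x \<Rightarrow> 'y \<Rightarrow> 'k) \<Rightarrow> ('x \<Rightarrow> 'k::field) \<Rightarrow> 'y \<Rightarrow> 'k" where
  "lin h f = (\<lambda>y. \<Sum>x\<in>supp f. f x * h x y)"

lemma lin_sum: "lin h f = (\<Sum>x\<in>supp f. smul (f x) (h x))"
  by (auto simp: fun_apply lin_def sum_fun_apply)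

lemma lin_superset: "finite B \<Longrightarrow> supp f \<subseteq> B \<Longrightarrow> lin h f = (\<Sum>x\<in>B. smul (f x) (h x))"
  unfolding lin_sum by (rule sum.mono_neutral_left) (auto simp: fun_apply supp_def fun_eq_iff)

lemma lin_add: "f \<in> fsupp A \<Longrightarrow> g \<in> fsupp A \<Longrightarrow> lin h (f + g) = lin h f + lin h g"
  using supp_add[of f g]
  by (simp add: lin_superset[of "supp f \<union> supp g"] fsupp_def fun_apply fv.scale_left_distrib sum.distrib)

lemma lin_smul: "lin h (smul c f) = smul c (lin h f)"
  by (cases "c = 0") (auto simp: fun_apply lin_def supp_def fun_eq_iff sum_distrib_left mult.assoc)

lemma lin_zero [simp]: "lin h 0 = 0"
  by (simp add: fun_apply lin_def supp_def fun_eq_iff)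

lemma lin_diff: "f \<in> fsupp A \<Longrightarrow> g \<in> fsupp A \<Longrightarrow> lin h (f - g) = lin h f - lin h g"
  using lin_add[of f A "smul (-1) g" h] lin_smul[of h "-1" g]
    fv.subspace_scale[OF subspace_fsupp, of g A "-1"]
  by simp

lemma lin_kron [simp]: "lin h (kron x) = h x"
  by (simp add: lin_def kron_def fun_eq_iff supp_kron[unfolded kron_def])

lemma lin_kron_id: "f \<in> fsupp A \<Longrightarrow> lin kron f = f"
  using fsupp_eq_sum[of f A] by (simp add: lin_sum)

lemma lin_in_subspace:
  "f \<in> fsupp A \<Longrightarrow> fv.subspace S \<Longrightarrow> (\<And>x. x \<in> A \<Longrightarrow> h x \<in> S) \<Longrightarrow> lin h f \<in> S"
  unfolding lin_sum by (auto intro!: fv.subspace_sum fv.subspace_scale simp: fsupp_def)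

lemma lin_in_fsupp: "f \<in> fsupp A \<Longrightarrow> (\<And>x. x \<in> A \<Longrightarrow> h x \<in> fsupp B) \<Longrightarrow> lin h f \<in> fsupp B"
  by (rule lin_in_subspace) auto

lemma lin_cong: "f \<in> fsupp A \<Longrightarrow> (\<And>x. x \<in> A \<Longrightarrow> h x = h' x) \<Longrightarrow> lin h f = lin h' f"
  unfolding lin_sum by (rule sum.cong) (auto simp: fsupp_def)

definition ev :: "('x \<Rightarrow> 'k) \<Rightarrow> ('x \<Rightarrow> 'k::field) \<Rightarrow> 'k" where
  "ev p f = (\<Sum>x\<in>supp f. f x * p x)"

lemma ev_lin: "ev p f = lin (\<lambda>x _. p x) f ()"
  by (simp add: ev_def lin_def)

lemma ev_add: "f \<in> fsupp A \<Longrightarrow> g \<in> fsupp A \<Longrightarrow> ev p (f + g) = ev p f + ev p g"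
  by (simp add: fun_apply ev_lin lin_add)

lemma ev_diff: "f \<in> fsupp A \<Longrightarrow> g \<in> fsupp A \<Longrightarrow> ev p (f - g) = ev p f - ev p g"
  by (simp add: fun_apply ev_lin lin_diff)

lemma ev_smul: "ev p (smul c f) = c * ev p f"
  by (simp add: fun_apply ev_lin lin_smul)

lemma ev_zero [simp]: "ev p 0 = 0"
  by (simp add: fun_apply ev_lin)

lemma ev_kron [simp]: "ev p (kron x) = p x"
  by (simp add: fun_apply ev_lin)

section \<open>Products on the free algebra and on its tensor square\<close>

text \<open>Both products are convolutions over the decompositions of a word. The recursion on the
  first letter is easier to use than the sums over cut positions in \<open>ncmul_def\<close> and
  \<open>mul2_def\<close>.\<close>

definition splits :: "'l list \<Rightarrow> ('l list \<Rightarrow> 'l list \<Rightarrow> 'k::comm_monoid_add) \<Rightarrow> 'k" where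
  "splits w f = (\<Sum>k\<le>length w. f (take k w) (drop k w))"

lemma splits_Nil [simp]: "splits [] f = f [] []"
  by (simp add: splits_def)

lemma splits_Cons [simp]: "splits (x # w) f = f [] (x # w) + splits w (\<lambda>u v. f (x # u) v)"
  unfolding splits_def length_Cons by (subst sum.atMost_Suc_shift) simp

lemma splits_add: "splits w (\<lambda>u v. f u v + g u v) = splits w f + splits w g"
  by (simp add: splits_def sum.distrib)

lemma splits_mult_left: "splits w (\<lambda>u v. c * f u v) = (c :: 'k::comm_ring_1) * splits w f"
  by (simp add: splits_def sum_distrib_left)

lemma splits_mult_right: "splits w (\<lambda>u v. f u v * c) = splits w f * (c :: 'k::comm_ring_1)"
  by (simp add: splits_def sum_distrib_right)

lemma splits_zero [simp]: "splits w (\<lambda>u v. 0) = 0"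
  by (simp add: splits_def)

lemma splits_swap: "splits w (\<lambda>a b. splits u (\<lambda>c d. f a b c d)) = splits u (\<lambda>c d. splits w (\<lambda>a b. f a b c d))"
  unfolding splits_def by (rule sum.swap)

text \<open>Both sides run over the decompositions of \<open>w\<close> into three consecutive words:
  deconcatenation is coassociative.\<close>

lemma splits_assoc: "splits w (\<lambda>a b. splits a (\<lambda>c d. f c d b)) = splits w (\<lambda>c e. splits e (\<lambda>d b. f c d b))"
proof (induction w arbitrary: f)
  case (Cons x w)
  then show ?case by (simp add: splits_add add.assoc)
qed simp

lemma splits_cong: "(\<And>u v. u @ v = w \<Longrightarrow> f u v = g u v) \<Longrightarrow> splits w f = splits w g"
  unfolding splits_def by (rule sum.cong) auto

lemma splits_indicator:
  "splits w (\<lambda>u v. if u = a \<and> v = b then c else 0) = (if w = a @ b then (c :: 'k::comm_ring_1) else 0)"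
proof (induction w arbitrary: a)
  case (Cons x w)
  show ?case
  proof (cases a)
    case (Cons y a')
    have "splits w (\<lambda>u v. if x # u = a \<and> v = b then c else 0)
        = (if x = y then splits w (\<lambda>u v. if u = a' \<and> v = b then c else 0) else 0)"
      by (simp add: Cons)
    with Cons.IH[of a'] Cons show ?thesis by auto
  qed auto
qed auto

lemma ncmul_splits: "ncmul f g w = splits w (\<lambda>u v. f u * g v)"
  by (simp add: ncmul_def splits_def)

lemma mul2_splits: "mul2 chi F G (u, v) =
    splits u (\<lambda>a b. splits v (\<lambda>c d. chiw chi c b * F (a, c) * G (b, d)))"
  by (simp add: mul2_def splits_def)

lemma chiw_Nil [simp]: "chiw chi [] b = 1" "chiw chi a [] = 1"
  by (auto simp: chiw_def, induction a, auto)

lemma chiw_append_left: "chiw chi (a @ a') b = chiw chi a b * chiw chi a' b"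
  by (simp add: chiw_def)

lemma chiw_Cons_left: "chiw chi (x # a) b = chiw chi [x] b * chiw chi a b"
  by (simp add: chiw_def)

lemma chiw_append_right: "chiw chi a (b @ b') = chiw chi a b * (chiw chi a b' :: 'k::comm_ring_1)"
proof (induction a)
  case (Cons x a)
  have "chiw chi [x] (b @ b') = chiw chi [x] b * chiw chi [x] b'" by (simp add: chiw_def)
  with Cons show ?case by (subst (1 2 3) chiw_Cons_left) simp
qed (simp add: chiw_def)

lemma ncmul_assoc: "ncmul (ncmul f g) h = ncmul f (ncmul g h)"
proof
  fix w
  have "ncmul (ncmul f g) h w = splits w (\<lambda>a b. splits a (\<lambda>c d. f c * g d * h b))"
    by (simp add: ncmul_splits splits_mult_right)
  also have "\<dots> = splits w (\<lambda>c e. splits e (\<lambda>d b. f c * (g d * h b)))"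
    by (subst splits_assoc) (simp add: mult.assoc)
  also have "\<dots> = ncmul f (ncmul g h) w"
    by (simp add: ncmul_splits splits_mult_left)
  finally show "ncmul (ncmul f g) h w = ncmul f (ncmul g h) w" .
qed

text \<open>The character \<open>chiw\<close> is multiplicative in both arguments, so either
  bracketing carries the factor \<open>chi(c1,a2) chi(c1,b) chi(c2,b)\<close>: each piece of a
  second leg moves past every later piece of a first leg.\<close>

lemma mul2_assoc: "mul2 chi (mul2 chi F G) H = mul2 chi F (mul2 chi G H)"
proof
  fix p :: "nat list \<times> nat list"
  obtain u v where p: "p = (u, v)" by (cases p)
  let ?f = "\<lambda>a1 a2 b c1 c2 d. chiw chi c1 a2 * chiw chi c1 b * chiw chi c2 b * F (a1, c1) * G (a2, c2) * H (b, d)"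
  have "mul2 chi (mul2 chi F G) H (u, v) =
     splits u (\<lambda>a b. splits v (\<lambda>c d. splits a (\<lambda>a1 a2. splits c (\<lambda>c1 c2. chiw chi c b * (chiw chi c1 a2 * F (a1, c1) * G (a2, c2)) * H (b, d)))))"
    by (simp add: mul2_splits splits_mult_left splits_mult_right)
  also have "\<dots> = splits u (\<lambda>a b. splits v (\<lambda>c d. splits a (\<lambda>a1 a2. splits c (\<lambda>c1 c2. ?f a1 a2 b c1 c2 d))))"
    by (intro splits_cong) (auto simp: chiw_append_left)
  also have "\<dots> = splits u (\<lambda>a b. splits a (\<lambda>a1 a2. splits v (\<lambda>c d. splits c (\<lambda>c1 c2. ?f a1 a2 b c1 c2 d))))"
    by (subst splits_swap) simp
  also have "\<dots> = splits u (\<lambda>a1 e. splits e (\<lambda>a2 b. splits v (\<lambda>c1 g. splits g (\<lambda>c2 d. ?f a1 a2 b c1 c2 d))))"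
    by (subst splits_assoc) (subst splits_assoc, rule refl)
  also have "\<dots> = splits u (\<lambda>a1 e. splits v (\<lambda>c1 g. splits e (\<lambda>a2 b. splits g (\<lambda>c2 d. ?f a1 a2 b c1 c2 d))))"
    by (subst (2) splits_swap) simp
  also have "\<dots> = splits u (\<lambda>a1 e. splits v (\<lambda>c1 g. splits e (\<lambda>a2 b. splits g (\<lambda>c2 d.
      chiw chi c1 e * F (a1, c1) * (chiw chi c2 b * G (a2, c2) * H (b, d))))))"
    by (intro splits_cong) (auto simp: chiw_append_right mult_ac)
  also have "\<dots> = mul2 chi F (mul2 chi G H) (u, v)"
    by (simp add: mul2_splits splits_mult_left)
  finally show "mul2 chi (mul2 chi F G) H p = mul2 chi F (mul2 chi G H) p" by (simp add: p)
qed

lemma ncmul_add_left: "ncmul (f + g) h = ncmul f h + ncmul g h"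
  by (auto simp: fun_apply fun_eq_iff ncmul_splits splits_add distrib_right)
lemma ncmul_add_right: "ncmul h (f + g) = ncmul h f + ncmul h g"
  by (auto simp: fun_apply fun_eq_iff ncmul_splits splits_add distrib_left)
lemma ncmul_smul_left: "ncmul (smul c f) h = smul c (ncmul f h)"
  by (auto simp: fun_apply fun_eq_iff ncmul_splits splits_mult_left[symmetric] mult.assoc)
lemma ncmul_smul_right: "ncmul h (smul c f) = smul c (ncmul h f)"
  by (auto simp: fun_apply fun_eq_iff ncmul_splits splits_mult_left[symmetric] mult_ac)
lemma ncmul_zero [simp]: "ncmul 0 f = 0" "ncmul f 0 = 0"
  by (auto simp: fun_apply fun_eq_iff ncmul_splits)

lemma mul2_add_left: "mul2 chi (f + g) h = mul2 chi f h + mul2 chi g h"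
  by (rule ext) (auto simp: fun_apply mul2_splits splits_add[symmetric] algebra_simps)
lemma mul2_add_right: "mul2 chi h (f + g) = mul2 chi h f + mul2 chi h g"
  by (rule ext) (auto simp: fun_apply mul2_splits splits_add[symmetric] algebra_simps)
lemma mul2_smul_left: "mul2 chi (smul c f) h = smul c (mul2 chi f h)"
  by (rule ext) (auto simp: fun_apply mul2_splits splits_mult_left[symmetric] mult_ac)
lemma mul2_smul_right: "mul2 chi h (smul c f) = smul c (mul2 chi h f)"
  by (rule ext) (auto simp: fun_apply mul2_splits splits_mult_left[symmetric] mult_ac)
lemma mul2_zero [simp]: "mul2 chi 0 f = 0" "mul2 chi f 0 = 0"
  by (rule ext, auto simp: mul2_splits fun_apply)+

lemma ncmul_kron: "ncmul (kron a) (kron b) = (kron (a @ b) :: 'k::comm_ring_1 ncp)"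
proof
  fix w
  have "ncmul (kron a) (kron b) w = splits w (\<lambda>u v. if u = a \<and> v = b then 1 else (0::'k))"
    unfolding ncmul_splits by (rule splits_cong) (auto simp: kron_def)
  then show "ncmul (kron a) (kron b) w = (kron (a @ b) w :: 'k)"
    by (simp add: splits_indicator kron_def)
qed

lemma mul2_kron:
  "mul2 chi (kron (a, b)) (kron (c, d)) = smul (chiw chi b c) (kron (a @ c, b @ d))"
proof
  fix p :: "nat list \<times> nat list"
  obtain u v where p: "p = (u, v)" by (cases p)
  have "mul2 chi (kron (a, b)) (kron (c, d)) (u, v) =
     splits u (\<lambda>x y. splits v (\<lambda>z w. if z = b \<and> w = d then if x = a \<and> y = c then chiw chi b c else 0 else 0))"
    unfolding mul2_splits by (intro splits_cong) (auto simp: kron_def)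
  also have "\<dots> = splits u (\<lambda>x y. if x = a \<and> y = c then if v = b @ d then chiw chi b c else 0 else 0)"
    by (intro splits_cong) (simp add: splits_indicator)
  finally show "mul2 chi (kron (a, b)) (kron (c, d)) p = smul (chiw chi b c) (kron (a @ c, b @ d)) p"
    by (simp add: fun_apply p splits_indicator kron_def)
qed

lemma tens_kron: "tens (kron u) (kron v) = (kron (u, v) :: 'k::comm_ring_1 ncp2)"
  by (auto simp: fun_apply tens_def kron_def fun_eq_iff)

lemma tens_add_left: "tens (f + g :: 'k::field ncp) h = tens f h + tens g h"
  by (auto simp: fun_apply tens_def fun_eq_iff distrib_right)
lemma tens_add_right: "tens h (f + g :: 'k::field ncp) = tens h f + tens h g"
  by (auto simp: fun_apply tens_def fun_eq_iff distrib_left)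
lemma tens_smul_left: "tens (smul c f :: 'k::field ncp) h = smul c (tens f h)"
  by (auto simp: fun_apply tens_def fun_eq_iff)
lemma tens_smul_right: "tens h (smul c f :: 'k::field ncp) = smul c (tens h f)"
  by (auto simp: fun_apply tens_def fun_eq_iff)
lemma tens_zero [simp]: "tens (0 :: 'k::field ncp) f = 0" "tens f (0 :: 'k::field ncp) = 0"
  by (auto simp: fun_apply tens_def fun_eq_iff)
lemma tens_diff_left: "tens (f - g :: 'k::field ncp) h = tens f h - tens g h"
  by (auto simp: fun_apply tens_def fun_eq_iff left_diff_distrib)
lemma tens_diff_right: "tens h (f - g :: 'k::field ncp) = tens h f - tens h g"
  by (auto simp: fun_apply tens_def fun_eq_iff right_diff_distrib)

lemma ncone_left [simp]: "f \<in> fs N \<Longrightarrow> ncmul ncone f = (f :: 'k::field ncp)"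
  unfolding fs_fsupp by (induction rule: fsupp_induct)
    (auto simp: ncmul_add_right ncmul_smul_right ncone_kron ncmul_kron)

lemma ncone_right [simp]: "f \<in> fs N \<Longrightarrow> ncmul f ncone = (f :: 'k::field ncp)"
  unfolding fs_fsupp by (induction rule: fsupp_induct)
    (auto simp: ncmul_add_left ncmul_smul_left ncone_kron ncmul_kron)

lemma subspace_fs [simp]: "fv.subspace (fs N :: 'k::field ncp set)"
  and subspace_fs2 [simp]: "fv.subspace (fs2 N :: 'k::field ncp2 set)"
  by (simp_all add: fs_fsupp fs2_fsupp)

lemma kron_in_fs [simp]: "kron w \<in> (fs N :: 'k::field ncp set) \<longleftrightarrow> w \<in> words N"
  by (simp add: fs_fsupp)

lemma kron_in_fs2 [simp]: "kron p \<in> (fs2 N :: 'k::field ncp2 set) \<longleftrightarrow> p \<in> words N \<times> words N"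
  by (simp add: fs2_fsupp)

lemma fs_induct [consumes 1, case_names zero add smul kron]:
  fixes f :: "'k::field ncp"
  assumes "f \<in> fs N" and "P 0"
    and "\<And>f g. f \<in> fs N \<Longrightarrow> g \<in> fs N \<Longrightarrow> P f \<Longrightarrow> P g \<Longrightarrow> P (f + g)"
    and "\<And>c f. f \<in> fs N \<Longrightarrow> P f \<Longrightarrow> P (smul c f)"
    and "\<And>x. x \<in> words N \<Longrightarrow> P (kron x)"
  shows "P f"
  using assms unfolding fs_fsupp by (rule fsupp_induct)

lemma fs2_induct [consumes 1, case_names zero add smul kron]:
  fixes f :: "'k::field ncp2"
  assumes "f \<in> fs2 N" and "P 0"
    and "\<And>f g. f \<in> fs2 N \<Longrightarrow> g \<in> fs2 N \<Longrightarrow> P f \<Longrightarrow> P g \<Longrightarrow> P (f + g)"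
    and "\<And>c f. f \<in> fs2 N \<Longrightarrow> P f \<Longrightarrow> P (smul c f)"
    and "\<And>x. x \<in> words N \<times> words N \<Longrightarrow> P (kron x)"
  shows "P f"
  using assms unfolding fs2_fsupp by (rule fsupp_induct)

lemmas fs_add [simp] = fv.subspace_add[OF subspace_fs]
  and fs_smul [simp] = fv.subspace_scale[OF subspace_fs]
  and fs_diff [simp] = fv.subspace_diff[OF subspace_fs]
  and fs_zero [simp] = fv.subspace_0[OF subspace_fs]
  and fs2_add [simp] = fv.subspace_add[OF subspace_fs2]
  and fs2_smul [simp] = fv.subspace_scale[OF subspace_fs2]
  and fs2_diff [simp] = fv.subspace_diff[OF subspace_fs2]
  and fs2_zero [simp] = fv.subspace_0[OF subspace_fs2]

lemma ncmul_in_fs [simp]: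
  assumes "f \<in> fs N" "g \<in> fs N"
  shows "ncmul f g \<in> (fs N :: 'k::field ncp set)"
  using assms(1)
proof (induction rule: fs_induct)
  case (kron x)
  from assms(2) show ?case
    by (induction rule: fs_induct)
      (use kron in \<open>auto simp: ncmul_add_right ncmul_smul_right ncmul_kron\<close>)
qed (auto simp: ncmul_add_left ncmul_smul_left)

lemma mul2_in_fs2 [simp]:
  assumes "f \<in> fs2 N" "g \<in> fs2 N"
  shows "mul2 chi f g \<in> (fs2 N :: 'k::field ncp2 set)"
  using assms(1)
proof (induction rule: fs2_induct)
  case (kron x)
  from assms(2) show ?case
    by (induction rule: fs2_induct)
      (use kron in \<open>auto simp: mul2_add_right mul2_smul_right mul2_kron intro!: fs2_smul\<close>)
qed (auto simp: mul2_add_left mul2_smul_left)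

lemma tens_in_fs2 [simp]:
  assumes "f \<in> fs N" "g \<in> fs N"
  shows "tens f g \<in> (fs2 N :: 'k::field ncp2 set)"
  using assms(1)
proof (induction rule: fs_induct)
  case (kron x)
  from assms(2) show ?case
    by (induction rule: fs_induct)
      (use kron in \<open>auto simp: tens_add_right tens_smul_right tens_kron\<close>)
qed (auto simp: tens_add_left tens_smul_left)

lemma ncone_in_fs [simp]: "ncone \<in> (fs N :: 'k::field ncp set)"
  by (simp add: ncone_kron)

lemma ncgen_in_fs [simp]: "i < N \<Longrightarrow> ncgen i \<in> (fs N :: 'k::field ncp set)"
  by (simp add: ncgen_kron)

section \<open>Quantum Serre sums\<close>

lemma qint_0 [simp]: "qint t 0 = 0" and qint_1 [simp]: "qint t (Suc 0) = 1"
  by (simp_all add: qint_def)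

text \<open>The sum splits at index \<open>a\<close>, and each block is a shifted copy of a
  q-integer. This asymmetric addition law is the source of the Pascal rule below.\<close>

lemma qint_add:
  assumes "t \<noteq> (0 :: 'k::field)"
  shows "qint t (a + b) = t powi int b * qint t a + t powi (- int a) * qint t b"
proof -
  have split: "(\<Sum>j<a + b. f j) = (\<Sum>j<a. f j) + (\<Sum>j<b. f (a + j))" for f :: "nat \<Rightarrow> 'k"
    by (induction b) (auto simp: add.assoc)
  have "qint t (a + b) = (\<Sum>j<a. t powi (int (a + b) - 1 - 2 * int j))
      + (\<Sum>j<b. t powi (int (a + b) - 1 - 2 * int (a + j)))"
    unfolding qint_def by (rule split)
  also have "(\<Sum>j<a. t powi (int (a + b) - 1 - 2 * int j)) = t powi int b * qint t a"
    unfolding qint_def sum_distrib_left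
    by (rule sum.cong) (auto simp: power_int_add[symmetric] assms algebra_simps simp del: power_int_of_nat)
  also have "(\<Sum>j<b. t powi (int (a + b) - 1 - 2 * int (a + j))) = t powi (- int a) * qint t b"
    unfolding qint_def sum_distrib_left
    by (rule sum.cong) (auto simp: power_int_add[symmetric] assms algebra_simps simp del: power_int_of_nat)
  finally show ?thesis .
qed

text \<open>Reversing the order of summation negates all exponents. The resulting symmetry of the
  Gaussian binomials later reverses the order of the factors of a Serre sum.\<close>

lemma qint_inverse: "qint (inverse t) k = qint (t :: 'k::field) k"
proof -
  have "qint (inverse t) k = (\<Sum>j<k. t powi (2 * int j + 1 - int k))"
    unfolding qint_def by (rule sum.cong) (auto simp: power_int_inverse power_int_minus[symmetric] algebra_simps)
  also have "\<dots> = (\<Sum>j<k. t powi (2 * int (k - Suc j) + 1 - int k))"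
    by (rule sum.nat_diff_reindex[symmetric])
  also have "\<dots> = qint t k"
    unfolding qint_def by (rule sum.cong) (auto simp: of_nat_diff algebra_simps)
  finally show ?thesis .
qed

lemma qbinom_inverse: "qbinom (inverse t) m v = qbinom (t :: 'k::field) m v"
  by (simp add: qbinom_def qfact_def qint_inverse)

lemma qint_mult:
  assumes "t \<noteq> (0 :: 'k::field)"
  shows "qint t k * (t - inverse t) = t powi int k - t powi (- int k)"
proof (induction k)
  case (Suc k)
  have "qint t (Suc k) * (t - inverse t)
      = t * (qint t k * (t - inverse t)) + t powi (- int k) * (t - inverse t)"
    using qint_add[OF assms, of k 1] by (simp add: algebra_simps)
  also have "\<dots> = t powi int (Suc k) - t powi (- int (Suc k))"
  proof -
    have "t powi int (Suc k) = t * t ^ k" "t powi (- int (Suc k)) = inverse (t * t ^ k)"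
      "t powi int k = t ^ k" "t powi (- int k) = inverse (t ^ k)"
      by (simp_all only: power_int_minus power_int_of_nat power_Suc)
    then show ?thesis using assms by (simp only: Suc) (simp add: field_simps)
  qed
  finally show ?case .
qed simp

lemma qint_nonzero:
  assumes "t \<noteq> (0 :: 'k::field)" "t ^ (2 * k) \<noteq> 1"
  shows "qint t k \<noteq> 0"
proof
  assume "qint t k = 0"
  then have "t ^ k - inverse (t ^ k) = 0"
    using qint_mult[OF assms(1), of k] by (simp add: power_int_minus)
  then have "t ^ k * t ^ k = 1" using assms(1) by (simp add: field_simps)
  then show False using assms(2) by (simp add: mult_2 power_add)
qed

lemma qfact_Suc: "qfact t (Suc k) = qfact t k * qint t (Suc k)"
  by (simp add: qfact_def mult.commute)

lemma qfact_0 [simp]: "qfact t 0 = 1"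
  by (simp add: qfact_def)

lemma qfact_nonzero: "(\<And>j. 1 \<le> j \<Longrightarrow> j \<le> k \<Longrightarrow> qint t j \<noteq> 0) \<Longrightarrow> qfact t k \<noteq> 0"
  by (auto simp: qfact_def)

text \<open>The signed Serre coefficient, cut off beyond \<open>m\<close>. The cutoff has content:
  by truncated subtraction \<open>qbinom t m (Suc m)\<close> need not vanish, and the Pascal rule is
  used at \<open>v = m\<close>.\<close>

definition qcf :: "'k::field \<Rightarrow> nat \<Rightarrow> nat \<Rightarrow> 'k" where
  "qcf t m v = (if v \<le> m then qbinom t m v * (-1) ^ v else 0)"

lemma qcf_0: "(\<And>j. 1 \<le> j \<Longrightarrow> j \<le> m \<Longrightarrow> qint t j \<noteq> 0) \<Longrightarrow> qcf t m 0 = 1"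
  using qfact_nonzero[of m t] by (simp add: qcf_def qbinom_def)

text \<open>Expand \<open>[m+1] = [(v+1) + (m-v)]\<close> by the addition law and divide by the
  q-factorials. These must be invertible, hence the assumption on \<open>qint t j\<close> up to
  \<open>Suc m\<close>.\<close>

lemma qcf_pascal:
  assumes t: "t \<noteq> (0 :: 'k::field)" and nz: "\<And>j. 1 \<le> j \<Longrightarrow> j \<le> Suc m \<Longrightarrow> qint t j \<noteq> 0" and v: "v \<le> m"
  shows "qcf t (Suc m) (Suc v) = t powi (- int (Suc v)) * qcf t m (Suc v) - t powi (int m - int v) * qcf t m v"
proof (cases "v = m")
  case True
  have "qfact t m \<noteq> 0" "qfact t (Suc m) \<noteq> 0" using nz by (auto intro!: qfact_nonzero)
  with True show ?thesis by (simp add: qcf_def qbinom_def)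
next
  case False
  then obtain u where m: "m = Suc (v + u)" using v by (metis le_neq_implies_less less_imp_Suc_add)
  have nzs: "qfact t v \<noteq> 0" "qfact t u \<noteq> 0" "qint t (Suc u) \<noteq> 0" "qint t (Suc v) \<noteq> 0"
    using nz by (auto intro!: qfact_nonzero simp: m)
  have q: "qint t (Suc m) = t powi (- int (Suc v)) * qint t (Suc u) + t powi int (Suc u) * qint t (Suc v)"
    using qint_add[OF t, of "Suc v" "Suc u"] by (simp add: m)
  have e: "int m - int v = int (Suc u)" "Suc m - Suc v = Suc u" "m - Suc v = u" "m - v = Suc u" by (auto simp: m)
  have "qbinom t (Suc m) (Suc v) = t powi (- int (Suc v)) * qbinom t m (Suc v) + t powi (int m - int v) * qbinom t m v"
    unfolding qbinom_def e qfact_Suc[of t m] q qfact_Suc[of t u] qfact_Suc[of t v]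
    using nzs by (simp add: field_simps)
  then show ?thesis using v m by (simp add: qcf_def algebra_simps)
qed

text \<open>The Serre sum for an arbitrary product \<open>mul\<close>, since it is needed both in
  the free algebra and in its tensor square. The parameter \<open>s\<close> is 1 in the Serre
  relation; it is carried along because splitting off a factor rescales it.\<close>

definition srr :: "(('x \<Rightarrow> 'k) \<Rightarrow> ('x \<Rightarrow> 'k) \<Rightarrow> 'x \<Rightarrow> 'k) \<Rightarrow> 'k::field \<Rightarrow> 'k \<Rightarrow> nat \<Rightarrow> ('x \<Rightarrow> 'k) \<Rightarrow> ('x \<Rightarrow> 'k) \<Rightarrow> 'x \<Rightarrow> 'k" where
  "srr mul t s m X Y =
     (\<Sum>v\<le>m. smul (qcf t m v * s ^ v) ((mul X ^^ (m - v)) (((\<lambda>y. mul y X) ^^ v) Y)))"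

definition qad :: "(('x \<Rightarrow> 'k) \<Rightarrow> ('x \<Rightarrow> 'k) \<Rightarrow> 'x \<Rightarrow> 'k) \<Rightarrow> ('x \<Rightarrow> 'k) \<Rightarrow> 'k::field \<Rightarrow> ('x \<Rightarrow> 'k) \<Rightarrow> 'x \<Rightarrow> 'k" where
  "qad mul X c Y = mul X Y - smul c (mul Y X)"

text \<open>Iterated q-commutators with varying scalars; \<open>f 0\<close> belongs to the innermost
  one.\<close>

primrec qads :: "(('x \<Rightarrow> 'k) \<Rightarrow> ('x \<Rightarrow> 'k) \<Rightarrow> 'x \<Rightarrow> 'k) \<Rightarrow> ('x \<Rightarrow> 'k) \<Rightarrow> (nat \<Rightarrow> 'k::field) \<Rightarrow> nat \<Rightarrow> ('x \<Rightarrow> 'k) \<Rightarrow> 'x \<Rightarrow> 'k" where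
  "qads mul X f 0 Y = Y"
| "qads mul X f (Suc k) Y = qad mul X (f k) (qads mul X f k Y)"

lemma srr_inverse: "srr mul (inverse t) s m X Y = srr mul t s m X Y"
  by (simp add: srr_def qcf_def qbinom_inverse)

locale bilin_assoc =
  fixes mul :: "('x \<Rightarrow> 'k::field) \<Rightarrow> ('x \<Rightarrow> 'k) \<Rightarrow> 'x \<Rightarrow> 'k"
  assumes mul_assoc: "mul (mul x y) z = mul x (mul y z)"
    and mul_add_left: "mul (x + y) z = mul x z + mul y z"
    and mul_add_right: "mul z (x + y) = mul z x + mul z y"
    and mul_smul_left: "mul (smul c x) y = smul c (mul x y)"
    and mul_smul_right: "mul x (smul c y) = smul c (mul x y)"
begin

lemma mul_zero_left [simp]: "mul 0 x = 0"
  using mul_smul_left[of 0 0 x] by simp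

lemma mul_zero_right [simp]: "mul x 0 = 0"
  using mul_smul_right[of x 0 0] by simp

lemma mul_diff_left: "mul (x - y) z = mul x z - mul y z"
  using mul_add_left[of x "smul (-1) y" z] mul_smul_left[of "-1" y z] by simp

lemma mul_diff_right: "mul z (x - y) = mul z x - mul z y"
  using mul_add_right[of z x "smul (-1) y"] mul_smul_right[of z "-1" y] by simp

lemma mul_sum_right: "mul z (\<Sum>i\<in>A. f i) = (\<Sum>i\<in>A. mul z (f i))"
  by (induction A rule: infinite_finite_induct) (auto simp: mul_add_right)

lemma mul_sum_left: "mul (\<Sum>i\<in>A. f i) z = (\<Sum>i\<in>A. mul (f i) z)"
  by (induction A rule: infinite_finite_induct) (auto simp: mul_add_left)

lemma mul_pow_right: "mul ((mul X ^^ k) Y) Z = (mul X ^^ k) (mul Y Z)"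
  by (induction k) (auto simp: mul_assoc)

lemmas mul_expand = mul_assoc mul_add_left mul_add_right mul_diff_left mul_diff_right
  mul_smul_left mul_smul_right

text \<open>Left and right multiplication by \<open>X\<close> commute, so the sum is a polynomial in
  these two operators and this is one step of the q-binomial theorem. Comparing the coefficients of
  \<open>X^(m-v) Y X^(v+1)\<close> gives exactly \<open>qcf_pascal\<close>.\<close>

lemma srr_Suc:
  assumes t: "t \<noteq> (0 :: 'k::field)" and nz: "\<And>j. 1 \<le> j \<Longrightarrow> j \<le> Suc m \<Longrightarrow> qint t j \<noteq> 0"
  shows "srr mul t s (Suc m) X Y = qad mul X (s * t ^ m) (srr mul t (s / t) m X Y)"
proof -
  let ?B = "\<lambda>k v. (mul X ^^ k) (((\<lambda>y. mul y X) ^^ v) Y)"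
  have rB: "mul (?B k v) X = ?B k (Suc v)" for k v
    by (simp add: mul_pow_right)
  have c0: "qcf t (Suc m) 0 = 1" "qcf t m 0 = 1" using nz by (auto intro!: qcf_0)
  have cS: "qcf t m (Suc m) = 0" by (simp add: qcf_def)
  have coef: "qcf t (Suc m) (Suc v) * s ^ Suc v
     = qcf t m (Suc v) * (s / t) ^ Suc v - s * t ^ m * (qcf t m v * (s / t) ^ v)" if "v \<le> m" for v
  proof -
    have e1: "t powi (int m - int v) = t ^ m / t ^ v" using t by (simp add: power_int_diff)
    have e2: "t powi (- int (Suc v)) = inverse (t ^ Suc v)"
      by (simp only: power_int_minus power_int_of_nat)
    have e3: "qcf t (Suc m) (Suc v) = t powi (- int (Suc v)) * qcf t m (Suc v) - t powi (int m - int v) * qcf t m v"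
      by (rule qcf_pascal[OF t _ that]) (rule nz)
    show ?thesis
      unfolding e3 e1 e2 using t by (simp add: power_divide field_simps)
  qed
  have "qad mul X (s * t ^ m) (srr mul t (s / t) m X Y) =
      (\<Sum>v\<le>m. smul (qcf t m v * (s / t) ^ v) (?B (Suc m - v) v))
      - (\<Sum>v\<le>m. smul (s * t ^ m * (qcf t m v * (s / t) ^ v)) (?B (m - v) (Suc v)))"
    unfolding qad_def srr_def
    by (auto simp: mul_sum_left mul_sum_right mul_smul_left mul_smul_right rB fv.scale_sum_right Suc_diff_le
        intro!: arg_cong2[where f = "(-)"] sum.cong)
  also have "(\<Sum>v\<le>m. smul (qcf t m v * (s / t) ^ v) (?B (Suc m - v) v))
      = (\<Sum>v\<le>Suc m. smul (qcf t m v * (s / t) ^ v) (?B (Suc m - v) v))"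
    by (simp add: cS)
  also have "\<dots> = smul 1 (?B (Suc m) 0) + (\<Sum>v\<le>m. smul (qcf t m (Suc v) * (s / t) ^ Suc v) (?B (m - v) (Suc v)))"
    by (subst sum.atMost_Suc_shift) (simp add: c0)
  also have "\<dots> - (\<Sum>v\<le>m. smul (s * t ^ m * (qcf t m v * (s / t) ^ v)) (?B (m - v) (Suc v)))
      = smul 1 (?B (Suc m) 0) + (\<Sum>v\<le>m. smul (qcf t (Suc m) (Suc v) * s ^ Suc v) (?B (m - v) (Suc v)))"
    unfolding add_diff_eq[symmetric] sum_subtractf[symmetric] fv.scale_left_diff_distrib[symmetric]
    by (intro arg_cong2[where f = "(+)"] sum.cong refl) (metis atMost_iff coef)
  also have "\<dots> = srr mul t s (Suc m) X Y"
    unfolding srr_def by (subst sum.atMost_Suc_shift) (simp add: c0)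
  finally show ?thesis by simp
qed

text \<open>Each factor removed divides \<open>s\<close> by \<open>t\<close>. Starting from
  \<open>s = 1\<close> at level \<open>m\<close> leaves \<open>t powi (k - m)\<close> at level
  \<open>k\<close>; the scalar of the factor removed, \<open>s * t ^ k\<close> with \<open>s\<close>
  taken at level \<open>k + 1\<close>, is \<open>t powi (1 - m + 2 k)\<close>.\<close>

lemma srr_qads:
  assumes t: "t \<noteq> (0 :: 'k::field)" and nz: "\<And>j. 1 \<le> j \<Longrightarrow> j \<le> m \<Longrightarrow> qint t j \<noteq> 0" and "k \<le> m"
  shows "srr mul t (t powi (int k - int m)) k X Y = qads mul X (\<lambda>k. t powi (1 - int m + 2 * int k)) k Y"
  using \<open>k \<le> m\<close>
proof (induction k)
  case 0
  show ?case by (simp add: srr_def qcf_0)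
next
  case (Suc k)
  have "t powi (int (Suc k) - int m) / t = t powi (int k - int m)"
    using t by (simp add: power_int_diff field_simps power_int_add)
  moreover have "t powi (int (Suc k) - int m) * t ^ k = t powi (1 - int m + 2 * int k)"
  proof -
    have "t powi (int (Suc k) - int m) * t ^ k = t powi (int (Suc k) - int m) * t powi int k" by simp
    also have "\<dots> = t powi (1 - int m + 2 * int k)"
      using t by (subst power_int_add[symmetric]) (auto simp: algebra_simps)
    finally show ?thesis .
  qed
  ultimately show ?case
    using srr_Suc[OF t, of k "t powi (int (Suc k) - int m)" X Y] nz Suc by simp
qed

lemma qads_add: "qads mul X f k (Y + Z) = qads mul X f k Y + qads mul X f k Z"
  by (induction k) (auto simp: qad_def mul_expand fv.scale_right_distrib)

end

text \<open>The product is defined on all functions, but the ideal \<open>J\<close> absorbs only the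
  subalgebra \<open>C\<close> of finitely supported ones. The locale provides calculation modulo
  \<open>J\<close> for the free algebra and for its tensor square alike.\<close>

locale alg_ideal = bilin_assoc mul for mul :: "('x \<Rightarrow> 'k::field) \<Rightarrow> ('x \<Rightarrow> 'k) \<Rightarrow> 'x \<Rightarrow> 'k" +
  fixes C J :: "('x \<Rightarrow> 'k) set"
  assumes C_subspace: "fv.subspace C" and C_mul: "x \<in> C \<Longrightarrow> y \<in> C \<Longrightarrow> mul x y \<in> C"
    and J_subspace: "fv.subspace J"
    and J_mul_left: "x \<in> C \<Longrightarrow> y \<in> J \<Longrightarrow> mul x y \<in> J"
    and J_mul_right: "x \<in> J \<Longrightarrow> y \<in> C \<Longrightarrow> mul x y \<in> J"
begin

lemmas C_closed = C_mul fv.subspace_add[OF C_subspace] fv.subspace_diff[OF C_subspace]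
  fv.subspace_scale[OF C_subspace] fv.subspace_0[OF C_subspace]

lemmas J_closed = fv.subspace_add[OF J_subspace] fv.subspace_diff[OF J_subspace]
  fv.subspace_scale[OF J_subspace] fv.subspace_0[OF J_subspace]

definition eqv :: "('x \<Rightarrow> 'k) \<Rightarrow> ('x \<Rightarrow> 'k) \<Rightarrow> bool" (infix \<open>\<approx>\<close> 50) where
  "x \<approx> y \<longleftrightarrow> x - y \<in> J"

lemma eqv_refl [simp]: "x \<approx> x"
  by (simp add: eqv_def J_closed)

lemma eqv_sym: "x \<approx> y \<Longrightarrow> y \<approx> x"
  unfolding eqv_def using fv.subspace_neg[OF J_subspace, of "x - y"] by simp

lemma eqv_trans [trans]: "x \<approx> y \<Longrightarrow> y \<approx> z \<Longrightarrow> x \<approx> z"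
  unfolding eqv_def using fv.subspace_add[OF J_subspace, of "x - y" "y - z"] by simp

lemma eqv_add: "x \<approx> x' \<Longrightarrow> y \<approx> y' \<Longrightarrow> x + y \<approx> x' + y'"
  unfolding eqv_def using fv.subspace_add[OF J_subspace, of "x - x'" "y - y'"] by (simp add: algebra_simps)

lemma eqv_diff: "x \<approx> x' \<Longrightarrow> y \<approx> y' \<Longrightarrow> x - y \<approx> x' - y'"
  unfolding eqv_def using fv.subspace_diff[OF J_subspace, of "x - x'" "y - y'"] by (simp add: algebra_simps)

lemma eqv_smul: "x \<approx> y \<Longrightarrow> smul c x \<approx> smul c y"
  unfolding eqv_def using fv.subspace_scale[OF J_subspace, of "x - y" c]
  by (simp add: fv.scale_right_diff_distrib)

lemma eqv_mul_left: "y \<approx> y' \<Longrightarrow> x \<in> C \<Longrightarrow> mul x y \<approx> mul x y'"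
  unfolding eqv_def using J_mul_left[of x "y - y'"] by (simp add: mul_diff_right)

lemma eqv_mul_right: "x \<approx> x' \<Longrightarrow> y \<in> C \<Longrightarrow> mul x y \<approx> mul x' y"
  unfolding eqv_def using J_mul_right[of "x - x'" y] by (simp add: mul_diff_left)

lemma eqv_mul: "x \<approx> x' \<Longrightarrow> y \<approx> y' \<Longrightarrow> x' \<in> C \<Longrightarrow> y \<in> C \<Longrightarrow> mul x y \<approx> mul x' y'"
  by (meson eqv_mul_left eqv_mul_right eqv_trans)

lemma eqv_sum: "(\<And>i. i \<in> A \<Longrightarrow> f i \<approx> g i) \<Longrightarrow> sum f A \<approx> sum g A"
  by (induction A rule: infinite_finite_induct) (auto intro: eqv_add)

lemma eqv_zero_iff: "x \<approx> 0 \<longleftrightarrow> x \<in> J"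
  by (simp add: eqv_def)

lemma eqv_mem: "x \<approx> y \<Longrightarrow> x \<in> J \<longleftrightarrow> y \<in> J"
  using eqv_zero_iff eqv_sym eqv_trans by blast

lemma qad_eqv: "x \<in> C \<Longrightarrow> y \<approx> y' \<Longrightarrow> qad mul x c y \<approx> qad mul x c y'"
  unfolding qad_def by (intro eqv_diff eqv_smul eqv_mul_left eqv_mul_right)

lemma qads_C: "X \<in> C \<Longrightarrow> Y \<in> C \<Longrightarrow> qads mul X f k Y \<in> C"
  by (induction k) (auto simp: qad_def C_closed)

text \<open>By induction \<open>b\<close> moves past the iterated commutator \<open>D\<close> of
  \<open>a\<close> and \<open>c\<close> with the scalar \<open>r p^k\<close>. The
  \<open>k\<close>-th commutator uses this very scalar, so its \<open>b\<close>-part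
  \<open>bD - f(k) Db\<close> vanishes modulo \<open>J\<close>.\<close>

lemma qads_first:
  assumes C: "a \<in> C" "b \<in> C" "c \<in> C"
    and ba: "mul b a \<approx> smul p (mul a b)" and bc: "mul b c \<approx> smul r (mul c b)"
    and f: "\<And>k. f k = r * p ^ k"
  shows "qads mul (a + b) f k c \<approx> qads mul a f k c
    \<and> mul b (qads mul a f k c) \<approx> smul (f k) (mul (qads mul a f k c) b)"
proof (induction k)
  case 0
  show ?case using bc by (simp add: f)
next
  case (Suc k)
  define D where "D = qads mul a f k c"
  define g where "g = f k"
  have DC: "D \<in> C" unfolding D_def by (intro qads_C C)
  have E1: "mul b D - smul g (mul D b) \<in> J" using Suc by (simp add: D_def eqv_def g_def)
  have E2: "mul b a - smul p (mul a b) \<in> J" using ba by (simp add: eqv_def)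
  have "qads mul (a + b) f (Suc k) c \<approx> qad mul (a + b) g D"
    using Suc C by (auto simp: D_def g_def intro!: qad_eqv C_closed)
  moreover have "qad mul (a + b) g D - qad mul a g D = mul b D - smul g (mul D b)"
    by (simp add: qad_def mul_expand fun_eq_iff fun_apply algebra_simps)
  then have "qad mul (a + b) g D \<approx> qad mul a g D" using E1 by (simp add: eqv_def)
  ultimately have 1: "qads mul (a + b) f (Suc k) c \<approx> qads mul a f (Suc k) c"
    using eqv_trans by (simp add: D_def g_def)
  \<comment> \<open>The new commutation defect is an explicit combination of the two defects already
    in \<open>J\<close>; the identity holds in any associative algebra and is checked by
    expansion.\<close>
  have "mul b (qad mul a g D) - smul (g * p) (mul (qad mul a g D) b)
      = mul (mul b a - smul p (mul a b)) D + smul p (mul a (mul b D - smul g (mul D b)))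
        - smul g (mul (mul b D - smul g (mul D b)) a) - smul (g * g) (mul D (mul b a - smul p (mul a b)))"
    by (simp add: qad_def mul_expand fun_eq_iff fun_apply algebra_simps)
  also have "\<dots> \<in> J"
    by (intro J_closed J_mul_left J_mul_right E1 E2 C DC)
  finally have "mul b (qad mul a g D) - smul (g * p) (mul (qad mul a g D) b) \<in> J" .
  moreover have "f (Suc k) = g * p" by (simp add: f g_def)
  ultimately show ?case using 1 by (simp add: eqv_def D_def g_def)
qed

text \<open>The mirror case: the iterated commutator \<open>D\<close> of \<open>b\<close> and
  \<open>d\<close> moves past \<open>a\<close> with the scalar \<open>r p^k\<close>, and the
  \<open>a\<close>-part \<open>aD - f(k) Da\<close> becomes \<open>(1 - f(k) r p^k) aD\<close>.
  Hence \<open>f(k)\<close> must be the inverse scalar.\<close>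

lemma qads_second:
  assumes C: "a \<in> C" "b \<in> C" "d \<in> C"
    and ba: "mul b a \<approx> smul p (mul a b)" and da: "mul d a \<approx> smul r (mul a d)"
    and f: "\<And>k. k < m \<Longrightarrow> f k * (r * p ^ k) = 1" and "k \<le> m"
  shows "qads mul (a + b) f k d \<approx> qads mul b f k d
    \<and> mul (qads mul b f k d) a \<approx> smul (r * p ^ k) (mul a (qads mul b f k d))"
  using \<open>k \<le> m\<close>
proof (induction k)
  case 0
  show ?case using da by simp
next
  case (Suc k)
  define D where "D = qads mul b f k d"
  define g where "g = f k"
  have fk: "g * (r * p ^ k) = 1" using Suc f by (simp add: g_def)
  have DC: "D \<in> C" unfolding D_def by (intro qads_C C)
  have E1: "mul D a - smul (r * p ^ k) (mul a D) \<in> J" using Suc by (simp add: D_def eqv_def)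
  have E2: "mul b a - smul p (mul a b) \<in> J" using ba by (simp add: eqv_def)
  have "qads mul (a + b) f (Suc k) d \<approx> qad mul (a + b) g D"
    using Suc C by (auto simp: D_def g_def intro!: qad_eqv C_closed)
  moreover have "qad mul (a + b) g D - qad mul b g D
      = smul (1 - g * (r * p ^ k)) (mul a D) - smul g (mul D a - smul (r * p ^ k) (mul a D))"
    by (simp add: qad_def mul_expand fun_eq_iff fun_apply algebra_simps)
  then have "qad mul (a + b) g D \<approx> qad mul b g D"
    using E1 by (simp add: eqv_def fk J_closed fv.subspace_neg[OF J_subspace])
  ultimately have 1: "qads mul (a + b) f (Suc k) d \<approx> qads mul b f (Suc k) d"
    using eqv_trans by (simp add: D_def g_def)
  have "mul (qad mul b g D) a - smul (r * p ^ Suc k) (mul a (qad mul b g D))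
      = mul b (mul D a - smul (r * p ^ k) (mul a D)) + smul (r * p ^ k) (mul (mul b a - smul p (mul a b)) D)
        - smul g (mul D (mul b a - smul p (mul a b))) - smul (g * p) (mul (mul D a - smul (r * p ^ k) (mul a D)) b)"
    by (simp add: qad_def mul_expand fun_eq_iff fun_apply algebra_simps)
  also have "\<dots> \<in> J"
    by (intro J_closed J_mul_left J_mul_right E1 E2 C DC)
  finally show ?case using 1 by (simp add: eqv_def D_def g_def mult_ac)
qed

text \<open>The Serre sum is the product of the commuting operators $Y \mapsto XY - t^{1-m+2k}YX$
  for $k < m$.  Applied in increasing order of $k$ they ignore $b$ on $c$,
  applied in decreasing order they ignore $a$ on $d$.\<close>

lemma srr_primitive:
  assumes C: "a \<in> C" "b \<in> C" "c \<in> C" "d \<in> C"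
    and t: "t \<noteq> 0" and nz: "\<And>j. 1 \<le> j \<Longrightarrow> j \<le> m \<Longrightarrow> qint t j \<noteq> 0"
    and ba: "mul b a \<approx> smul (t\<^sup>2) (mul a b)"
    and bc: "mul b c \<approx> smul (t powi (1 - int m)) (mul c b)"
    and da: "mul d a \<approx> smul (t powi (1 - int m)) (mul a d)"
  shows "srr mul t 1 m (a + b) (c + d) \<approx> srr mul t 1 m a c + srr mul t 1 m b d"
proof -
  let ?f = "\<lambda>k. t powi (1 - int m + 2 * int k)" and ?g = "\<lambda>k. inverse t powi (1 - int m + 2 * int k)"
  have p2: "(t\<^sup>2) ^ k = t powi (2 * int k)" for k
    using power_int_of_nat[of t "2 * k"] by (simp add: power_mult)
  have 1: "srr mul t 1 m X Y = qads mul X ?f m Y" for X Y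
    using srr_qads[OF t nz, of m m X Y] by simp
  \<comment> \<open>The Serre sum does not change under \<open>t\<close> to
    \<open>inverse t\<close>, whereas \<open>?g\<close> lists the scalars of \<open>?f\<close> in
    reverse order; since \<open>?g k\<close> is the inverse of \<open>?f k\<close>, this is the
    order that suits \<open>b\<close> and \<open>d\<close>.\<close>
  have 2: "srr mul t 1 m X Y = qads mul X ?g m Y" for X Y
    using srr_qads[of "inverse t" m m X Y] t nz by (simp add: qint_inverse srr_inverse)
  have "qads mul (a + b) ?f m c \<approx> qads mul a ?f m c"
    by (rule qads_first[OF C(1-3) ba bc, THEN conjunct1]) (use t in \<open>auto simp: p2 power_int_add\<close>)
  moreover have "qads mul (a + b) ?g m d \<approx> qads mul b ?g m d"
  proof (rule qads_second[OF C(1,2,4) ba da, THEN conjunct1])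
    fix k assume "k < m"
    have "t powi (1 - int m) * (t\<^sup>2) ^ k = t powi (1 - int m + 2 * int k)"
      using t by (simp only: p2) (simp add: power_int_add)
    then show "?g k * (t powi (1 - int m) * (t\<^sup>2) ^ k) = 1"
      using t by (simp add: power_int_inverse)
  qed simp
  ultimately show ?thesis
    using eqv_add[of "srr mul t 1 m (a + b) c" "srr mul t 1 m a c" "srr mul t 1 m (a + b) d"]
    by (metis "1" "2" qads_add)
qed

end

text \<open>Carries Serre sums through the coproduct and through the two embeddings of the algebra
  into its tensor square.\<close>

lemma srr_hom:
  assumes mul: "\<And>x y. x \<in> C \<Longrightarrow> y \<in> C \<Longrightarrow> h (mul x y) = mul' (h x) (h y)"
    and C: "fv.subspace C" "\<And>x y. x \<in> C \<Longrightarrow> y \<in> C \<Longrightarrow> mul x y \<in> C"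
    and add: "\<And>x y. x \<in> C \<Longrightarrow> y \<in> C \<Longrightarrow> h (x + y) = h x + h y"
    and sm: "\<And>c x. x \<in> C \<Longrightarrow> h (smul c x) = smul c (h x)"
    and XY: "X \<in> C" "Y \<in> C"
  shows "h (srr mul t s m X Y) = srr mul' t s m (h X) (h Y)"
proof -
  have r: "((\<lambda>y. mul y X) ^^ v) Y \<in> C \<and> h (((\<lambda>y. mul y X) ^^ v) Y) = ((\<lambda>y. mul' y (h X)) ^^ v) (h Y)" for v
    by (induction v) (auto simp: mul C XY)
  have l: "Z \<in> C \<Longrightarrow> (mul X ^^ k) Z \<in> C \<and> h ((mul X ^^ k) Z) = (mul' (h X) ^^ k) (h Z)" for k Z
    by (induction k) (auto simp: mul C XY)
  have h0: "h 0 = 0" using sm[of 0 0] fv.subspace_0[OF C(1)] by simp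
  have "sum f A \<in> C \<and> h (sum f A) = (\<Sum>i\<in>A. h (f i))" if "\<And>i. i \<in> A \<Longrightarrow> f i \<in> C" for f and A :: "nat set"
    using that by (induction A rule: infinite_finite_induct)
      (auto simp: h0 add fv.subspace_0[OF C(1)] fv.subspace_add[OF C(1)])
  then show ?thesis unfolding srr_def
    using l r sm by (auto simp: fv.subspace_scale[OF C(1)] intro!: sum.cong)
qed

lemma ncmul_bilin: "bilin_assoc (ncmul :: 'k::field ncp \<Rightarrow> _)"
  by unfold_locales (auto simp: ncmul_assoc ncmul_add_left ncmul_add_right ncmul_smul_left ncmul_smul_right)

lemma mul2_bilin: "bilin_assoc (mul2 chi :: 'k::field ncp2 \<Rightarrow> _)"
  by unfold_locales (auto simp: mul2_assoc mul2_add_left mul2_add_right mul2_smul_left mul2_smul_right)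

section \<open>Ideals and quotients\<close>

text \<open>Diagonal operators in the word basis. Projections to a degree, the twists by
  \<open>chi\<close> and, up to the flip, the braiding are of this kind.\<close>

definition pw :: "('x \<Rightarrow> 'k) \<Rightarrow> ('x \<Rightarrow> 'k::field) \<Rightarrow> 'x \<Rightarrow> 'k" where
  "pw c f = (\<lambda>w. c w * f w)"

lemma pw_add: "pw c (f + g) = pw c f + pw c g"
  by (auto simp: pw_def fun_apply distrib_left)
lemma pw_smul: "pw c (smul d f) = smul d (pw c f)"
  by (auto simp: pw_def fun_apply fun_eq_iff)
lemma pw_zero [simp]: "pw c 0 = 0"
  by (auto simp: pw_def fun_apply fun_eq_iff)
lemma pw_diff: "pw c (f - g) = pw c f - pw c g"
  by (auto simp: pw_def fun_apply fun_eq_iff right_diff_distrib)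
lemma pw_kron [simp]: "pw c (kron w) = smul (c w) (kron w)"
  by (auto simp: pw_def kron_def fun_apply fun_eq_iff)
lemma pw_const: "(\<And>w. w \<in> supp f \<Longrightarrow> c w = d) \<Longrightarrow> pw c f = smul d f"
  by (auto simp: pw_def fun_apply fun_eq_iff supp_def)
lemma pw_fsupp: "f \<in> fsupp A \<Longrightarrow> pw c f \<in> fsupp A"
proof -
  assume "f \<in> fsupp A"
  moreover have "supp (pw c f) \<subseteq> supp f" by (auto simp: pw_def supp_def)
  ultimately show ?thesis by (auto simp: fsupp_def intro: finite_subset)
qed
lemma pw_fs [simp]: "f \<in> fs N \<Longrightarrow> pw c f \<in> fs N"
  and pw_fs2 [simp]: "F \<in> fs2 N \<Longrightarrow> pw c' F \<in> fs2 N"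
  by (simp_all add: fs_fsupp fs2_fsupp pw_fsupp)

lemma word_mul_lin:
  assumes "r \<in> fs N"
  shows "ncmul (ncmul (kron u) r) (kron v) = lin (\<lambda>w. kron (u @ w @ v)) (r :: 'k::field ncp)"
  using assms
  by (induction rule: fs_induct)
    (auto simp: ncmul_add_left ncmul_add_right ncmul_smul_left ncmul_smul_right ncmul_kron
      lin_add[of _ "words N"] lin_smul fs_fsupp)

lemma supp_word_mul:
  assumes "r \<in> fs N"
  shows "supp (ncmul (ncmul (kron u) r) (kron v)) \<subseteq> (\<lambda>w. u @ w @ v) ` supp (r :: 'k::field ncp)"
proof -
  have "lin (\<lambda>w. kron (u @ w @ v)) r x = 0" if "x \<notin> (\<lambda>w. u @ w @ v) ` supp r" for x
    using that by (auto simp: lin_def kron_def intro!: sum.neutral)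
  then show ?thesis unfolding word_mul_lin[OF assms] by (auto simp: supp_def)
qed

locale presentation =
  fixes N :: nat and R :: "'k::field ncp set"
  assumes R_fs: "R \<subseteq> fs N"
begin

abbreviation "I \<equiv> ncideal N R"
abbreviation "I2 \<equiv> ncideal2 N R"
abbreviation "W \<equiv> words N"

lemma I_fs: "f \<in> I \<Longrightarrow> f \<in> fs N"
  by (induction rule: ncideal.induct) (use R_fs in auto)

lemma I_subspace: "fv.subspace I"
  by (rule fv.subspaceI) (auto intro: ncideal.intros)

lemma I2_subspace: "fv.subspace I2"
  by (rule fv.subspaceI) (auto intro: ncideal2.intros)

lemma R_I: "r \<in> R \<Longrightarrow> r \<in> I"
  using ncideal.gen[of ncone N r R ncone] R_fs by (auto simp: subset_iff)

lemma I_mul_left: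
  assumes "f \<in> fs N" "g \<in> I"
  shows "ncmul f g \<in> I"
  using assms(2,1)
proof (induction rule: ncideal.induct)
  case (gen u r v)
  then show ?case using ncideal.gen[of "ncmul f u" N r R v] by (simp add: ncmul_assoc)
qed (auto simp: ncmul_add_right ncmul_smul_right intro: ncideal.intros)

lemma I_mul_right:
  assumes "g \<in> I" "f \<in> fs N"
  shows "ncmul g f \<in> I"
  using assms
proof (induction rule: ncideal.induct)
  case (gen u r v)
  then show ?case using ncideal.gen[of u N r R "ncmul v f"] by (simp add: ncmul_assoc)
qed (auto simp: ncmul_add_left ncmul_smul_left intro: ncideal.intros)

sublocale T: alg_ideal ncmul "fs N" I
proof -
  interpret bilin_assoc "ncmul :: 'k ncp \<Rightarrow> _" by (rule ncmul_bilin)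
  show "alg_ideal ncmul (fs N) I"
    by unfold_locales (auto simp: I_subspace I_mul_left I_mul_right)
qed

text \<open>By bilinearity the ideal is spanned by the elements \<open>u r v\<close> with words
  \<open>u\<close> and \<open>v\<close>. Their words are those of \<open>r\<close> with a fixed
  prefix and suffix, which is what arguments about degrees need.\<close>

lemma ideal_induct [consumes 1, case_names zero add smul word]:
  assumes f: "f \<in> I" and z: "P 0"
    and add: "\<And>f g. f \<in> I \<Longrightarrow> g \<in> I \<Longrightarrow> P f \<Longrightarrow> P g \<Longrightarrow> P (f + g)"
    and smul: "\<And>c f. f \<in> I \<Longrightarrow> P f \<Longrightarrow> P (smul c f)"
    and word: "\<And>u r v. u \<in> W \<Longrightarrow> r \<in> R \<Longrightarrow> v \<in> W \<Longrightarrow> P (ncmul (ncmul (kron u) r) (kron v))"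
  shows "P f"
proof -
  define S where "S = {f \<in> I. P f}"
  have S: "fv.subspace S" unfolding S_def
    by (rule fv.subspaceI) (auto intro: z add smul ncideal.intros)
  note S_closed = fv.subspace_add[OF S] fv.subspace_scale[OF S] fv.subspace_0[OF S]
  have w: "ncmul (ncmul (kron u) r) (kron v) \<in> S" if "u \<in> W" "r \<in> R" "v \<in> W" for u r v
    using that word by (auto simp: S_def intro!: ncideal.gen)
  have v: "ncmul (ncmul (kron u) r) v \<in> S" if "u \<in> W" "r \<in> R" and v: "v \<in> fs N" for u r v
    using v that(1,2)
    by (induction rule: fs_induct) (auto simp: ncmul_add_right ncmul_smul_right intro: w S_closed)
  have u: "ncmul (ncmul u r) v \<in> S" if u: "u \<in> fs N" and "r \<in> R" "v \<in> fs N" for u r v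
    using u that(2,3)
    by (induction rule: fs_induct) (auto simp: ncmul_add_left ncmul_smul_left intro: v S_closed)
  from f have "f \<in> S"
    by (induction rule: ncideal.induct) (auto intro: u S_closed)
  then show ?thesis by (simp add: S_def)
qed

lemma ideal2_induct [consumes 1, case_names zero add smul left right]:
  assumes f: "F \<in> I2" and z: "P 0"
    and add: "\<And>f g. f \<in> I2 \<Longrightarrow> g \<in> I2 \<Longrightarrow> P f \<Longrightarrow> P g \<Longrightarrow> P (f + g)"
    and smul: "\<And>c f. f \<in> I2 \<Longrightarrow> P f \<Longrightarrow> P (smul c f)"
    and left: "\<And>f v. f \<in> I \<Longrightarrow> v \<in> W \<Longrightarrow> P (tens f (kron v))"
    and right: "\<And>u g. u \<in> W \<Longrightarrow> g \<in> I \<Longrightarrow> P (tens (kron u) g)"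
  shows "P F"
proof -
  define S where "S = {f \<in> I2. P f}"
  have S: "fv.subspace S" unfolding S_def
    by (rule fv.subspaceI) (auto intro: z add smul ncideal2.intros)
  note S_closed = fv.subspace_add[OF S] fv.subspace_scale[OF S] fv.subspace_0[OF S]
  have l0: "tens f (kron v) \<in> S" if "f \<in> I" "v \<in> W" for f v
    using that left by (auto simp: S_def intro!: ncideal2.left)
  have r0: "tens (kron v) f \<in> S" if "f \<in> I" "v \<in> W" for f v
    using that right by (auto simp: S_def intro!: ncideal2.right)
  have l: "tens f g \<in> S" if "f \<in> I" and g: "g \<in> fs N" for f g
    using g that(1)
    by (induction rule: fs_induct) (auto simp: tens_add_right tens_smul_right intro: l0 S_closed)
  have r: "tens f g \<in> S" if f: "f \<in> fs N" and "g \<in> I" for f g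
    using f that(2)
    by (induction rule: fs_induct) (auto simp: tens_add_left tens_smul_left intro: r0 S_closed)
  from f have "F \<in> S"
    by (induction rule: ncideal2.induct) (auto intro: l r S_closed)
  then show ?thesis by (simp add: S_def)
qed

lemma I2_fs2: "F \<in> I2 \<Longrightarrow> F \<in> fs2 N"
  by (induction rule: ncideal2.induct) (auto simp: I_fs)

text \<open>On \<open>u r v\<close> with words \<open>u\<close> and \<open>v\<close> the diagonal
  operator is multiplication by a constant.\<close>

lemma pw_ideal:
  assumes c: "\<And>u r v. u \<in> W \<Longrightarrow> r \<in> R \<Longrightarrow> v \<in> W \<Longrightarrow> \<exists>d. \<forall>w\<in>supp r. c (u @ w @ v) = d"
    and f: "f \<in> I"
  shows "pw c f \<in> I"
  using f
proof (induction rule: ideal_induct)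
  case (word u r v)
  then obtain d where d: "\<And>w. w \<in> supp r \<Longrightarrow> c (u @ w @ v) = d" using c by metis
  have "pw c (ncmul (ncmul (kron u) r) (kron v)) = smul d (ncmul (ncmul (kron u) r) (kron v))"
    using supp_word_mul[of r N u v] d R_fs word by (intro pw_const) blast
  then show ?case using word by (auto intro!: ncideal.intros)
qed (auto simp: pw_add pw_smul intro: ncideal.intros)

lemma cls_eq_iff: "f \<in> fs N \<Longrightarrow> g \<in> fs N \<Longrightarrow> cls N R f = cls N R g \<longleftrightarrow> f - g \<in> I"
proof
  assume fg: "f \<in> fs N" "g \<in> fs N"
  show "f - g \<in> I" if e: "cls N R f = cls N R g"
  proof -
    have "f \<in> cls N R f" using fg by (simp add: cls_def ncideal.zero)
    then show ?thesis by (simp add: e) (simp add: cls_def)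
  qed
  show "cls N R f = cls N R g" if "f - g \<in> I"
  proof -
    have "h - f \<in> I \<longleftrightarrow> h - g \<in> I" for h
      using fv.subspace_add[OF I_subspace that, of "h - f"] fv.subspace_diff[OF I_subspace _ that, of "h - g"]
      by auto
    then show ?thesis by (simp add: cls_def)
  qed
qed

lemma cls2_eq_iff: "f \<in> fs2 N \<Longrightarrow> g \<in> fs2 N \<Longrightarrow> cls2 N R f = cls2 N R g \<longleftrightarrow> f - g \<in> I2"
proof
  assume fg: "f \<in> fs2 N" "g \<in> fs2 N"
  show "f - g \<in> I2" if e: "cls2 N R f = cls2 N R g"
  proof -
    have "f \<in> cls2 N R f" using fg by (simp add: cls2_def ncideal2.zero)
    then show ?thesis by (simp add: e) (simp add: cls2_def)
  qed
  show "cls2 N R f = cls2 N R g" if "f - g \<in> I2"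
  proof -
    have "h - f \<in> I2 \<longleftrightarrow> h - g \<in> I2" for h
      using fv.subspace_add[OF I2_subspace that, of "h - f"] fv.subspace_diff[OF I2_subspace _ that, of "h - g"]
      by auto
    then show ?thesis by (simp add: cls2_def)
  qed
qed

lemma rep_cls:
  assumes "f \<in> fs N"
  shows "rep (cls N R f) \<in> fs N" and "rep (cls N R f) - f \<in> I"
proof -
  have "f \<in> cls N R f" using assms by (simp add: cls_def ncideal.zero)
  then have "rep (cls N R f) \<in> cls N R f" unfolding rep_def by (rule someI[of "\<lambda>x. x \<in> _"])
  then show "rep (cls N R f) \<in> fs N" "rep (cls N R f) - f \<in> I" by (auto simp: cls_def)
qed

lemma rep_cls2:
  assumes "f \<in> fs2 N"
  shows "rep (cls2 N R f) \<in> fs2 N" and "rep (cls2 N R f) - f \<in> I2"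
proof -
  have "f \<in> cls2 N R f" using assms by (simp add: cls2_def ncideal2.zero)
  then have "rep (cls2 N R f) \<in> cls2 N R f" unfolding rep_def by (rule someI[of "\<lambda>x. x \<in> _"])
  then show "rep (cls2 N R f) \<in> fs2 N" "rep (cls2 N R f) - f \<in> I2" by (auto simp: cls2_def)
qed

lemma cls_in_Qt [simp]: "f \<in> fs N \<Longrightarrow> cls N R f \<in> Qt N R"
  by (simp add: Qt_def)

lemma QtE: assumes "X \<in> Qt N R" obtains f where "f \<in> fs N" "X = cls N R f"
  using assms by (auto simp: Qt_def)

lemma rep_Qt: "X \<in> Qt N R \<Longrightarrow> rep X \<in> fs N \<and> cls N R (rep X) = X"
  by (elim QtE) (simp add: rep_cls cls_eq_iff)

lemma qadd_cls: "f \<in> fs N \<Longrightarrow> g \<in> fs N \<Longrightarrow> qadd N R (cls N R f) (cls N R g) = cls N R (f + g)"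
  using T.eqv_add[unfolded T.eqv_def, OF rep_cls(2) rep_cls(2), of f g]
  by (simp add: qadd_def cls_eq_iff rep_cls)

lemma qmul_cls: "f \<in> fs N \<Longrightarrow> g \<in> fs N \<Longrightarrow> qmul N R (cls N R f) (cls N R g) = cls N R (ncmul f g)"
  using T.eqv_mul[unfolded T.eqv_def, OF rep_cls(2) rep_cls(2), of f g]
  by (simp add: qmul_def cls_eq_iff rep_cls)

lemma qsmul_cls: "f \<in> fs N \<Longrightarrow> qsmul N R c (cls N R f) = cls N R (smul c f)"
  using T.eqv_smul[unfolded T.eqv_def, OF rep_cls(2), of f c]
  by (simp add: qsmul_def cls_eq_iff rep_cls)

text \<open>A basis of the ideal stays independent when \<open>f\<close> is added, and the dual
  functional extends to all functions. It is recorded by its values on words, the form that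
  \<open>ev\<close> and the slices use.\<close>

lemma linear_functional_exists:
  assumes f: "f \<in> fs N" "f \<notin> I"
  shows "\<exists>p. (\<forall>h\<in>I. ev p h = 0) \<and> ev p f = 1"
proof -
  interpret vp: vector_space_pair "smul :: 'k \<Rightarrow> 'k ncp \<Rightarrow> 'k ncp" "(*) :: 'k \<Rightarrow> 'k \<Rightarrow> 'k"
    by unfold_locales (auto simp: algebra_simps)
  obtain B where B: "B \<subseteq> I" "fv.independent B" "I \<subseteq> fv.span B"
    using fv.maximal_independent_subset[of I] by auto
  have sp: "fv.span B \<subseteq> I" using B(1) I_subspace by (rule fv.span_minimal)
  then have ind: "fv.independent (insert f B)"
    using f B(2) by (intro fv.independent_insertI) auto
  obtain L where L: "Vector_Spaces.linear smul (*) L" "\<forall>x\<in>insert f B. L x = (if x = f then 1 else 0)"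
    using vp.linear_independent_extend[OF ind, of "\<lambda>x. if x = f then 1 else 0"] by auto
  have Lev: "L h = ev (\<lambda>w. L (kron w)) h" if "h \<in> fs N" for h
    using that by (induction rule: fs_induct)
      (auto simp: vp.linear_add[OF L(1)] vp.linear_scale[OF L(1)] vp.linear_0[OF L(1)]
        ev_add[of _ W] ev_smul fs_fsupp)
  have "f \<notin> B" using B(1) f by auto
  then have "L x = 0" if "x \<in> B" for x using L(2) that by auto
  then have "L h = 0" if "h \<in> I" for h
    using vp.linear_eq_0_on_span[OF L(1), of B h] that B(3) by auto
  moreover have "L f = 1" using L(2) by simp
  ultimately show ?thesis using Lev f I_fs by (intro exI[of _ "\<lambda>w. L (kron w)"]) auto
qed

end

section \<open>The slices \<open>p \<otimes> id\<close> and \<open>id \<otimes> p\<close>, and the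
  tensor square of a linear map\<close>

definition sliceL :: "(nat list \<Rightarrow> 'k) \<Rightarrow> 'k::field ncp2 \<Rightarrow> 'k ncp" where
  "sliceL p = lin (\<lambda>(u, v). smul (p u) (kron v))"

definition sliceR :: "(nat list \<Rightarrow> 'k) \<Rightarrow> 'k::field ncp2 \<Rightarrow> 'k ncp" where
  "sliceR p = lin (\<lambda>(u, v). smul (p v) (kron u))"

lemma slice_add:
  assumes "F \<in> fs2 N" "G \<in> fs2 N"
  shows "sliceL p (F + G) = sliceL p F + sliceL p G" "sliceR p (F + G) = sliceR p F + sliceR p G"
  using assms by (simp_all add: sliceL_def sliceR_def lin_add fs2_fsupp)

lemma slice_diff:
  assumes "F \<in> fs2 N" "G \<in> fs2 N"
  shows "sliceL p (F - G) = sliceL p F - sliceL p G" "sliceR p (F - G) = sliceR p F - sliceR p G"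
  using assms by (simp_all add: sliceL_def sliceR_def lin_diff fs2_fsupp)

lemma slice_smul:
  "sliceL p (smul c F) = smul c (sliceL p F)" "sliceR p (smul c F) = smul c (sliceR p F)"
  by (simp_all add: sliceL_def sliceR_def lin_smul)

lemma slice_zero [simp]: "sliceL p 0 = 0" "sliceR p 0 = 0"
  by (simp_all add: sliceL_def sliceR_def)

lemma lin_tens:
  assumes f: "f \<in> fs N" and g: "g \<in> (fs N :: 'k::field ncp set)"
  shows "lin h (tens f g) = lin (\<lambda>u. lin (\<lambda>v. h (u, v)) g) f"
  using f
proof (induction rule: fs_induct)
  case (kron u)
  show ?case using g
    by (induction rule: fs_induct)
      (use kron in \<open>auto simp: tens_add_right tens_smul_right tens_kron lin_smul
        lin_add[of _ "words N \<times> words N"] lin_add[of _ "words N"] fs_fsupp fs2_fsupp[symmetric]\<close>)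
next
  case (add f f')
  then show ?case using g tens_in_fs2[OF _ g]
    by (simp add: tens_add_left lin_add[of _ "words N \<times> words N"] lin_add[of _ "words N"]
      flip: fs_fsupp fs2_fsupp)
qed (auto simp: tens_smul_left lin_smul)

lemma slice_tens:
  assumes f: "f \<in> fs N" and g: "g \<in> (fs N :: 'k::field ncp set)"
  shows "sliceL p (tens f g) = smul (ev p f) g" "sliceR p (tens f g) = smul (ev p g) f"
proof -
  have l: "lin (\<lambda>v. smul c (kron v)) g = smul c g" for c
    using g by (induction rule: fs_induct)
      (auto simp: fs_fsupp lin_add[of _ "words N"] lin_smul fv.scale_right_distrib mult.commute)
  have r: "lin (\<lambda>v. smul (p v) x) g = smul (ev p g) x" for x :: "'k ncp"  and p g
    by (auto simp: lin_def ev_def fun_eq_iff smul_apply sum_distrib_right mult.assoc)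
  show "sliceL p (tens f g) = smul (ev p f) g"
    unfolding sliceL_def lin_tens[OF f g] by (simp add: l r)
  have "lin (\<lambda>u. smul c (kron u)) f = smul c f" for c
    using f by (induction rule: fs_induct)
      (auto simp: fs_fsupp lin_add[of _ "words N"] lin_smul fv.scale_right_distrib mult.commute)
  then show "sliceR p (tens f g) = smul (ev p g) f"
    unfolding sliceR_def lin_tens[OF f g] by (simp add: r)
qed

context presentation
begin

text \<open>A functional that kills the ideal kills one summand of
  \<open>I \<otimes> T + T \<otimes> I\<close> and sends the other into \<open>I\<close>, so the
  slice descends to the quotient. This is how information is extracted from the coproduct.\<close>

lemma slice_ideal:
  assumes p: "\<And>h. h \<in> I \<Longrightarrow> ev p h = 0" and F: "F \<in> I2"
  shows "sliceL p F \<in> I" "sliceR p F \<in> I"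
proof -
  have "sliceL p F \<in> I \<and> sliceR p F \<in> I" using F
    by (induction rule: ncideal2.induct)
      (auto simp: slice_add[of _ N] I2_fs2 slice_smul slice_tens[of _ N] I_fs p intro: ncideal.intros)
  then show "sliceL p F \<in> I" "sliceR p F \<in> I" by auto
qed

text \<open>Nonzero vectors have a nonzero tensor: slice with a functional that is 1 on
  \<open>g\<close> and 0 on the ideal.\<close>

lemma tens_ideal:
  assumes fg: "f \<in> fs N" "g \<in> fs N" and t: "tens f g \<in> I2"
  shows "f \<in> I \<or> g \<in> I"
proof (rule disjCI)
  assume "g \<notin> I"
  then obtain p where p: "\<And>h. h \<in> I \<Longrightarrow> ev p h = 0" "ev p g = 1"
    using linear_functional_exists[OF fg(2)] by auto
  have "sliceR p (tens f g) \<in> I" by (rule slice_ideal[OF p(1) t])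
  then show "f \<in> I" using slice_tens[OF fg] p(2) by simp
qed

definition lift2 :: "(nat list \<Rightarrow> 'k ncp) \<Rightarrow> 'k ncp2 \<Rightarrow> 'k ncp2" where
  "lift2 h = lin (\<lambda>(u, v). tens (h u) (h v))"

lemma lin_fs: "f \<in> fs N \<Longrightarrow> (\<And>w. w \<in> W \<Longrightarrow> h w \<in> fs N) \<Longrightarrow> lin h f \<in> fs N"
  unfolding fs_fsupp by (rule lin_in_fsupp)

lemma lift2_fs2: "F \<in> fs2 N \<Longrightarrow> (\<And>w. w \<in> W \<Longrightarrow> h w \<in> fs N) \<Longrightarrow> lift2 h F \<in> fs2 N"
  unfolding lift2_def
  by (rule lin_in_subspace[where A = "W \<times> W"]) (auto simp flip: fs2_fsupp)

lemma lift2_tens: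
  assumes f: "f \<in> fs N" and g: "g \<in> fs N"
  shows "lift2 h (tens f g) = tens (lin h f) (lin h g)"
proof -
  have "lin (\<lambda>v. tens x (h v)) g = tens x (lin h g)" for x
    using g by (induction rule: fs_induct)
      (auto simp: fs_fsupp lin_add[of _ W] lin_smul tens_add_right tens_smul_right)
  moreover have "lin (\<lambda>u. tens (h u) y) f = tens (lin h f) y" for y
    using f by (induction rule: fs_induct)
      (auto simp: fs_fsupp lin_add[of _ W] lin_smul tens_add_left tens_smul_left)
  ultimately show ?thesis unfolding lift2_def lin_tens[OF f g] by simp
qed

lemma lift2_add: "F \<in> fs2 N \<Longrightarrow> G \<in> fs2 N \<Longrightarrow> lift2 h (F + G) = lift2 h F + lift2 h G"
  and lift2_diff: "F \<in> fs2 N \<Longrightarrow> G \<in> fs2 N \<Longrightarrow> lift2 h (F - G) = lift2 h F - lift2 h G"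
  and lift2_smul: "lift2 h (smul c F) = smul c (lift2 h F)"
  and lift2_kron: "lift2 h (kron (u, v)) = tens (h u) (h v)"
  by (auto simp: lift2_def fs2_fsupp lin_add lin_diff lin_smul)

lemma lift2_ideal:
  assumes h: "\<And>w. w \<in> W \<Longrightarrow> h w \<in> fs N" and I: "\<And>f. f \<in> I \<Longrightarrow> lin h f \<in> I" and F: "F \<in> I2"
  shows "lift2 h F \<in> I2"
  using F
proof (induction rule: ncideal2.induct)
  case zero
  then show ?case by (simp add: lift2_def ncideal2.zero)
qed (auto simp: lift2_tens I_fs lift2_add I2_fs2 lift2_smul h I lin_fs intro: ncideal2.intros)

lemma tens_cong:
  assumes "f - f' \<in> I" "g - g' \<in> I" "f' \<in> fs N" "g \<in> fs N"
  shows "tens f g - tens f' g' \<in> I2"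
proof -
  have "tens f g - tens f' g' = tens (f - f') g + tens f' (g - g')"
    by (simp add: tens_diff_left tens_diff_right)
  then show ?thesis using assms by (auto intro: ncideal2.intros)
qed

text \<open>\<open>qmap2\<close> is defined with the representatives that \<open>rep\<close>
  chooses. Modulo \<open>I2\<close> any word-wise lift \<open>h\<close> of \<phi> computes it, and
  stability of the ideal under \<open>lin h\<close> removes the dependence on the representative of
  the class.\<close>

lemma qmap2_cls2:
  assumes h: "\<And>w. w \<in> W \<Longrightarrow> h w \<in> fs N \<and> \<phi> (cls N R (kron w)) = cls N R (h w)"
    and I: "\<And>f. f \<in> I \<Longrightarrow> lin h f \<in> I" and F: "F \<in> fs2 N"
  shows "qmap2 N R \<phi> (cls2 N R F) = cls2 N R (lift2 h F)"
proof -
  let ?h = "\<lambda>w. rep (\<phi> (cls N R (kron w)))"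
  have rh: "?h w \<in> fs N" "?h w - h w \<in> I" if "w \<in> W" for w
    using h[OF that] rep_cls[of "h w"] by auto
  let ?G = "rep (cls2 N R F)"
  have G: "?G \<in> fs2 N" "?G - F \<in> I2" using rep_cls2[OF F] by auto
  have q: "qmap2 N R \<phi> (cls2 N R F) = cls2 N R (lift2 ?h ?G)"
    by (simp add: qmap2_def lift2_def lin_def ncword_kron case_prod_beta cong: sum.cong)
  have "lift2 ?h H - lift2 h H \<in> I2" if "H \<in> fs2 N" for H
    using that
  proof (induction rule: fs2_induct)
    case zero
    then show ?case by (simp add: lift2_def ncideal2.zero)
  next
    case (add f g)
    have "lift2 ?h (f + g) - lift2 h (f + g) = (lift2 ?h f - lift2 h f) + (lift2 ?h g - lift2 h g)"
      using add by (simp add: lift2_add)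
    then show ?case using add by (auto intro: ncideal2.intros)
  next
    case (smul c f)
    then show ?case by (simp add: lift2_smul fv.scale_right_diff_distrib[symmetric] ncideal2.smul)
  next
    case (kron x)
    then show ?case using rh h by (cases x) (auto simp: lift2_kron intro!: tens_cong)
  qed
  from this[OF G(1)] have "lift2 ?h ?G - lift2 h ?G \<in> I2" .
  moreover have "lift2 h ?G - lift2 h F \<in> I2"
    using lift2_ideal[of h, OF _ I G(2)] h G F by (simp add: lift2_diff)
  ultimately have "lift2 ?h ?G - lift2 h F \<in> I2"
    using fv.subspace_add[OF I2_subspace, of "lift2 ?h ?G - lift2 h ?G" "lift2 h ?G - lift2 h F"] by simp
  then show ?thesis unfolding q using F G rh(1) h by (subst cls2_eq_iff) (auto intro!: lift2_fs2 simp del: split_paired_All)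
qed

end

section \<open>Coproduct, counit and braiding\<close>

lemma ncEps_ev: "ncEps e f = ev (\<lambda>w. prod_list (map e w)) f"
  by (simp add: ncEps_def ev_def)

lemma ncDelta_lin: "ncDelta chi D f = lin (delta_word chi D) f"
  by (simp add: ncDelta_def lin_def)

lemma chiw_Cons_right: "chiw chi a (x # b) = chiw chi a [x] * (chiw chi a b :: 'k::comm_ring_1)"
  using chiw_append_right[of chi a "[x]" b] by simp

lemma ev_mult:
  assumes p: "\<And>u v. u \<in> words N \<Longrightarrow> v \<in> words N \<Longrightarrow> p (u @ v) = p u * p v"
    and f: "f \<in> fs N" and g: "g \<in> (fs N :: 'k::field ncp set)"
  shows "ev p (ncmul f g) = ev p f * ev p g"
  using f
proof (induction rule: fs_induct)
  case (kron u)
  show ?case using g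
    by (induction rule: fs_induct) (use kron in \<open>auto simp: ncmul_add_right ncmul_smul_right ncmul_kron p
      ev_add[of _ "words N"] ev_smul distrib_left simp flip: fs_fsupp\<close>)
qed (use g in \<open>auto simp: ncmul_add_left ncmul_smul_left ev_add[of _ "words N"] ev_smul distrib_right simp flip: fs_fsupp\<close>)

lemma ev_word_mul:
  assumes "r \<in> (fs N :: 'k::field ncp set)" "u \<in> words N" "v \<in> words N"
  shows "ev p (ncmul (ncmul (kron u) r) (kron v)) = ev (\<lambda>w. p (u @ w @ v)) r"
  using assms
  by (induction rule: fs_induct) (auto simp: ncmul_add_left ncmul_add_right ncmul_smul_left ncmul_smul_right
    ncmul_kron ev_add[of _ "words N"] ev_smul simp flip: fs_fsupp)

lemma mul2_one_left:
  assumes "F \<in> (fs2 N :: 'k::field ncp2 set)"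
  shows "mul2 chi (tens ncone ncone) F = F"
  using assms by (induction rule: fs2_induct)
    (auto simp: mul2_add_right mul2_smul_right mul2_kron ncone_kron tens_kron)

lemma mul2_one_right:
  assumes "F \<in> (fs2 N :: 'k::field ncp2 set)"
  shows "mul2 chi F (tens ncone ncone) = F"
  using assms by (induction rule: fs2_induct)
    (auto simp: mul2_add_left mul2_smul_left mul2_kron ncone_kron tens_kron)

lemma tens_mul_left:
  "f \<in> fs N \<Longrightarrow> mul2 chi (tens f (kron v)) (kron (a, b)) = smul (chiw chi v a) (tens (ncmul f (kron a)) (kron (v @ b)) :: 'k::field ncp2)"
  by (induction rule: fs_induct) (auto simp: tens_add_left tens_smul_left mul2_add_left mul2_smul_left
    ncmul_add_left ncmul_smul_left tens_kron ncmul_kron mul2_kron fv.scale_right_distrib mult.commute)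

lemma tens_mul_right:
  "f \<in> fs N \<Longrightarrow> mul2 chi (kron (a, b)) (tens (kron v) f) = smul (chiw chi b v) (tens (kron (a @ v)) (ncmul (kron b) f) :: 'k::field ncp2)"
  by (induction rule: fs_induct) (auto simp: tens_add_right tens_smul_right mul2_add_right mul2_smul_right
    ncmul_add_right ncmul_smul_right tens_kron ncmul_kron mul2_kron fv.scale_right_distrib mult.commute)

lemma tens_mul_left':
  "f \<in> fs N \<Longrightarrow> mul2 chi (kron (a, b)) (tens f (kron v)) = (tens (ncmul (kron a) (pw (\<lambda>w. chiw chi b w) f)) (kron (b @ v)) :: 'k::field ncp2)"
  by (induction rule: fs_induct) (auto simp: tens_add_left tens_smul_left mul2_add_right mul2_smul_right
    ncmul_add_right ncmul_smul_right tens_kron ncmul_kron mul2_kron fv.scale_right_distrib pw_add pw_smul)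

lemma tens_mul_right':
  "f \<in> fs N \<Longrightarrow> mul2 chi (tens (kron v) f) (kron (a, b)) = (tens (kron (v @ a)) (ncmul (pw (\<lambda>w. chiw chi w a) f) (kron b)) :: 'k::field ncp2)"
  by (induction rule: fs_induct) (auto simp: tens_add_right tens_smul_right mul2_add_left mul2_smul_left
    ncmul_add_left ncmul_smul_left tens_kron ncmul_kron mul2_kron fv.scale_right_distrib pw_add pw_smul)

lemma braid_add: "braid chi (F + G) = braid chi F + braid chi G"
  by (auto simp: braid_def fun_eq_iff fun_apply distrib_left)
lemma braid_smul: "braid chi (smul c F) = smul c (braid chi F)"
  by (auto simp: braid_def fun_eq_iff fun_apply)
lemma braid_zero [simp]: "braid chi 0 = 0"
  by (auto simp: braid_def fun_eq_iff fun_apply)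
lemma braid_diff: "braid chi (F - G) = braid chi F - braid chi G"
  by (auto simp: braid_def fun_eq_iff fun_apply right_diff_distrib)
lemma braid_kron: "braid chi (kron (u, v)) = smul (chiw chi u v) (kron (v, u))"
  by (auto simp: braid_def kron_def fun_eq_iff fun_apply)
lemma braid_tens: "braid chi (tens f g) = pw (\<lambda>(u, v). chiw chi v u) (tens g f)"
  by (auto simp: braid_def tens_def pw_def fun_eq_iff)
lemma braid_fs2: "F \<in> fs2 N \<Longrightarrow> braid chi F \<in> (fs2 N :: 'k::field ncp2 set)"
  by (induction rule: fs2_induct) (auto simp: braid_add braid_smul braid_kron)

text \<open>Each relator has a constant \<open>chi\<close> factor against every letter. Hence the
  ideal is stable under twists by words, so that \<open>I2\<close> is a two-sided ideal for the
  braided product and is preserved by the braiding.\<close>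

locale twisted = presentation N R for N and R :: "'k::field ncp set" +
  fixes chi :: "nat \<Rightarrow> nat \<Rightarrow> 'k"
  assumes chi_left: "r \<in> R \<Longrightarrow> x < N \<Longrightarrow> \<exists>c. \<forall>w\<in>supp r. chiw chi w [x] = c"
    and chi_right: "r \<in> R \<Longrightarrow> x < N \<Longrightarrow> \<exists>c. \<forall>w\<in>supp r. chiw chi [x] w = c"
begin

lemma twist_left: assumes "f \<in> I" "v \<in> W" shows "pw (\<lambda>w. chiw chi w v) f \<in> I"
proof (rule pw_ideal[OF _ assms(1)])
  fix u r z assume r: "r \<in> R"
  have "\<exists>c. \<forall>w\<in>supp r. chiw chi w v = c" using assms(2)
  proof (induction v)
    case (Cons x v)
    then obtain c where "\<forall>w\<in>supp r. chiw chi w v = c" by auto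
    moreover obtain c' where "\<forall>w\<in>supp r. chiw chi w [x] = c'"
      using chi_left[OF r, of x] Cons.prems by auto
    ultimately show ?case by (subst chiw_Cons_right) auto
  qed simp
  then show "\<exists>d. \<forall>w\<in>supp r. chiw chi (u @ w @ z) v = d"
    by (auto simp: chiw_append_left)
qed

lemma twist_right: assumes "f \<in> I" "v \<in> W" shows "pw (\<lambda>w. chiw chi v w) f \<in> I"
proof (rule pw_ideal[OF _ assms(1)])
  fix u r z assume r: "r \<in> R"
  have "\<exists>c. \<forall>w\<in>supp r. chiw chi v w = c" using assms(2)
  proof (induction v)
    case (Cons x v)
    then obtain c where "\<forall>w\<in>supp r. chiw chi v w = c" by auto
    moreover obtain c' where "\<forall>w\<in>supp r. chiw chi [x] w = c'"
      using chi_right[OF r, of x] Cons.prems by auto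
    ultimately show ?case by (subst chiw_Cons_left) auto
  qed simp
  then show "\<exists>d. \<forall>w\<in>supp r. chiw chi v (u @ w @ z) = d"
    by (auto simp: chiw_append_right)
qed

lemma I2_mul_right: assumes "F \<in> I2" "G \<in> fs2 N" shows "mul2 chi F G \<in> I2"
  using assms(2)
proof (induction rule: fs2_induct)
  case (kron p)
  then obtain a b where p: "p = (a, b)" and ab: "a \<in> W" "b \<in> W" by auto
  show ?case unfolding p using assms(1)
  proof (induction rule: ideal2_induct)
    case (left f v)
    with ab show ?case by (auto simp: tens_mul_left[of _ N] I_fs intro!: ncideal2.smul ncideal2.left T.J_mul_right)
  next
    case (right u g)
    with ab show ?case by (auto simp: tens_mul_right'[of _ N] I_fs intro!: ncideal2.right T.J_mul_right twist_left)
  qed (auto simp: mul2_add_left mul2_smul_left intro: ncideal2.intros)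
qed (auto simp: mul2_add_right mul2_smul_right intro: ncideal2.intros)

lemma I2_mul_left: assumes "F \<in> I2" "G \<in> fs2 N" shows "mul2 chi G F \<in> I2"
  using assms(2)
proof (induction rule: fs2_induct)
  case (kron p)
  then obtain a b where p: "p = (a, b)" and ab: "a \<in> W" "b \<in> W" by auto
  show ?case unfolding p using assms(1)
  proof (induction rule: ideal2_induct)
    case (left f v)
    with ab show ?case by (auto simp: tens_mul_left'[of _ N] I_fs intro!: ncideal2.left T.J_mul_left twist_right)
  next
    case (right u g)
    with ab show ?case by (auto simp: tens_mul_right[of _ N] I_fs intro!: ncideal2.smul ncideal2.right T.J_mul_left)
  qed (auto simp: mul2_add_right mul2_smul_right intro: ncideal2.intros)
qed (auto simp: mul2_add_left mul2_smul_left intro: ncideal2.intros)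

sublocale T2: alg_ideal "mul2 chi" "fs2 N" I2
proof -
  interpret bilin_assoc "mul2 chi :: 'k ncp2 \<Rightarrow> _" by (rule mul2_bilin)
  show "alg_ideal (mul2 chi) (fs2 N) I2"
    by unfold_locales (auto simp: I2_subspace I2_mul_left I2_mul_right)
qed

lemma braid_I2: "F \<in> I2 \<Longrightarrow> braid chi F \<in> I2"
proof (induction rule: ideal2_induct)
  case (left f v)
  have "f \<in> fs N \<Longrightarrow> braid chi (tens f (kron v)) = tens (kron v) (pw (\<lambda>w. chiw chi w v) f)" for f
    by (induction rule: fs_induct) (auto simp: tens_add_left tens_add_right tens_smul_left tens_smul_right
      braid_add braid_smul tens_kron braid_kron pw_add pw_smul)
  with left show ?case by (auto simp: I_fs intro!: ncideal2.right twist_left)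
next
  case (right v f)
  have "f \<in> fs N \<Longrightarrow> braid chi (tens (kron v) f) = tens (pw (\<lambda>w. chiw chi v w) f) (kron v)" for f
    by (induction rule: fs_induct) (auto simp: tens_add_left tens_add_right tens_smul_left tens_smul_right
      braid_add braid_smul tens_kron braid_kron pw_add pw_smul)
  with right show ?case by (auto simp: I_fs intro!: ncideal2.left twist_right)
qed (auto simp: braid_add braid_smul intro: ncideal2.intros)

end

locale coproduct = twisted N R chi for N and R :: "'k::field ncp set" and chi +
  fixes D :: "nat \<Rightarrow> 'k ncp2"
  assumes D_fs2: "x < N \<Longrightarrow> D x \<in> fs2 N"
begin

abbreviation "\<Delta> \<equiv> ncDelta chi D"

lemma delta_word_fs2: "w \<in> W \<Longrightarrow> delta_word chi D w \<in> fs2 N"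
  by (induction w) (auto simp: delta_word_def D_fs2)

lemma delta_word_Cons: "delta_word chi D (x # w) = mul2 chi (D x) (delta_word chi D w)"
  by (simp add: delta_word_def)

lemma delta_word_append:
  "v \<in> W \<Longrightarrow> delta_word chi D (u @ v) = mul2 chi (delta_word chi D u) (delta_word chi D v)"
  by (induction u)
    (auto simp: delta_word_Cons mul2_assoc mul2_one_left[OF delta_word_fs2], simp add: delta_word_def[of _ _ "[]"] mul2_one_left[OF delta_word_fs2])

lemma Delta_fs2: "f \<in> fs N \<Longrightarrow> \<Delta> f \<in> fs2 N"
  unfolding ncDelta_lin fs_fsupp by (rule lin_in_subspace) (auto simp: delta_word_fs2)

lemma Delta_add: "f \<in> fs N \<Longrightarrow> g \<in> fs N \<Longrightarrow> \<Delta> (f + g) = \<Delta> f + \<Delta> g"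
  and Delta_diff: "f \<in> fs N \<Longrightarrow> g \<in> fs N \<Longrightarrow> \<Delta> (f - g) = \<Delta> f - \<Delta> g"
  and Delta_smul: "\<Delta> (smul c f) = smul c (\<Delta> f)"
  and Delta_kron: "\<Delta> (kron w) = delta_word chi D w"
  and Delta_zero: "\<Delta> 0 = 0"
  by (simp_all add: ncDelta_lin lin_add lin_diff lin_smul fs_fsupp)

lemma Delta_gen: "x < N \<Longrightarrow> \<Delta> (ncgen x) = D x"
  by (simp add: ncgen_kron Delta_kron delta_word_def mul2_one_right[OF D_fs2])

lemma Delta_mul:
  assumes f: "f \<in> fs N" and g: "g \<in> fs N"
  shows "\<Delta> (ncmul f g) = mul2 chi (\<Delta> f) (\<Delta> g)"
  using f
proof (induction rule: fs_induct)
  case (kron u)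
  show ?case using g
    by (induction rule: fs_induct) (use kron in \<open>auto simp: ncmul_add_right ncmul_smul_right ncmul_kron
      Delta_add Delta_smul Delta_kron Delta_zero delta_word_append mul2_add_right mul2_smul_right\<close>)
qed (use g in \<open>auto simp: ncmul_add_left ncmul_smul_left Delta_add Delta_smul Delta_zero
      mul2_add_left mul2_smul_left\<close>)

lemma Delta_ideal:
  assumes "\<And>r. r \<in> R \<Longrightarrow> \<Delta> r \<in> I2" and "f \<in> I"
  shows "\<Delta> f \<in> I2"
  using assms(2)
  by (induction rule: ncideal.induct)
    (use R_fs in \<open>auto simp: Delta_add Delta_smul Delta_mul Delta_zero subset_iff I_fs assms(1)
      intro!: ncideal2.zero ncideal2.add ncideal2.smul T2.J_mul_right[OF T2.J_mul_left] Delta_fs2\<close>)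

lemma Delta_srr:
  assumes "f \<in> fs N" "g \<in> fs N"
  shows "\<Delta> (srr ncmul t s m f g) = srr (mul2 chi) t s m (\<Delta> f) (\<Delta> g)"
  by (rule srr_hom[where C = "fs N"]) (use assms in \<open>auto simp: Delta_mul Delta_add Delta_smul\<close>)

end

section \<open>Maps induced by a substitution of scaled letters\<close>

definition mword :: "(nat \<Rightarrow> 'k) \<Rightarrow> (nat \<Rightarrow> nat) \<Rightarrow> nat list \<Rightarrow> 'k::field ncp" where
  "mword \<alpha> s w = smul (prod_list (map \<alpha> w)) (kron (map s w))"

abbreviation mono_map :: "(nat \<Rightarrow> 'k) \<Rightarrow> (nat \<Rightarrow> nat) \<Rightarrow> 'k::field ncp \<Rightarrow> 'k ncp" where
  "mono_map \<alpha> s \<equiv> lin (mword \<alpha> s)"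

lemma mword_fs: "w \<in> words N \<Longrightarrow> (\<And>x. x < N \<Longrightarrow> s x < N) \<Longrightarrow> mword \<alpha> s w \<in> fs N"
proof -
  assume "w \<in> words N" "\<And>x. x < N \<Longrightarrow> s x < N"
  then have "map s w \<in> words N" by (induction w) auto
  then show ?thesis by (simp add: mword_def)
qed

lemma mono_map_fs: "f \<in> fs N \<Longrightarrow> (\<And>x. x < N \<Longrightarrow> s x < N) \<Longrightarrow> mono_map \<alpha> s f \<in> fs N"
  unfolding fs_fsupp by (rule lin_in_fsupp[of _ "words N"]) (auto simp: mword_fs simp flip: fs_fsupp)

lemma mono_map_mul:
  assumes f: "f \<in> fs N" and g: "g \<in> fs N"
  shows "mono_map \<alpha> s (ncmul f g) = ncmul (mono_map \<alpha> s f) (mono_map \<alpha> s g)"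
  using f
proof (induction rule: fs_induct)
  case (kron u)
  show ?case using g
    by (induction rule: fs_induct) (use kron in \<open>auto simp: ncmul_add_right ncmul_smul_right ncmul_kron mword_def
      lin_add[of _ "words N"] lin_smul ncmul_smul_left mult.commute simp flip: fs_fsupp\<close>)
qed (use g in \<open>auto simp: ncmul_add_left ncmul_smul_left lin_add[of _ "words N"] lin_smul simp flip: fs_fsupp\<close>)

lemma mono_map_comp:
  assumes f: "f \<in> fs N" and t: "\<And>x. x < N \<Longrightarrow> t x < N"
  shows "mono_map \<alpha> s (mono_map \<beta> t f) = mono_map (\<lambda>x. \<beta> x * \<alpha> (t x)) (s \<circ> t) f"
  using f
proof (induction rule: fs_induct)
  case (kron w)
  have "prod_list (map (\<lambda>x. \<beta> x * \<alpha> (t x)) w) = prod_list (map \<beta> w) * prod_list (map \<alpha> (map t w))"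
    by (induction w) auto
  then show ?case by (simp add: mword_def lin_smul comp_def)
qed (use t in \<open>auto simp: lin_add[of _ "words N"] lin_smul mono_map_fs simp flip: fs_fsupp\<close>)

lemma mono_map_cong:
  assumes "f \<in> fs N" "\<And>x. x < N \<Longrightarrow> \<alpha> x = \<beta> x" "\<And>x. x < N \<Longrightarrow> s x = t x"
  shows "mono_map \<alpha> s f = mono_map \<beta> t f"
proof (rule lin_cong[of f "words N"])
  fix w assume "w \<in> words N"
  then have "map \<alpha> w = map \<beta> w" "map s w = map t w" using assms by (auto simp: words_def)
  then show "mword \<alpha> s w = mword \<beta> t w" by (simp only: mword_def)
qed (use assms(1) in \<open>simp add: fs_fsupp\<close>)

lemma mono_map_id:
  assumes "f \<in> fs N"
  shows "mono_map (\<lambda>_. 1 :: 'k::field) (\<lambda>x. x) f = f"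
proof -
  have "mword (\<lambda>_. 1 :: 'k) (\<lambda>x. x) = kron"
    by (rule ext) (simp add: mword_def map_replicate_const)
  then show ?thesis using assms by (simp add: fs_fsupp lin_kron_id)
qed

text \<open>Restricted to the quotient, hence \<open>undefined\<close> elsewhere, because the
  automorphism sets contain only extensional maps.\<close>

definition qmono :: "nat \<Rightarrow> 'k::field ncp set \<Rightarrow> (nat \<Rightarrow> 'k) \<Rightarrow> (nat \<Rightarrow> nat) \<Rightarrow> 'k ncp set \<Rightarrow> 'k ncp set" where
  "qmono N R \<alpha> s = (\<lambda>X\<in>Qt N R. cls N R (mono_map \<alpha> s (rep X)))"

context presentation
begin

lemma mono_map_ideal:
  assumes s: "\<And>x. x < N \<Longrightarrow> s x < N" and R: "\<And>r. r \<in> R \<Longrightarrow> mono_map \<alpha> s r \<in> I" and f: "f \<in> I"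
  shows "mono_map \<alpha> s f \<in> I"
  using f
proof (induction rule: ncideal.induct)
  case (gen u r v)
  then show ?case using R_fs R s
    by (auto simp: mono_map_mul[of _ N] mono_map_fs subset_iff intro!: T.J_mul_right[OF T.J_mul_left])
qed (auto simp: lin_add[of _ W] lin_smul I_fs intro: ncideal.intros simp flip: fs_fsupp)

definition preserves :: "(nat \<Rightarrow> 'k) \<Rightarrow> (nat \<Rightarrow> nat) \<Rightarrow> bool" where
  "preserves \<alpha> s \<longleftrightarrow> (\<forall>x<N. s x < N) \<and> (\<forall>f\<in>I. mono_map \<alpha> s f \<in> I)"

lemma qmono_cls:
  assumes "preserves \<alpha> s" "f \<in> fs N"
  shows "qmono N R \<alpha> s (cls N R f) = cls N R (mono_map \<alpha> s f)"
proof -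
  have "mono_map \<alpha> s (rep (cls N R f)) - mono_map \<alpha> s f = mono_map \<alpha> s (rep (cls N R f) - f)"
    using assms rep_cls[OF assms(2)] by (subst lin_diff[of _ W]) (auto simp flip: fs_fsupp)
  also have "\<dots> \<in> I" using assms rep_cls[OF assms(2)] by (auto simp: preserves_def)
  finally show ?thesis using assms rep_cls[OF assms(2)]
    by (simp add: qmono_def cls_eq_iff mono_map_fs preserves_def)
qed

lemma qmono_Qt: "preserves \<alpha> s \<Longrightarrow> X \<in> Qt N R \<Longrightarrow> qmono N R \<alpha> s X \<in> Qt N R"
  by (elim QtE) (auto simp: qmono_cls preserves_def intro!: cls_in_Qt mono_map_fs)

lemma qmono_comp:
  assumes "preserves \<alpha> s" "preserves \<beta> t" "X \<in> Qt N R" "preserves \<gamma> u"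
    and "\<And>x. x < N \<Longrightarrow> \<gamma> x = \<beta> x * \<alpha> (t x)" "\<And>x. x < N \<Longrightarrow> u x = s (t x)"
  shows "qmono N R \<alpha> s (qmono N R \<beta> t X) = qmono N R \<gamma> u X"
  using assms(3)
proof (rule QtE)
  fix f assume f: "f \<in> fs N" "X = cls N R f"
  have "mono_map \<alpha> s (mono_map \<beta> t f) = mono_map (\<lambda>x. \<beta> x * \<alpha> (t x)) (s \<circ> t) f"
    using assms(2) f by (intro mono_map_comp) (auto simp: preserves_def)
  also have "\<dots> = mono_map \<gamma> u f"
    using assms f by (intro mono_map_cong[of _ N]) auto
  finally show ?thesis using f assms
    by (simp add: qmono_cls mono_map_fs preserves_def)
qed

lemma qmono_id:
  assumes "X \<in> Qt N R" "\<And>x. x < N \<Longrightarrow> \<alpha> x = 1" "\<And>x. x < N \<Longrightarrow> s x = x"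
  shows "qmono N R \<alpha> s X = X"
proof -
  have "mono_map \<alpha> s (rep X) = mono_map (\<lambda>_. 1) (\<lambda>x. x) (rep X)"
    using assms rep_Qt[OF assms(1)] by (intro mono_map_cong[of _ N]) auto
  then show ?thesis using assms rep_Qt[OF assms(1)] by (simp add: qmono_def mono_map_id[of _ N])
qed

lemma qmono_alg_aut:
  assumes p: "preserves \<alpha> s" "preserves \<beta> t"
    and inv: "\<And>x. x < N \<Longrightarrow> \<beta> x * \<alpha> (t x) = 1 \<and> s (t x) = x"
      "\<And>x. x < N \<Longrightarrow> \<alpha> x * \<beta> (s x) = 1 \<and> t (s x) = x"
  shows "is_alg_aut N R (qmono N R \<alpha> s)"
proof -
  have pid: "preserves (\<lambda>_. 1) (\<lambda>x. x)" by (auto simp: preserves_def mono_map_id[OF I_fs])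
  have "bij_betw (qmono N R \<alpha> s) (Qt N R) (Qt N R)"
  proof (rule bij_betw_byWitness[where f' = "qmono N R \<beta> t"])
    show "\<forall>X\<in>Qt N R. qmono N R \<beta> t (qmono N R \<alpha> s X) = X"
      using qmono_comp[OF p(2,1) _ pid] inv by (auto simp: qmono_id)
    show "\<forall>X\<in>Qt N R. qmono N R \<alpha> s (qmono N R \<beta> t X) = X"
      using qmono_comp[OF p(1,2) _ pid] inv by (auto simp: qmono_id)
  qed (auto simp: qmono_Qt p)
  moreover have "qmono N R \<alpha> s (qone N R) = qone N R"
    by (simp add: qone_def qmono_cls p ncone_kron mword_def)
  ultimately show ?thesis using p(1) unfolding is_alg_aut_def
    by (auto elim!: QtE simp: qadd_cls qmul_cls qsmul_cls qmono_cls mono_map_fs preserves_def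
      mono_map_mul[of _ N] lin_add[of _ W] lin_smul simp flip: fs_fsupp)
qed

end

locale hopf_presentation = coproduct N R chi D for N and R :: "'k::field ncp set" and chi D +
  fixes e :: "nat \<Rightarrow> 'k"
  assumes Delta_R: "r \<in> R \<Longrightarrow> \<Delta> r \<in> I2" and eps_R: "r \<in> R \<Longrightarrow> ncEps e r = 0"
begin

lemma Delta_I: "f \<in> I \<Longrightarrow> \<Delta> f \<in> I2"
  by (rule Delta_ideal[OF Delta_R])

lemma eps_mul: "f \<in> fs N \<Longrightarrow> g \<in> fs N \<Longrightarrow> ncEps e (ncmul f g) = ncEps e f * ncEps e g"
  unfolding ncEps_ev by (rule ev_mult[of N]) auto

lemma eps_add: "f \<in> fs N \<Longrightarrow> g \<in> fs N \<Longrightarrow> ncEps e (f + g) = ncEps e f + ncEps e g"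
  and eps_diff: "f \<in> fs N \<Longrightarrow> g \<in> fs N \<Longrightarrow> ncEps e (f - g) = ncEps e f - ncEps e g"
  and eps_smul: "ncEps e (smul c f) = c * ncEps e f"
  by (auto simp: ncEps_ev ev_add[of _ W] ev_diff[of _ W] ev_smul fs_fsupp)

lemma eps_I: "f \<in> I \<Longrightarrow> ncEps e f = 0"
proof (induction rule: ncideal.induct)
  case (gen u r v)
  then show ?case using R_fs by (auto simp: eps_mul eps_R subset_iff)
qed (auto simp: eps_add eps_smul I_fs, simp add: ncEps_ev)

text \<open>The letter map preserves \<open>chi\<close>, so its tensor square is multiplicative for
  the braided product and commutes with the braiding. Both sides of the coproduct identity are then
  multiplicative and agree once they agree on letters.\<close>

lemma qmono_coalg:
  assumes p: "preserves \<alpha> s"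
    and chi: "\<And>x y. x < N \<Longrightarrow> y < N \<Longrightarrow> chi (s x) (s y) = chi x y"
    and D: "\<And>x. x < N \<Longrightarrow> lift2 (mword \<alpha> s) (D x) = smul (\<alpha> x) (D (s x))"
    and e: "\<And>x. x < N \<Longrightarrow> e (s x) * \<alpha> x = e x"
  shows "is_coalg_map N R chi D e (qmono N R \<alpha> s)"
    and "preserves_braiding N R chi (qmono N R \<alpha> s)"
proof -
  have sN: "\<And>x. x < N \<Longrightarrow> s x < N" using p by (simp add: preserves_def)
  have mw: "w \<in> W \<Longrightarrow> mword \<alpha> s w \<in> fs N \<and> qmono N R \<alpha> s (cls N R (kron w)) = cls N R (mword \<alpha> s w)" for w
    using qmono_cls[OF p, of "kron w"] sN by (auto simp: mword_fs)
  have chiw: "chiw chi (map s u) (map s v) = chiw chi u v" if "u \<in> W" "v \<in> W" for u v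
    using that(1)
  proof (induction u)
    case (Cons x u)
    have "map (chi (s x) \<circ> s) v = map (chi x) v" using that(2) Cons.prems chi by (auto simp: words_def)
    then have "chiw chi [s x] (map s v) = chiw chi [x] v" by (simp add: chiw_def del: map_eq_conv)
    then show ?case using Cons
      by (simp add: chiw_Cons_left[of chi x u v] chiw_Cons_left[of chi "s x" "map s u" "map s v"])
  qed simp
  have l2m: "lift2 (mword \<alpha> s) (mul2 chi F G) = mul2 chi (lift2 (mword \<alpha> s) F) (lift2 (mword \<alpha> s) G)"
    if F: "F \<in> fs2 N" and G: "G \<in> fs2 N" for F G
    using F
  proof (induction rule: fs2_induct)
    case (kron p)
    then obtain u v where uv: "p = (u, v)" "u \<in> W" "v \<in> W" by auto
    show ?case unfolding uv(1) using G
    proof (induction rule: fs2_induct)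
      case (kron p')
      then obtain u' v' where uv': "p' = (u', v')" "u' \<in> W" "v' \<in> W" by auto
      show ?case unfolding uv' using uv uv'
        by (simp add: mul2_kron lift2_kron lift2_smul mword_def tens_smul_left tens_smul_right tens_kron
            mul2_smul_left mul2_smul_right chiw mult_ac)
    qed (use uv in \<open>auto simp: mul2_add_right mul2_smul_right lift2_add lift2_smul, auto simp: lift2_def\<close>)
  qed (use G in \<open>auto simp: mul2_add_left mul2_smul_left lift2_add lift2_smul, auto simp: lift2_def\<close>)
  have Delta_w: "\<Delta> (mword \<alpha> s w) = lift2 (mword \<alpha> s) (delta_word chi D w)" if "w \<in> W" for w
    using that
  proof (induction w)
    case Nil
    show ?case by (simp add: mword_def Delta_kron Delta_smul delta_word_def ncone_kron tens_kron lift2_kron)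
  next
    case (Cons x w)
    have "\<Delta> (mword \<alpha> s (x # w)) = mul2 chi (smul (\<alpha> x) (D (s x))) (\<Delta> (mword \<alpha> s w))"
      by (simp add: mword_def Delta_kron Delta_smul delta_word_Cons mul2_smul_left mul2_smul_right)
    also have "\<dots> = lift2 (mword \<alpha> s) (delta_word chi D (x # w))"
      using Cons D by (simp add: delta_word_Cons l2m D_fs2 delta_word_fs2)
    finally show ?case .
  qed
  have Delta_m: "\<Delta> (mono_map \<alpha> s f) = lift2 (mword \<alpha> s) (\<Delta> f)" if "f \<in> fs N" for f
    using that sN
    by (induction rule: fs_induct) (auto simp: lin_add[of _ W] lin_smul Delta_add Delta_smul mono_map_fs
        lift2_add lift2_smul Delta_fs2 Delta_w Delta_kron Delta_zero simp flip: fs_fsupp, simp add: lift2_def)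
  have eps_w: "ncEps e (mword \<alpha> s w) = prod_list (map e w)" if "w \<in> W" for w
    using that e by (induction w) (auto simp: ncEps_ev mword_def ev_smul algebra_simps)
  have eps_m: "ncEps e (mono_map \<alpha> s f) = ncEps e f" if "f \<in> fs N" for f
    using that sN
    by (induction rule: fs_induct) (auto simp: lin_add[of _ W] lin_smul eps_add eps_smul mono_map_fs eps_w
        simp flip: fs_fsupp, simp_all add: ncEps_ev)
  have mI: "\<And>f. f \<in> I \<Longrightarrow> mono_map \<alpha> s f \<in> I" using p by (simp add: preserves_def)
  show "is_coalg_map N R chi D e (qmono N R \<alpha> s)"
    unfolding is_coalg_map_def
  proof
    fix X assume X: "X \<in> Qt N R"
    define f where "f = rep X"
    have f: "f \<in> fs N" using X rep_Qt by (simp add: f_def)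
    have qX: "qmono N R \<alpha> s X = cls N R (mono_map \<alpha> s f)" using X by (simp add: qmono_def f_def)
    define g where "g = rep (qmono N R \<alpha> s X)"
    have g: "g \<in> fs N" "g - mono_map \<alpha> s f \<in> I"
      unfolding g_def qX using rep_cls[of "mono_map \<alpha> s f"] mono_map_fs[OF f sN] by auto
    have "ncEps e g = ncEps e f"
      using eps_I[OF g(2)] eps_m[OF f] mono_map_fs[OF f sN] g by (simp add: eps_diff)
    moreover have "cls2 N R (\<Delta> g) = cls2 N R (lift2 (mword \<alpha> s) (\<Delta> f))"
      using Delta_I[OF g(2)] g f sN mw
      by (subst cls2_eq_iff) (auto simp: Delta_diff Delta_m mono_map_fs Delta_fs2 intro!: lift2_fs2)
    moreover have "\<dots> = qmap2 N R (qmono N R \<alpha> s) (cls2 N R (\<Delta> f))"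
      by (rule qmap2_cls2[symmetric]) (use mw mI f in \<open>auto simp: Delta_fs2\<close>)
    ultimately show "ncEps e (rep (qmono N R \<alpha> s X)) = ncEps e (rep X) \<and>
        cls2 N R (\<Delta> (rep (qmono N R \<alpha> s X))) = qmap2 N R (qmono N R \<alpha> s) (cls2 N R (\<Delta> (rep X)))"
      by (simp add: f_def g_def)
  qed
  have br: "braid chi (lift2 (mword \<alpha> s) F) = lift2 (mword \<alpha> s) (braid chi F)" if "F \<in> fs2 N" for F
    using that
  proof (induction rule: fs2_induct)
    case (kron p)
    then obtain u v where uv: "p = (u, v)" "u \<in> W" "v \<in> W" by auto
    then show ?case by (simp add: lift2_kron braid_kron lift2_smul mword_def tens_smul_left
      tens_smul_right tens_kron braid_smul chiw mult_ac)
  qed (auto simp: braid_add braid_smul lift2_add lift2_smul braid_fs2, simp add: lift2_def)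
  show "preserves_braiding N R chi (qmono N R \<alpha> s)"
    unfolding preserves_braiding_def
  proof
    fix Z assume "Z \<in> Qt2 N R"
    then obtain F0 where F0: "F0 \<in> fs2 N" "Z = cls2 N R F0" by (auto simp: Qt2_def)
    define F where "F = rep Z"
    have F: "F \<in> fs2 N" "cls2 N R F = Z" using F0 rep_cls2[OF F0(1)] by (auto simp: F_def cls2_eq_iff)
    have l2: "\<And>F. F \<in> fs2 N \<Longrightarrow> lift2 (mword \<alpha> s) F \<in> fs2 N" using mw by (auto intro: lift2_fs2)
    have q: "qmap2 N R (qmono N R \<alpha> s) (cls2 N R G) = cls2 N R (lift2 (mword \<alpha> s) G)" if "G \<in> fs2 N" for G
      by (rule qmap2_cls2) (use mw mI that in auto)
    define H where "H = rep (qmap2 N R (qmono N R \<alpha> s) Z)"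
    have H: "H \<in> fs2 N" "H - lift2 (mword \<alpha> s) F \<in> I2"
      unfolding H_def F(2)[symmetric] q[OF F(1)] using rep_cls2[OF l2[OF F(1)]] by auto
    have "cls2 N R (braid chi H) = cls2 N R (braid chi (lift2 (mword \<alpha> s) F))"
      using braid_I2[OF H(2)] H F l2 by (subst cls2_eq_iff) (auto simp: braid_fs2 braid_diff)
    also have "\<dots> = qmap2 N R (qmono N R \<alpha> s) (cls2 N R (braid chi F))"
      using F by (simp add: br q braid_fs2)
    finally show "qmap2 N R (qmono N R \<alpha> s) (cls2 N R (braid chi (rep Z)))
        = cls2 N R (braid chi (rep (qmap2 N R (qmono N R \<alpha> s) Z)))"
      by (simp add: F_def H_def)
  qed
qed

end

section \<open>Gradings and automorphisms\<close>

definition wdeg :: "(nat \<Rightarrow> 'g::monoid_add) \<Rightarrow> nat list \<Rightarrow> 'g" where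
  "wdeg g w = sum_list (map g w)"

lemma wdeg_simps [simp]: "wdeg g [] = 0" "wdeg g (x # w) = g x + wdeg g w" "wdeg g (u @ v) = wdeg g u + wdeg g v"
  by (simp_all add: wdeg_def)

lemma wdeg_mset: "mset u = mset v \<Longrightarrow> wdeg (g :: nat \<Rightarrow> 'g::comm_monoid_add) u = wdeg g v"
  unfolding wdeg_def by (metis mset_map sum_mset_sum_list)

lemma wdeg_apply: "wdeg g w k = wdeg (\<lambda>x. g x k) w"
  by (induction w) (auto simp: fun_apply)

definition cmp :: "(nat \<Rightarrow> 'g::monoid_add) \<Rightarrow> 'g \<Rightarrow> 'k::field ncp \<Rightarrow> 'k ncp" where
  "cmp g \<gamma> = pw (\<lambda>w. if wdeg g w = \<gamma> then 1 else 0)"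

definition homog :: "(nat \<Rightarrow> 'g::monoid_add) \<Rightarrow> 'g \<Rightarrow> 'k::field ncp \<Rightarrow> bool" where
  "homog g \<gamma> f \<longleftrightarrow> (\<forall>w\<in>supp f. wdeg g w = \<gamma>)"

lemma cmp_add: "cmp g \<gamma> (f + h) = cmp g \<gamma> f + cmp g \<gamma> h"
  and cmp_diff: "cmp g \<gamma> (f - h) = cmp g \<gamma> f - cmp g \<gamma> h"
  and cmp_smul: "cmp g \<gamma> (smul c f) = smul c (cmp g \<gamma> f)"
  and cmp_zero [simp]: "cmp g \<gamma> 0 = 0"
  and cmp_fs [simp]: "f \<in> fs N \<Longrightarrow> cmp g \<gamma> f \<in> fs N"
  by (simp_all add: cmp_def pw_add pw_diff pw_smul)

lemma cmp_kron: "cmp g \<gamma> (kron w) = (if wdeg g w = \<gamma> then kron w else 0)"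
  by (simp add: cmp_def)

lemma homog_cmp: "homog g \<gamma> (cmp g \<gamma> f)"
  by (auto simp: homog_def cmp_def pw_def supp_def)

lemma homog_cmp_other: "homog h \<delta> f \<Longrightarrow> homog h \<delta> (cmp g \<gamma> f)"
  by (auto simp: homog_def cmp_def pw_def supp_def)

lemma cmp_homog: "homog g \<gamma> f \<Longrightarrow> cmp g \<delta> f = (if \<gamma> = \<delta> then f else 0)"
  by (force simp: homog_def cmp_def pw_def supp_def fun_apply fun_eq_iff)

lemma homog_mul:
  assumes "homog g \<gamma> f" "homog g \<delta> h"
  shows "homog g (\<gamma> + \<delta>) (ncmul f h)"
  unfolding homog_def
proof
  fix w assume "w \<in> supp (ncmul f h)"
  then have "(\<Sum>k\<le>length w. f (take k w) * h (drop k w)) \<noteq> 0" by (simp add: supp_def ncmul_def)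
  then obtain k where "f (take k w) * h (drop k w) \<noteq> 0" by (meson sum.not_neutral_contains_not_neutral)
  then have "wdeg g (take k w) = \<gamma>" "wdeg g (drop k w) = \<delta>" using assms by (auto simp: homog_def supp_def)
  then have "wdeg g (take k w @ drop k w) = \<gamma> + \<delta>" by (simp only: wdeg_simps)
  then show "wdeg g w = \<gamma> + \<delta>" by simp
qed

lemma homog_one: "homog g 0 ncone"
  by (simp add: homog_def ncone_kron)

lemma eq_sum_cmp:
  assumes "f \<in> fs N"
  shows "f = (\<Sum>\<gamma>\<in>wdeg g ` supp f. cmp g \<gamma> f)"
proof
  fix w
  have fin: "finite (supp f)" using assms by (simp add: fs_def)
  have "(\<Sum>\<gamma>\<in>wdeg g ` supp f. cmp g \<gamma> f) w = (\<Sum>\<gamma>\<in>wdeg g ` supp f. if \<gamma> = wdeg g w then f w else 0)"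
    by (auto simp: sum_fun_apply cmp_def pw_def intro!: sum.cong)
  also have "\<dots> = f w" using fin by (auto simp: supp_def)
  finally show "f w = (\<Sum>\<gamma>\<in>wdeg g ` supp f. cmp g \<gamma> f) w" by simp
qed

context presentation
begin

definition graded :: "(nat \<Rightarrow> 'g::monoid_add) \<Rightarrow> bool" where
  "graded g \<longleftrightarrow> (\<forall>r\<in>R. \<exists>\<gamma>. homog g \<gamma> r)"

lemma cmp_ideal:
  assumes "graded g" "f \<in> I"
  shows "cmp g \<gamma> f \<in> I"
  unfolding cmp_def
proof (rule pw_ideal[OF _ assms(2)])
  fix u r v assume "r \<in> R"
  then obtain \<delta> where "\<forall>w\<in>supp r. wdeg g w = \<delta>" using assms(1) by (auto simp: graded_def homog_def)
  then show "\<exists>d. \<forall>w\<in>supp r. (if wdeg g (u @ w @ v) = \<gamma> then 1 else 0) = d" by auto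
qed

lemma cmp_eqv: "graded g \<Longrightarrow> T.eqv f h \<Longrightarrow> T.eqv (cmp g \<gamma> f) (cmp g \<gamma> h)"
  unfolding T.eqv_def cmp_diff[symmetric] by (rule cmp_ideal)

lemma exists_cmp:
  assumes "f \<in> fs N" "f \<notin> I"
  shows "\<exists>w\<in>supp f. cmp g (wdeg g w) f \<notin> I"
proof (rule ccontr)
  assume "\<not> ?thesis"
  then have "(\<Sum>\<gamma>\<in>wdeg g ` supp f. cmp g \<gamma> f) \<in> I" by (auto intro!: fv.subspace_sum I_subspace)
  then show False using assms eq_sum_cmp by metis
qed

lemma eqv_cmp:
  assumes f: "f \<in> fs N" and \<gamma>: "\<And>\<delta>. \<delta> \<noteq> \<gamma> \<Longrightarrow> cmp g \<delta> f \<in> I"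
  shows "T.eqv f (cmp g \<gamma> f)"
proof (rule ccontr)
  assume "\<not> T.eqv f (cmp g \<gamma> f)"
  then have "f - cmp g \<gamma> f \<notin> I" by (simp add: T.eqv_def)
  moreover have "f - cmp g \<gamma> f \<in> fs N" using f by simp
  ultimately obtain \<delta> where \<delta>: "cmp g \<delta> (f - cmp g \<gamma> f) \<notin> I" using exists_cmp by blast
  have "cmp g \<delta> (f - cmp g \<gamma> f) = (if \<delta> = \<gamma> then 0 else cmp g \<delta> f)"
    using cmp_homog[OF homog_cmp[of g \<gamma> f], of \<delta>] by (auto simp: cmp_diff)
  then show False using \<delta> \<gamma>[of \<delta>] by (auto simp: T.J_closed split: if_splits)
qed

end

lemma member_le_sum_list_int:
  "(\<And>x. x \<in> set xs \<Longrightarrow> f x \<ge> (0::int)) \<Longrightarrow> x \<in> set xs \<Longrightarrow> f x \<le> sum_list (map f xs)"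
proof (induction xs)
  case (Cons y ys)
  have "0 \<le> sum_list (map f ys)" using Cons.prems(1) by (intro sum_list_nonneg) auto
  with Cons show ?case by (cases "x = y") force+
qed simp

section \<open>Lifting an algebra automorphism to the free algebra\<close>

locale algebra_aut = presentation N R for N and R :: "'k::field ncp set" +
  fixes \<phi> :: "'k ncp set \<Rightarrow> 'k ncp set"
  assumes aut: "is_alg_aut N R \<phi>"
begin

text \<open>A choice of representatives word by word. Its linear extension lifts \<phi> to the free
  algebra but is multiplicative only modulo the ideal.\<close>

definition psiw :: "nat list \<Rightarrow> 'k ncp" where
  "psiw w = rep (\<phi> (cls N R (kron w)))"

abbreviation "\<psi> \<equiv> lin psiw"

lemma phi_Qt: "X \<in> Qt N R \<Longrightarrow> \<phi> X \<in> Qt N R"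
  using aut by (auto simp: is_alg_aut_def bij_betw_def)

lemma psiw: "w \<in> W \<Longrightarrow> psiw w \<in> fs N \<and> \<phi> (cls N R (kron w)) = cls N R (psiw w)"
  using rep_Qt[OF phi_Qt[of "cls N R (kron w)"]] by (simp add: psiw_def)

lemma psiw_fs: "w \<in> W \<Longrightarrow> psiw w \<in> fs N"
  using psiw by blast

lemma psi_fs: "f \<in> fs N \<Longrightarrow> \<psi> f \<in> fs N"
  by (rule lin_fs) (auto simp: psiw_fs)

lemma psi_add: "f \<in> fs N \<Longrightarrow> g \<in> fs N \<Longrightarrow> \<psi> (f + g) = \<psi> f + \<psi> g"
  and psi_diff: "f \<in> fs N \<Longrightarrow> g \<in> fs N \<Longrightarrow> \<psi> (f - g) = \<psi> f - \<psi> g"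
  by (simp_all add: fs_fsupp lin_add lin_diff)

lemma phi_cls: "f \<in> fs N \<Longrightarrow> \<phi> (cls N R f) = cls N R (\<psi> f)"
proof (induction rule: fs_induct)
  case zero
  have "qsmul N R 0 (cls N R 0) = cls N R 0" by (simp add: qsmul_cls)
  then have "\<phi> (cls N R 0) = qsmul N R 0 (\<phi> (cls N R 0))" using aut cls_in_Qt[of 0] unfolding is_alg_aut_def by (metis fs_zero)
  also have "\<dots> = cls N R 0" using rep_Qt[OF phi_Qt[OF cls_in_Qt[of 0]]] qsmul_cls[of _ 0] by (metis fs_zero fv.scale_zero_left)
  finally show ?case by simp
next
  case (add f g)
  then have "\<phi> (qadd N R (cls N R f) (cls N R g)) = qadd N R (\<phi> (cls N R f)) (\<phi> (cls N R g))"
    using aut by (simp add: is_alg_aut_def)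
  then show ?case using add by (simp add: qadd_cls psi_fs psi_add)
next
  case (smul c f)
  then have "\<phi> (qsmul N R c (cls N R f)) = qsmul N R c (\<phi> (cls N R f))"
    using aut by (simp add: is_alg_aut_def)
  then show ?case using smul by (simp add: qsmul_cls psi_fs lin_smul)
qed (simp add: psiw)

lemma psi_I_iff: assumes "f \<in> fs N" shows "\<psi> f \<in> I \<longleftrightarrow> f \<in> I"
proof -
  have "\<psi> f \<in> I \<longleftrightarrow> \<phi> (cls N R f) = \<phi> (cls N R 0)"
    using assms by (simp add: phi_cls cls_eq_iff psi_fs)
  also have "\<dots> \<longleftrightarrow> cls N R f = cls N R 0"
  proof (rule inj_on_eq_iff)
    show "inj_on \<phi> (Qt N R)" using aut by (simp add: is_alg_aut_def bij_betw_def)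
  qed (use assms in auto)
  finally show ?thesis using assms by (simp add: cls_eq_iff)
qed

lemma psi_I: "f \<in> I \<Longrightarrow> \<psi> f \<in> I"
  using psi_I_iff I_fs by blast

lemma psi_eqv: "f \<in> fs N \<Longrightarrow> g \<in> fs N \<Longrightarrow> T.eqv f g \<Longrightarrow> T.eqv (\<psi> f) (\<psi> g)"
  using psi_I[of "f - g"] by (simp add: T.eqv_def psi_diff)

lemma psi_mul: assumes "f \<in> fs N" "g \<in> fs N" shows "T.eqv (\<psi> (ncmul f g)) (ncmul (\<psi> f) (\<psi> g))"
proof -
  have "\<phi> (qmul N R (cls N R f) (cls N R g)) = qmul N R (\<phi> (cls N R f)) (\<phi> (cls N R g))"
    using aut assms by (simp add: is_alg_aut_def)
  then show ?thesis using assms by (simp add: qmul_cls phi_cls psi_fs cls_eq_iff T.eqv_def)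
qed

lemma psi_one: "T.eqv (\<psi> ncone) ncone"
proof -
  have "\<phi> (qone N R) = qone N R" using aut by (simp add: is_alg_aut_def)
  then show ?thesis by (simp add: qone_def phi_cls psi_fs cls_eq_iff T.eqv_def)
qed

lemma psi_surj: assumes "g \<in> fs N" obtains f where "f \<in> fs N" "T.eqv (\<psi> f) g"
proof -
  have "cls N R g \<in> \<phi> ` Qt N R" using aut assms by (simp add: is_alg_aut_def bij_betw_def)
  then obtain f where "f \<in> fs N" "cls N R g = \<phi> (cls N R f)" by (auto elim: QtE)
  then show ?thesis using that[of f] assms
    by (metis T.eqv_def cls_eq_iff phi_cls psi_fs)
qed

text \<open>In contrast to \<open>psiw\<close>, strictly multiplicative on words, and built from
  freely chosen images \<open>y\<close> of the letters.\<close>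

definition pword :: "(nat \<Rightarrow> 'k ncp) \<Rightarrow> nat list \<Rightarrow> 'k ncp" where
  "pword y w = foldr (\<lambda>x. ncmul (y x)) w ncone"

lemma pword:
  assumes y: "\<And>x. x < N \<Longrightarrow> y x \<in> fs N \<and> T.eqv (psiw [x]) (y x)" and w: "w \<in> W"
  shows "pword y w \<in> fs N \<and> T.eqv (psiw w) (pword y w)"
  using w
proof (induction w)
  case Nil
  then show ?case using psi_one by (simp add: pword_def ncone_kron)
next
  case (Cons x w)
  have "T.eqv (psiw (x # w)) (ncmul (psiw [x]) (psiw w))"
    using psi_mul[of "kron [x]" "kron w"] Cons.prems by (simp add: ncmul_kron)
  also have "T.eqv (ncmul (psiw [x]) (psiw w)) (ncmul (y x) (pword y w))"
    using Cons y by (intro T.eqv_mul) (auto simp: psiw_fs)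
  finally show ?case using Cons y by (simp add: pword_def)
qed

text \<open>Allows the images of the letters to be replaced by homogeneous representatives before
  degrees are computed.\<close>

lemma psi_determined:
  assumes y: "\<And>x. x < N \<Longrightarrow> y x \<in> fs N \<and> T.eqv (psiw [x]) (y x)" and f: "f \<in> fs N"
  shows "T.eqv (\<psi> f) (lin (pword y) f) \<and> lin (pword y) f \<in> fs N"
  using f
proof (induction rule: fs_induct)
  case (add f g)
  then show ?case by (auto simp: fs_fsupp lin_add intro!: T.eqv_add fv.subspace_add)
next
  case (smul c f)
  then show ?case by (auto simp: lin_smul intro!: T.eqv_smul)
next
  case (kron w)
  then show ?case using pword[OF y] by simp
qed simp

text \<open>A positive combination of vectors in the positive cone can only be a basis vector
  if that basis vector is among them, so surjectivity makes the weights of the images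
  of the generators contain all simple roots.\<close>

lemma weight_of_generator:
  fixes g :: "nat \<Rightarrow> nat \<Rightarrow> int"
  assumes gr: "graded g" and y: "\<And>x. x < N \<Longrightarrow> y x \<in> fs N \<and> T.eqv (psiw [x]) (y x)"
    and \<beta>: "\<And>x. x < N \<Longrightarrow> homog g (\<beta> x) (y x)" and nn: "\<And>x k. x < N \<Longrightarrow> 0 \<le> \<beta> x k"
    and j: "j < N" "kron [j] \<notin> I" "g j j = 1" "\<And>k. k \<noteq> j \<Longrightarrow> g j k = 0"
  shows "\<exists>x<N. \<beta> x = g j"
proof -
  obtain f where f: "f \<in> fs N" "T.eqv (\<psi> f) (kron [j])" using psi_surj[of "kron [j]"] j by auto
  have hp: "homog g (wdeg \<beta> w) (pword y w)" if "w \<in> W" for w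
    using that by (induction w) (auto simp: pword_def homog_one intro!: homog_mul \<beta>)
  have "\<exists>w\<in>W. wdeg \<beta> w = g j"
  proof (rule ccontr)
    assume no: "\<not> ?thesis"
    \<comment> \<open>Without a word of weight \<open>g j\<close> no term of the preimage
      contributes to this component, although \<open>kron [j]\<close> lies in it and is nonzero in
      the quotient.\<close>
    have "cmp g (g j) (lin (pword y) f) = 0" using f(1)
      by (induction rule: fs_induct)
        (use no cmp_homog[OF hp] in \<open>auto simp: fs_fsupp lin_add cmp_add lin_smul cmp_smul\<close>)
    moreover have "T.eqv (lin (pword y) f) (kron [j])"
      using psi_determined[OF y f(1)] f(2) T.eqv_sym T.eqv_trans by blast
    ultimately have "T.eqv 0 (kron [j])"
      using cmp_eqv[OF gr, of "lin (pword y) f" "kron [j]" "g j"] by (simp add: cmp_kron)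
    then have "kron [j] \<in> I" using T.eqv_sym T.eqv_zero_iff by blast
    then show False using j by simp
  qed
  then obtain w where w: "w \<in> W" "wdeg \<beta> w = g j" by blast
  have wN: "x < N" if "x \<in> set w" for x using w(1) that by (auto simp: words_def)
  have s: "sum_list (map (\<lambda>x. \<beta> x k) w) = g j k" for k
    using wdeg_apply[of \<beta> w k] w(2) by (simp add: wdeg_def)
  have "\<exists>x\<in>set w. \<beta> x j \<noteq> 0"
  proof (rule ccontr)
    assume "\<not> ?thesis"
    then have "map (\<lambda>x. \<beta> x j) w = map (\<lambda>x. 0) w" by simp
    then have "sum_list (map (\<lambda>x. \<beta> x j) w) = 0" by (simp only: sum_list_0)
    then show False using s[of j] j by simp
  qed
  then obtain x where x: "x \<in> set w" "\<beta> x j \<noteq> 0" by blast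
  \<comment> \<open>All summands are nonnegative, so \<open>\<beta> x\<close> lies between 0 and the
    unit vector \<open>g j\<close>; at \<open>j\<close> it is nonzero, hence 1.\<close>
  have le: "\<beta> x k \<le> g j k" for k
    using member_le_sum_list_int[of w "\<lambda>x. \<beta> x k" x] nn wN x(1) s[of k] by auto
  have "\<beta> x k = g j k" for k
    using le[of k] nn[OF wN[OF x(1)], of k] j x(2) by (cases "k = j") auto
  then show ?thesis using wN[OF x(1)] by auto
qed

end

text \<open>A choice of \<open>\<tau> j\<close> with weight \<open>g j\<close> is injective because
  \<open>g\<close> is, so it permutes the finite index set; \<sigma> is its inverse.\<close>

lemma permutation_of_weights:
  assumes cover: "\<And>j. j < n \<Longrightarrow> \<exists>x<n. \<beta> x = g j" and inj: "inj_on g {..<n}"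
  shows "\<exists>\<sigma>. \<sigma> permutes {..<(n::nat)} \<and> (\<forall>x<n. \<beta> x = g (\<sigma> x))"
proof -
  obtain \<tau> where \<tau>: "\<And>j. j < n \<Longrightarrow> \<tau> j < n \<and> \<beta> (\<tau> j) = g j" using cover by metis
  define \<tau>' where "\<tau>' = (\<lambda>j. if j < n then \<tau> j else j)"
  have "inj_on \<tau>' {..<n}"
  proof (rule inj_onI)
    fix x y assume "x \<in> {..<n}" "y \<in> {..<n}" "\<tau>' x = \<tau>' y"
    then have "g x = g y" "x < n" "y < n" using \<tau> by (metis \<tau>'_def lessThan_iff)+
    then show "x = y" using inj by (auto dest: inj_onD)
  qed
  moreover have "\<tau>' ` {..<n} \<subseteq> {..<n}" using \<tau> by (auto simp: \<tau>'_def)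
  ultimately have "bij_betw \<tau>' {..<n} {..<n}"
    by (auto simp: bij_betw_def endo_inj_surj)
  then have p: "\<tau>' permutes {..<n}" by (rule bij_imp_permutes) (simp add: \<tau>'_def)
  have "\<beta> x = g (inv \<tau>' x)" if "x < n" for x
  proof -
    have "inv \<tau>' x < n" using permutes_in_image[OF permutes_inv[OF p], of x] that by auto
    then have "\<beta> (\<tau>' (inv \<tau>' x)) = g (inv \<tau>' x)" using \<tau> by (simp add: \<tau>'_def)
    then show ?thesis using permutes_inverses[OF p] by simp
  qed
  then show ?thesis using permutes_inv[OF p] by blast
qed

context hopf_presentation
begin

text \<open>Turns the condition on classes and chosen representatives into a congruence for the lift
  \<open>h\<close>; the coproduct, the counit and the tensor square of \<open>h\<close> all respect
  the ideals.\<close>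

lemma coalg_psi:
  assumes "is_alg_aut N R \<phi>" "is_coalg_map N R chi D e \<phi>" and f: "f \<in> fs N"
  defines "h \<equiv> algebra_aut.psiw N R \<phi>"
  shows "\<Delta> (lin h f) - lift2 h (\<Delta> f) \<in> I2" and "ncEps e (lin h f) = ncEps e f"
proof -
  interpret algebra_aut N R \<phi> by unfold_locales (rule assms(1))
  define X where "X = cls N R f"
  have X: "X \<in> Qt N R" using f by (simp add: X_def)
  define u where "u = rep X"
  define v where "v = rep (\<phi> X)"
  have u: "u \<in> fs N" "u - f \<in> I" using rep_cls[OF f] by (auto simp: u_def X_def)
  have v: "v \<in> fs N" "v - \<psi> f \<in> I" using rep_cls[OF psi_fs[OF f]] by (auto simp: v_def X_def phi_cls[OF f])
  have h: "h = psiw" by (simp add: h_def)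
  have co: "ncEps e v = ncEps e u" "cls2 N R (\<Delta> v) = qmap2 N R \<phi> (cls2 N R (\<Delta> u))"
    using assms(2) X by (auto simp: is_coalg_map_def u_def v_def)
  show "ncEps e (lin h f) = ncEps e f"
    using co(1) eps_I[OF u(2)] eps_I[OF v(2)] u(1) v(1) f psi_fs[OF f] by (simp add: eps_diff h)
  have "qmap2 N R \<phi> (cls2 N R (\<Delta> u)) = cls2 N R (lift2 h (\<Delta> u))"
    unfolding h by (rule qmap2_cls2) (use psiw psi_I u in \<open>auto simp: Delta_fs2\<close>)
  then have 1: "\<Delta> v - lift2 h (\<Delta> u) \<in> I2"
    using co(2) u v psiw by (subst cls2_eq_iff[symmetric]) (auto simp: Delta_fs2 h intro!: lift2_fs2)
  have 2: "\<Delta> v - \<Delta> (\<psi> f) \<in> I2" using Delta_I[OF v(2)] v(1) psi_fs[OF f] by (simp add: Delta_diff)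
  have 3: "lift2 h (\<Delta> u) - lift2 h (\<Delta> f) \<in> I2"
    using lift2_ideal[of psiw "\<Delta> (u - f)"] psiw_fs psi_I Delta_I[OF u(2)] u(1) f
    by (simp add: Delta_diff lift2_diff Delta_fs2 h)
  have "\<Delta> (\<psi> f) - lift2 h (\<Delta> f) = (\<Delta> v - lift2 h (\<Delta> u)) - (\<Delta> v - \<Delta> (\<psi> f)) + (lift2 h (\<Delta> u) - lift2 h (\<Delta> f))"
    by simp
  also have "\<dots> \<in> I2" by (intro T2.J_closed 1 2 3)
  finally show "\<Delta> (lin h f) - lift2 h (\<Delta> f) \<in> I2" by (simp add: h)
qed

lemma braid_psi:
  assumes "is_alg_aut N R \<phi>" "preserves_braiding N R chi \<phi>" and F: "F \<in> fs2 N"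
  defines "h \<equiv> algebra_aut.psiw N R \<phi>"
  shows "lift2 h (braid chi F) - braid chi (lift2 h F) \<in> I2"
proof -
  interpret algebra_aut N R \<phi> by unfold_locales (rule assms(1))
  have h: "h = psiw" by (simp add: h_def)
  have l2: "G \<in> fs2 N \<Longrightarrow> lift2 h G \<in> fs2 N" for G using psiw_fs by (auto simp: h intro: lift2_fs2)
  have q: "qmap2 N R \<phi> (cls2 N R G) = cls2 N R (lift2 h G)" if "G \<in> fs2 N" for G
    unfolding h by (rule qmap2_cls2) (use psiw psi_I that in auto)
  define Z where "Z = cls2 N R F"
  define u where "u = rep Z"
  have u: "u \<in> fs2 N" "u - F \<in> I2" using rep_cls2[OF F] by (auto simp: u_def Z_def)
  have Zu: "Z = cls2 N R u" using u F by (simp add: Z_def cls2_eq_iff fv.subspace_diff[OF I2_subspace] T2.eqv_sym[unfolded T2.eqv_def])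
  define v where "v = rep (qmap2 N R \<phi> Z)"
  have v: "v \<in> fs2 N" "v - lift2 h F \<in> I2" using rep_cls2[OF l2[OF F]] by (auto simp: v_def Z_def q[OF F])
  have "qmap2 N R \<phi> (cls2 N R (braid chi u)) = cls2 N R (braid chi v)"
    using assms(2) F by (auto simp: preserves_braiding_def Qt2_def u_def v_def Z_def)
  then have 1: "lift2 h (braid chi u) - braid chi v \<in> I2"
    using u v l2 by (simp add: q braid_fs2 cls2_eq_iff)
  have 2: "lift2 h (braid chi u) - lift2 h (braid chi F) \<in> I2"
    using lift2_ideal[of psiw "braid chi (u - F)"] psiw_fs psi_I braid_I2[OF u(2)] u(1) F
    by (simp add: lift2_diff braid_fs2 h braid_diff)
  have 3: "braid chi v - braid chi (lift2 h F) \<in> I2" using braid_I2[OF v(2)] by (simp add: braid_diff)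
  have "lift2 h (braid chi F) - braid chi (lift2 h F) = (lift2 h (braid chi u) - braid chi v)
      - (lift2 h (braid chi u) - lift2 h (braid chi F)) + (braid chi v - braid chi (lift2 h F))" by simp
  also have "\<dots> \<in> I2" by (intro T2.J_closed 1 2 3)
  finally show ?thesis .
qed

end

section \<open>The two presentations\<close>

text \<open>The root lattice degree: \<open>E_x\<close> has the \<open>x\<close>-th simple root, a
  unit vector, and the \<open>K\<close> letters have degree 0. Coordinates from \<open>n\<close> on
  are kept at 0, so that weights can be compared as functions.\<close>

definition edeg :: "nat \<Rightarrow> nat \<Rightarrow> nat \<Rightarrow> int" where
  "edeg n x = (\<lambda>k. if k < n \<and> x = k then 1 else 0)"

text \<open>The exponent vector of the \<open>K\<close> letters. On words without \<open>E\<close>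
  it determines the class in the Borel algebra.\<close>

definition kdeg :: "nat \<Rightarrow> nat \<Rightarrow> nat \<Rightarrow> int" where
  "kdeg n x = (\<lambda>k. if k < n \<and> x = n + k then 1 else if k < n \<and> x = 2 * n + k then - 1 else 0)"

definition Efree :: "nat \<Rightarrow> nat list \<Rightarrow> bool" where
  "Efree n w \<longleftrightarrow> (\<forall>x\<in>set w. n \<le> x)"

lemma Efree_simps [simp]: "Efree n []" "Efree n (x # w) \<longleftrightarrow> n \<le> x \<and> Efree n w"
  "Efree n (u @ v) \<longleftrightarrow> Efree n u \<and> Efree n v"
  by (auto simp: Efree_def)

lemma edeg_ge [simp]: "n \<le> x \<Longrightarrow> edeg n x = 0"
  by (auto simp: edeg_def fun_apply fun_eq_iff)

lemma kdeg_less [simp]: "x < n \<Longrightarrow> kdeg n x = 0"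
  by (auto simp: kdeg_def fun_apply fun_eq_iff)

lemma kdeg_K: "x < n \<Longrightarrow> kdeg n (n + x) = edeg n x"
  and kdeg_K': "x < n \<Longrightarrow> kdeg n (2 * n + x) = - edeg n x"
  by (auto simp: kdeg_def edeg_def fun_apply fun_eq_iff)

lemma edeg_nonneg: "0 \<le> edeg n x k"
  by (simp add: edeg_def)

lemma edeg_inj: "inj_on (edeg n) {..<n}"
  by (auto simp: inj_on_def edeg_def fun_eq_iff split: if_splits)

lemma wdeg_edeg_nonneg: "0 \<le> wdeg (edeg n) w k"
  by (induction w) (auto simp: fun_apply edeg_nonneg)

lemma wdeg_edeg_ge: "n \<le> k \<Longrightarrow> wdeg (edeg n) w k = 0"
  by (induction w) (auto simp: fun_apply edeg_def)

lemma Efree_wdeg: "Efree n w \<longleftrightarrow> wdeg (edeg n) w = 0"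
proof
  show "Efree n w \<Longrightarrow> wdeg (edeg n) w = 0" by (induction w) auto
  show "wdeg (edeg n) w = 0 \<Longrightarrow> Efree n w"
  proof (induction w)
    case (Cons x w)
    have s: "edeg n x k + wdeg (edeg n) w k = 0" for k
      using fun_cong[OF Cons.prems, of k] by (simp add: fun_apply)
    have "n \<le> x" using s[of x] wdeg_edeg_nonneg[of n w x] by (auto simp: edeg_def split: if_splits)
    with Cons show ?case by simp
  qed simp
qed

lemma chiw_prod: "chiw chi u v = prod_list (map (\<lambda>x. prod_list (map (chi x) v)) u)"
  by (induction u) (auto simp: chiw_def)

lemma prod_list_mset: "mset u = mset v \<Longrightarrow> prod_list (map (f :: nat \<Rightarrow> 'k::comm_monoid_mult) u) = prod_list (map f v)"
  by (metis mset_map prod_mset_prod_list)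

lemma chiw_mset: "mset u = mset u' \<Longrightarrow> mset v = mset v' \<Longrightarrow> chiw chi u v = chiw chi u' (v' :: nat list)"
proof -
  assume u: "mset u = mset u'" and v: "mset v = mset v'"
  have "prod_list (map (chi x) v) = prod_list (map (chi x) v')" for x
    using v by (rule prod_list_mset)
  then show "chiw chi u v = chiw chi u' v'"
    unfolding chiw_prod by (simp add: prod_list_mset[OF u])
qed

lemma supp_sum: "x \<in> supp (\<Sum>i\<in>A. f i) \<Longrightarrow> \<exists>i\<in>A. x \<in> supp (f i :: _ \<Rightarrow> 'k::field)"
  by (auto simp: supp_def sum_fun_apply intro: sum.not_neutral_contains_not_neutral)

lemma ncpow_gen: "ncpow (ncgen i) k = kron (replicate k i)"
  unfolding ncpow_def by (induction k) (auto simp: ncone_kron ncgen_kron ncmul_kron)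

lemma left_gen_pow: "(ncmul (ncgen i) ^^ k) (kron w) = kron (replicate k i @ w)"
  by (induction k) (auto simp: ncgen_kron ncmul_kron)

lemma right_gen_pow: "((\<lambda>y. ncmul y (ncgen i)) ^^ k) (kron w) = kron (w @ replicate k i)"
  by (induction k) (auto simp: ncgen_kron ncmul_kron replicate_append_same)

lemma serre_words: "serre q a d i j =
    (\<Sum>v\<le>nat (1 - a i j). smul (qcf (q ^ d i) (nat (1 - a i j)) v)
      (kron (replicate (nat (1 - a i j) - v) i @ j # replicate v i)))"
  unfolding serre_def Let_def
  by (rule sum.cong) (auto simp: ncpow_gen qcf_def ncgen_kron[of j] ncmul_kron)

lemma serre_srr: "serre q a d i j = srr ncmul (q ^ d i) 1 (nat (1 - a i j)) (ncgen i) (ncgen j)"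
  unfolding serre_words srr_def
  by (rule sum.cong) (auto simp: left_gen_pow right_gen_pow ncgen_kron[of j])

lemma serre_mset: "w \<in> supp (serre q a d i j) \<Longrightarrow> mset w = add_mset j (replicate_mset (nat (1 - a i j)) i)"
  unfolding serre_words
  by (drule supp_sum) (auto dest!: subsetD[OF supp_smul] simp: multiset_eq_iff)

lemma serre_fs: "i < N \<Longrightarrow> j < N \<Longrightarrow> serre q a d i j \<in> fs N"
proof -
  have r: "i < N \<Longrightarrow> replicate k i \<in> words N" for k by (induction k) auto
  then show "i < N \<Longrightarrow> j < N \<Longrightarrow> ?thesis" unfolding serre_words
    by (intro fv.subspace_sum fs_smul) auto
qed

lemma relsU_fs: "relsU n q a d \<subseteq> fs n"
  by (auto simp: relsU_def serre_fs)

lemma fs_mono: "M \<le> N \<Longrightarrow> fs M \<subseteq> fs N"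
  by (force simp: fs_def)

lemma relsB_fs: "relsB n q a d \<subseteq> fs (3 * n)"
  using relsU_fs[of n q a d] fs_mono[of n "3 * n"] by (auto simp: relsB_def)

text \<open>All words of \<open>f\<close> are rearrangements of one another. This yields homogeneity
  for every commutative grading and constant \<open>chi\<close> factors at once.\<close>

definition mhomog :: "'k::field ncp \<Rightarrow> bool" where
  "mhomog f \<longleftrightarrow> (\<exists>M. \<forall>w\<in>supp f. mset w = M)"

lemma mhomog_serre: "mhomog (serre q a d i j)"
  unfolding mhomog_def using serre_mset by blast

lemma mhomog_homog: "mhomog f \<Longrightarrow> \<exists>\<gamma>. homog (g :: nat \<Rightarrow> 'g::comm_monoid_add) \<gamma> f"
proof -
  assume "mhomog f"
  then obtain M where M: "\<And>w. w \<in> supp f \<Longrightarrow> mset w = M" by (auto simp: mhomog_def)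
  have "\<forall>w\<in>supp f. wdeg g w = wdeg g (SOME w. w \<in> supp f)"
  proof
    fix w assume w: "w \<in> supp f"
    then have "(SOME w. w \<in> supp f) \<in> supp f" by (rule someI)
    with w show "wdeg g w = wdeg g (SOME w. w \<in> supp f)" using M by (intro wdeg_mset) simp
  qed
  then show ?thesis by (auto simp: homog_def)
qed

lemma mhomog_chi:
  assumes "mhomog f" shows "\<exists>c. \<forall>w\<in>supp f. chiw chi w v = c" "\<exists>c. \<forall>w\<in>supp f. chiw chi v w = c"
proof -
  obtain M where M: "\<And>w. w \<in> supp f \<Longrightarrow> mset w = M" using assms by (auto simp: mhomog_def)
  have "\<forall>w\<in>supp f. chiw chi w v = chiw chi (SOME w. w \<in> supp f) v \<and> chiw chi v w = chiw chi v (SOME w. w \<in> supp f)"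
  proof
    fix w assume w: "w \<in> supp f"
    then have "(SOME w. w \<in> supp f) \<in> supp f" by (rule someI)
    with w have "mset w = mset (SOME w. w \<in> supp f)" using M by simp
    then show "chiw chi w v = chiw chi (SOME w. w \<in> supp f) v \<and> chiw chi v w = chiw chi v (SOME w. w \<in> supp f)"
      using chiw_mset by blast
  qed
  then show "\<exists>c. \<forall>w\<in>supp f. chiw chi w v = c" "\<exists>c. \<forall>w\<in>supp f. chiw chi v w = c" by blast+
qed

lemma tens_one_mul:
  assumes f: "f \<in> fs N" and g: "g \<in> (fs N :: 'k::field ncp set)"
  shows "mul2 chi (tens f ncone) (tens g ncone) = tens (ncmul f g) ncone"
  using g
  by (induction rule: fs_induct) (use f in \<open>auto simp: tens_add_left tens_smul_left mul2_add_right mul2_smul_right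
    ncmul_add_right ncmul_smul_right tens_kron ncone_kron tens_mul_left\<close>)

lemma one_tens_mul:
  assumes f: "f \<in> fs N" and g: "g \<in> (fs N :: 'k::field ncp set)"
  shows "mul2 chi (tens ncone f) (tens ncone g) = tens ncone (ncmul f g)"
  using f
  by (induction rule: fs_induct) (use g in \<open>auto simp: tens_add_right tens_smul_right mul2_add_left mul2_smul_left
    ncmul_add_left ncmul_smul_left tens_kron ncone_kron tens_mul_right\<close>)

lemma srr_tens_one:
  "f \<in> fs N \<Longrightarrow> g \<in> fs N \<Longrightarrow> srr (mul2 chi) t s m (tens f ncone) (tens g ncone) = tens (srr ncmul t s m f g) ncone"
  by (rule srr_hom[where C = "fs N" and h = "\<lambda>f. tens f ncone", symmetric])
    (auto simp: tens_one_mul[of _ N] tens_add_left tens_smul_left)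

lemma srr_one_tens:
  "f \<in> fs N \<Longrightarrow> g \<in> fs N \<Longrightarrow> srr (mul2 chi) t s m (tens ncone f) (tens ncone g) = tens ncone (srr ncmul t s m f g)"
  by (rule srr_hom[where C = "fs N" and h = "\<lambda>f. tens ncone f", symmetric])
    (auto simp: one_tens_mul[of _ N] tens_add_right tens_smul_right)

section \<open>Cartan data, the invariant form and the Serre relations of the positive part\<close>

locale quantum_data =
  fixes q :: "'k::field_char_0" and n :: nat and a :: "nat \<Rightarrow> nat \<Rightarrow> int" and d :: "nat \<Rightarrow> nat"
  assumes q_transcendental: "\<not> algebraic q" and cartan: "simple_cartan n a"
    and symmetrizer: "symmetrizer n a d"
begin

lemma q_nonzero: "q \<noteq> 0"
  using q_transcendental by auto

text \<open>Otherwise \<open>X ^ k - 1\<close> would be a nonzero integer polynomial with root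
  \<open>q\<close>.\<close>

lemma q_power: assumes "q ^ k = 1" shows "k = 0"
proof (rule ccontr)
  assume k: "k \<noteq> 0"
  have "algebraic q"
  proof (rule algebraicI)
    show "coeff (monom 1 k - 1 :: 'k poly) i \<in> \<int>" for i by simp
    have "coeff (monom 1 k - 1 :: 'k poly) k = 1" using k by simp
    then show "(monom 1 k - 1 :: 'k poly) \<noteq> 0" by (metis coeff_0 zero_neq_one)
    show "poly (monom 1 k - 1) q = 0" using assms by (simp add: poly_monom)
  qed
  then show False using q_transcendental by simp
qed

lemma q_powi: assumes "q powi i = q powi j" shows "i = j"
proof -
  have "q powi k = 1 \<Longrightarrow> k = 0" for k :: int
    using q_power[of "nat k"] q_power[of "nat (- k)"]
    by (auto simp: power_int_def power_inverse split: if_splits)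
  moreover have "q powi (i - j) = 1" using assms q_nonzero by (simp add: power_int_diff)
  ultimately show ?thesis by fastforce
qed

lemma a_diag: "i < n \<Longrightarrow> a i i = 2"
  and a_off: "i < n \<Longrightarrow> j < n \<Longrightarrow> i \<noteq> j \<Longrightarrow> a i j \<le> 0"
  and a_zero: "i < n \<Longrightarrow> j < n \<Longrightarrow> a i j = 0 \<Longrightarrow> a j i = 0"
  and n_pos: "0 < n"
proof -
  show "i < n \<Longrightarrow> a i i = 2" "0 < n" using cartan by (auto simp: simple_cartan_def)
  show "i < n \<Longrightarrow> j < n \<Longrightarrow> i \<noteq> j \<Longrightarrow> a i j \<le> 0" using cartan by (auto simp: simple_cartan_def)
  show "i < n \<Longrightarrow> j < n \<Longrightarrow> a i j = 0 \<Longrightarrow> a j i = 0"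
    using cartan by (cases "i = j") (auto simp: simple_cartan_def)
qed

lemma d_pos: "i < n \<Longrightarrow> 0 < d i"
  and d_sym: "i < n \<Longrightarrow> j < n \<Longrightarrow> int (d i) * a i j = int (d j) * a j i"
  using symmetrizer by (auto simp: symmetrizer_def)

text \<open>The indices at which the ratio agrees with the one at 0 are closed under edges of the
  Dynkin diagram, so indecomposability gives all of them. This carries positivity from the
  symmetrizer in \<open>simple_cartan\<close> over to \<open>d\<close>, and compares
  \<open>d\<close> with its pullback by a diagram automorphism.\<close>

lemma symmetrizers_proportional:
  assumes e: "\<And>i j. i < n \<Longrightarrow> j < n \<Longrightarrow> int (e i) * a i j = int (e j) * a j i"
    and f: "\<And>i j. i < n \<Longrightarrow> j < n \<Longrightarrow> int (f i) * a i j = int (f j) * a j i"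
    and "i < n"
  shows "f i * e 0 = f 0 * e i"
proof -
  let ?S = "{i. i < n \<and> f i * e 0 = f 0 * e i}"
  have "?S = {..<n}"
  proof (rule ccontr)
    assume "?S \<noteq> {..<n}"
    moreover have "0 \<in> ?S" using n_pos by simp
    then have "?S \<noteq> {}" by blast
    moreover have "?S \<subseteq> {..<n}" by auto
    moreover have "\<forall>S. S \<subseteq> {..<n} \<and> S \<noteq> {} \<and> S \<noteq> {..<n} \<longrightarrow> (\<exists>i\<in>S. \<exists>j\<in>{..<n} - S. a i j \<noteq> 0)"
      using cartan by (simp add: simple_cartan_def)
    ultimately obtain i j where i: "i < n" "f i * e 0 = f 0 * e i" and j: "j < n" "j \<notin> ?S" and aij: "a i j \<noteq> 0"
      by blast
    have aji: "a j i \<noteq> 0" using a_zero[of j i] aij i j by auto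
    have "int (f j * e 0) * a j i = int (f j) * a j i * int (e 0)" by simp
    also have "\<dots> = int (f i) * a i j * int (e 0)" by (simp only: f[OF i(1) j(1)])
    also have "\<dots> = int (f i * e 0) * a i j" by simp
    also have "\<dots> = int (f 0) * (int (e i) * a i j)" by (simp add: i(2))
    also have "\<dots> = int (f 0) * (int (e j) * a j i)" by (simp only: e[OF i(1) j(1)])
    also have "\<dots> = int (f 0 * e j) * a j i" by simp
    finally have "int (f j * e 0) = int (f 0 * e j)" using aji by simp
    then show False using j by (simp only: of_nat_eq_iff) simp
  qed
  then show ?thesis using assms(3) by auto
qed

text \<open>The invariant form on the root lattice, the simple roots being the unit vectors.\<close>

definition bil :: "(nat \<Rightarrow> int) \<Rightarrow> (nat \<Rightarrow> int) \<Rightarrow> int" where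
  "bil \<beta> \<gamma> = (\<Sum>k<n. \<Sum>l<n. \<beta> k * (int (d k) * a k l) * \<gamma> l)"

lemma bil_add: "bil (\<beta> + \<beta>') \<gamma> = bil \<beta> \<gamma> + bil \<beta>' \<gamma>" "bil \<gamma> (\<beta> + \<beta>') = bil \<gamma> \<beta> + bil \<gamma> \<beta>'"
  by (simp_all add: bil_def fun_apply algebra_simps sum.distrib)

lemma bil_diff: "bil (\<beta> - \<beta>') \<gamma> = bil \<beta> \<gamma> - bil \<beta>' \<gamma>" "bil \<gamma> (\<beta> - \<beta>') = bil \<gamma> \<beta> - bil \<gamma> \<beta>'"
  by (simp_all add: bil_def fun_apply algebra_simps sum_subtractf)

lemma bil_zero [simp]: "bil 0 \<gamma> = 0" "bil \<gamma> 0 = 0"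
  by (simp_all add: bil_def fun_apply)

lemma bil_uminus: "bil (- \<beta>) \<gamma> = - bil \<beta> \<gamma>" "bil \<gamma> (- \<beta>) = - bil \<gamma> \<beta>"
  by (simp_all add: bil_def fun_apply sum_negf)

lemma sum_edeg: "j < n \<Longrightarrow> (\<Sum>l<n. f l * edeg n j l) = f j"
proof -
  have "(\<Sum>l<n. f l * edeg n j l) = (\<Sum>l<n. if l = j then f l else 0)"
    by (rule sum.cong) (auto simp: edeg_def)
  then show "j < n \<Longrightarrow> ?thesis" by simp
qed

lemma bil_edeg: "i < n \<Longrightarrow> j < n \<Longrightarrow> bil (edeg n i) (edeg n j) = int (d i) * a i j"
proof -
  assume "i < n" "j < n"
  then have "bil (edeg n i) (edeg n j) = (\<Sum>k<n. edeg n i k * (int (d k) * a k j))"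
    unfolding bil_def by (simp only: sum_edeg)
  also have "\<dots> = (\<Sum>k<n. (int (d k) * a k j) * edeg n i k)"
    by (simp only: mult.commute)
  also have "\<dots> = int (d i) * a i j" using \<open>i < n\<close> by (rule sum_edeg)
  finally show ?thesis .
qed

text \<open>By \<open>d i * e 0 = d 0 * e i\<close>, the form of \<open>d\<close> multiplied by
  \<open>e 0\<close> is \<open>d 0\<close> times the positive definite form of
  \<open>e\<close>.\<close>

lemma bil_pos: assumes "k < n" "\<beta> k \<noteq> 0" shows "0 < bil \<beta> \<beta>"
proof -
  have "\<exists>e::nat \<Rightarrow> nat. (\<forall>i<n. e i > 0) \<and> (\<forall>i<n. \<forall>j<n. int (e i) * a i j = int (e j) * a j i)
      \<and> (\<forall>x::nat \<Rightarrow> real. (\<exists>i<n. x i \<noteq> 0) \<longrightarrow>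
        (\<Sum>i<n. \<Sum>j<n. x i * of_int (int (e i) * a i j) * x j) > 0)"
    using cartan unfolding simple_cartan_def by (elim conjE) assumption
  then obtain e :: "nat \<Rightarrow> nat" where e: "\<forall>i<n. e i > 0"
    "\<forall>i<n. \<forall>j<n. int (e i) * a i j = int (e j) * a j i"
    "\<forall>x::nat \<Rightarrow> real. (\<exists>i<n. x i \<noteq> 0) \<longrightarrow> (\<Sum>i<n. \<Sum>j<n. x i * of_int (int (e i) * a i j) * x j) > 0"
    by (elim exE conjE)
  let ?x = "\<lambda>i. real_of_int (\<beta> i)"
  have de: "real (d i) * real (e 0) = real (d 0) * real (e i)" if "i < n" for i
  proof -
    have "d i * e 0 = d 0 * e i"
      by (rule symmetrizers_proportional[of e d]) (use e(2) d_sym that in auto)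
    then show ?thesis by (simp only: of_nat_mult[symmetric])
  qed
  have "\<exists>i<n. ?x i \<noteq> 0" using assms by auto
  then have pos: "(\<Sum>i<n. \<Sum>j<n. ?x i * of_int (int (e i) * a i j) * ?x j) > 0"
    using e(3)[THEN spec, of ?x] by blast
  have "real_of_int (bil \<beta> \<beta>) * real (e 0) = (\<Sum>i<n. \<Sum>j<n. ?x i * (real (d i) * of_int (a i j)) * ?x j * real (e 0))"
    by (simp add: bil_def sum_distrib_right)
  also have "\<dots> = (\<Sum>i<n. \<Sum>j<n. real (d 0) * (?x i * of_int (int (e i) * a i j) * ?x j))"
  proof (intro sum.cong refl)
    fix i j assume "i \<in> {..<n}"
    have "?x i * (real (d i) * of_int (a i j)) * ?x j * real (e 0)
        = (real (d i) * real (e 0)) * (?x i * of_int (a i j) * ?x j)" by (simp only: mult_ac)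
    also have "\<dots> = (real (d 0) * real (e i)) * (?x i * of_int (a i j) * ?x j)"
      using \<open>i \<in> {..<n}\<close> de[of i] by simp
    finally show "?x i * (real (d i) * of_int (a i j)) * ?x j * real (e 0)
        = real (d 0) * (?x i * of_int (int (e i) * a i j) * ?x j)" by simp
  qed
  also have "\<dots> = real (d 0) * (\<Sum>i<n. \<Sum>j<n. ?x i * of_int (int (e i) * a i j) * ?x j)"
    by (simp only: sum_distrib_left)
  also have "\<dots> > 0"
    using pos d_pos[OF n_pos] by (intro mult_pos_pos) auto
  finally have "0 < real_of_int (bil \<beta> \<beta>) * real (e 0)" .
  then have "0 < real_of_int (bil \<beta> \<beta>)" by (metis mult_nonpos_nonneg not_le of_nat_0_le_iff)
  then show ?thesis by simp
qed

text \<open>\<open>d\<close> composed with \<sigma> is again a symmetrizer, hence proportional to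
  \<open>d\<close>; both have the same sum over all indices, so the ratio is 1.\<close>

lemma autdiagr_d: assumes "\<sigma> \<in> autdiagr n a" "i < n" shows "d (\<sigma> i) = d i"
proof -
  have p: "\<sigma> permutes {..<n}" and s: "\<And>i j. i < n \<Longrightarrow> j < n \<Longrightarrow> a (\<sigma> i) (\<sigma> j) = a i j"
    using assms(1) by (auto simp: autdiagr_def)
  have sn: "\<sigma> i < n" if "i < n" for i using permutes_in_image[OF p, of i] that by simp
  have ratio: "d (\<sigma> i) * d 0 = d (\<sigma> 0) * d i" if "i < n" for i
    by (rule symmetrizers_proportional[of d "\<lambda>i. d (\<sigma> i)"]) (use d_sym sn s that in \<open>metis+\<close>)
  have "sum d {..<n} * d 0 = (\<Sum>i<n. d (\<sigma> i)) * d 0"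
    using sum.permute[OF p, of d] by (simp add: comp_def)
  also have "\<dots> = d (\<sigma> 0) * sum d {..<n}"
    using ratio by (simp add: sum_distrib_right sum_distrib_left)
  finally have "sum d {..<n} * (d 0) = sum d {..<n} * d (\<sigma> 0)" by (simp add: mult.commute)
  moreover have "sum d {..<n} > 0" using n_pos d_pos by (intro sum_pos) auto
  ultimately have "d (\<sigma> 0) = d 0" by (metis mult_cancel1 less_numeral_extra(3))
  then show ?thesis using ratio[OF assms(2)] d_pos[OF n_pos] by simp
qed

lemma qint_q_nonzero: assumes "i < n" "1 \<le> j" shows "qint (q ^ d i) j \<noteq> 0"
proof (rule qint_nonzero)
  show "(q ^ d i) ^ (2 * j) \<noteq> 1"
    using q_power[of "d i * (2 * j)"] d_pos[OF assms(1)] assms(2) by (auto simp: power_mult[symmetric])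
qed (simp add: q_nonzero)

lemma q_square: "i < n \<Longrightarrow> (q ^ d i)\<^sup>2 = q powi (int (d i) * a i i)"
  using power_int_of_nat[of q "2 * d i"] by (simp add: a_diag power_mult[symmetric] mult.commute)

text \<open>With \<open>m = 1 - a i j\<close> the exponent \<open>1 - m\<close> is
  \<open>a i j\<close>. Thus the scalar demanded by the factored Serre sum is exactly the braiding
  of \<open>E_i\<close> with \<open>E_j\<close>.\<close>

lemma q_serre_power:
  assumes "i < n" "j < n" "i \<noteq> j"
  shows "(q ^ d i) powi (1 - int (nat (1 - a i j))) = q powi (int (d i) * a i j)"
  using a_off[OF assms] power_int_mult[of q "int (d i)" "a i j"] by simp

lemma chiU_word:
  assumes "u \<in> words n" "v \<in> words n"
  shows "chiw (chiU q a d) u v = q powi bil (wdeg (edeg n) u) (wdeg (edeg n) v)"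
  using assms(1)
proof (induction u)
  case (Cons x u)
  have "chiw (chiU q a d) [x] v = q powi bil (edeg n x) (wdeg (edeg n) v)"
    using assms(2)
  proof (induction v)
    case (Cons y v)
    have "chiw (chiU q a d) [x] [y] = q powi bil (edeg n x) (edeg n y)"
      using Cons.prems \<open>x # u \<in> words n\<close> by (simp add: chiw_def chiU_def bil_edeg)
    with Cons show ?case
      by (simp add: chiw_Cons_right[of _ _ y v] bil_add power_int_add q_nonzero)
  qed simp
  with Cons show ?case by (simp add: chiw_Cons_left[of _ x u] bil_add power_int_add q_nonzero)
qed simp

sublocale U: presentation n "relsU n q a d"
  by unfold_locales (rule relsU_fs)

sublocale B: presentation "3 * n" "relsB n q a d"
  by unfold_locales (rule relsB_fs)

sublocale U: coproduct n "relsU n q a d" "chiU q a d" DU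
  by unfold_locales (auto simp: relsU_def DU_def intro!: mhomog_chi mhomog_serre)

lemma chiw_chi1 [simp]: "chiw chi1 u v = 1"
  by (induction u) (auto simp: chiw_prod chi1_def map_replicate_const)

sublocale B: coproduct "3 * n" "relsB n q a d" chi1 "DB n"
  by unfold_locales (auto simp: DB_def)

text \<open>In the braided product \<open>1 \<otimes> E_x\<close> passes
  \<open>E_y \<otimes> 1\<close> with the scalar \<open>q^(d_x a_xy)\<close>. These are the
  hypotheses of \<open>srr_primitive\<close>, so the Serre element \<open>r\<close> is primitive
  modulo \<open>I2\<close>, and \<open>r \<otimes> 1 + 1 \<otimes> r\<close> lies in
  \<open>I2\<close>.\<close>

lemma DU_hopf: "r \<in> relsU n q a d \<Longrightarrow> ncDelta (chiU q a d) DU r \<in> U.I2"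
proof -
  assume "r \<in> relsU n q a d"
  then obtain i j where ij: "i < n" "j < n" "i \<noteq> j" and r: "r = serre q a d i j" by (auto simp: relsU_def)
  let ?t = "q ^ d i" and ?m = "nat (1 - a i j)"
  let ?S = "srr (mul2 (chiU q a d)) ?t 1 ?m"
  have 1: "ncDelta (chiU q a d) DU r = ?S (DU i) (DU j)"
    using ij by (simp add: r serre_srr U.Delta_srr U.Delta_gen)
  have 2: "U.T2.eqv (?S (tens (ncgen i) ncone + tens ncone (ncgen i)) (tens (ncgen j) ncone + tens ncone (ncgen j)))
    (?S (tens (ncgen i) ncone) (tens (ncgen j) ncone) + ?S (tens ncone (ncgen i)) (tens ncone (ncgen j)))"
  proof (rule U.T2.srr_primitive)
    have t: "?t powi (1 - int ?m) = q powi (int (d i) * a i j)" by (rule q_serre_power[OF ij])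
    have c: "chiw (chiU q a d) [x] [y] = q powi (int (d x) * a x y)" for x y
      by (simp add: chiw_def chiU_def)
    show "U.T2.eqv (mul2 (chiU q a d) (tens ncone (ncgen i)) (tens (ncgen i) ncone))
       (smul (?t\<^sup>2) (mul2 (chiU q a d) (tens (ncgen i) ncone) (tens ncone (ncgen i))))"
      using ij by (simp add: ncone_kron ncgen_kron tens_kron mul2_kron c q_square)
    show "U.T2.eqv (mul2 (chiU q a d) (tens ncone (ncgen i)) (tens (ncgen j) ncone))
       (smul (?t powi (1 - int ?m)) (mul2 (chiU q a d) (tens (ncgen j) ncone) (tens ncone (ncgen i))))"
      unfolding t using ij by (simp add: ncone_kron ncgen_kron tens_kron mul2_kron c del: of_nat_nat)
    \<comment> \<open>Here the braiding of \<open>E_j\<close> with \<open>E_i\<close> occurs; the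
      symmetry \<open>d_j a_ji = d_i a_ij\<close> makes it the same scalar.\<close>
    show "U.T2.eqv (mul2 (chiU q a d) (tens ncone (ncgen j)) (tens (ncgen i) ncone))
       (smul (?t powi (1 - int ?m)) (mul2 (chiU q a d) (tens (ncgen i) ncone) (tens ncone (ncgen j))))"
      unfolding t using ij by (simp add: ncone_kron ncgen_kron tens_kron mul2_kron c d_sym[of j i] del: of_nat_nat)
  qed (use ij in \<open>auto simp: q_nonzero qint_q_nonzero\<close>)
  have "?S (tens (ncgen i) ncone) (tens (ncgen j) ncone) = tens r ncone"
    "?S (tens ncone (ncgen i)) (tens ncone (ncgen j)) = tens ncone r"
    unfolding r serre_srr using ij by (simp_all only: srr_tens_one[OF ncgen_in_fs ncgen_in_fs] srr_one_tens[OF ncgen_in_fs ncgen_in_fs])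
  then have "U.T2.eqv (ncDelta (chiU q a d) DU r) (tens r ncone + tens ncone r)"
    using 2 unfolding 1 DU_def by (simp only:)
  moreover have "tens r ncone + tens ncone r \<in> U.I2"
    by (intro ncideal2.add ncideal2.left ncideal2.right U.R_I \<open>r \<in> relsU n q a d\<close> ncone_in_fs)
  ultimately show ?thesis by (rule U.T2.eqv_mem[THEN iffD2])
qed

lemma eps_serre: "e j = 0 \<Longrightarrow> ncEps e (serre q a d i j) = 0"
proof -
  assume ej: "e j = 0"
  have "prod_list (map e w) = 0" if "w \<in> supp (serre q a d i j)" for w
  proof -
    have "j \<in># mset w" unfolding serre_mset[OF that] by simp
    then have "0 \<in> set (map e w)" using ej by force
    then show ?thesis by (simp only: prod_list_zero_iff)
  qed
  then show ?thesis by (simp add: ncEps_def)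
qed

sublocale U: hopf_presentation n "relsU n q a d" "chiU q a d" DU epsU
  by unfold_locales (simp add: DU_hopf, auto simp: relsU_def eps_serre epsU_def)

end

section \<open>The Borel part\<close>

context presentation
begin

lemma word_cong:
  assumes "T.eqv (kron u) (smul c (kron v))" "x \<in> W" "y \<in> W"
  shows "T.eqv (kron (x @ u @ y)) (smul c (kron (x @ v @ y)))"
  using T.eqv_mul_right[OF T.eqv_mul_left[OF assms(1), of "kron x"], of "kron y"] assms(2,3)
  by (simp add: ncmul_kron ncmul_smul_left ncmul_smul_right)

lemma word_cong1:
  "T.eqv (kron u) (kron v) \<Longrightarrow> x \<in> W \<Longrightarrow> y \<in> W \<Longrightarrow> T.eqv (kron (x @ u @ y)) (kron (x @ v @ y))"
  using word_cong[of u 1 v x y] by simp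

end

lemma homog_diff: "homog g \<gamma> f \<Longrightarrow> homog g \<gamma> h \<Longrightarrow> homog g \<gamma> (f - smul c h)"
  by (force simp: homog_def supp_def fun_apply)

context quantum_data
begin

definition kinv :: "nat \<Rightarrow> nat" where
  "kinv x = (if x < 2 * n then x + n else x - n)"

lemma kinv: "n \<le> x \<Longrightarrow> x < 3 * n \<Longrightarrow> n \<le> kinv x \<and> kinv x < 3 * n \<and> kinv (kinv x) = x"
  by (auto simp: kinv_def)

lemma kdeg_kinv: "n \<le> x \<Longrightarrow> x < 3 * n \<Longrightarrow> kdeg n (kinv x) = - kdeg n x"
  by (auto simp: kinv_def kdeg_def fun_apply fun_eq_iff)

lemma relsB_cases [consumes 1, case_names serre inv_right inv_left comm qcomm]:
  assumes "r \<in> relsB n q a d"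
  obtains i j where "i < n" "j < n" "i \<noteq> j" "r = serre q a d i j"
  | i where "i < n" "r = kron [n + i, 2 * n + i] - kron []"
  | i where "i < n" "r = kron [2 * n + i, n + i] - kron []"
  | i j where "i < n" "j < n" "r = kron [n + i, n + j] - kron [n + j, n + i]"
  | i j where "i < n" "j < n" "r = kron [n + i, j] - smul (q powi (int (d i) * a i j)) (kron [j, n + i])"
  using assms unfolding relsB_def relsU_def ncgen_kron ncone_kron ncmul_kron by auto

lemma kinv_K: "i < n \<Longrightarrow> kinv (n + i) = 2 * n + i" "kinv (2 * n + i) = n + i"
  by (auto simp: kinv_def)

lemma rel_inv_K: "i < n \<Longrightarrow> kron [n + i, 2 * n + i] - kron [] \<in> relsB n q a d"
  "i < n \<Longrightarrow> kron [2 * n + i, n + i] - kron [] \<in> relsB n q a d"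
  unfolding relsB_def ncgen_kron ncone_kron ncmul_kron append.simps by blast+

lemma K_cases:
  assumes "n \<le> x" "x < 3 * n"
  obtains i where "i < n" "x = n + i" | i where "i < n" "x = 2 * n + i"
proof (cases "x < 2 * n")
  case True
  then show ?thesis using that(1)[of "x - n"] assms by auto
next
  case False
  then show ?thesis using that(2)[of "x - 2 * n"] assms by auto
qed

lemma rel_inv:
  assumes "n \<le> x" "x < 3 * n"
  shows "B.T.eqv (kron [x, kinv x]) (kron [])"
  using assms
proof (cases rule: K_cases)
  case (1 i)
  then show ?thesis using B.R_I[OF rel_inv_K(1)[of i]] by (simp only: kinv_K B.T.eqv_def)
next
  case (2 i)
  then show ?thesis using B.R_I[OF rel_inv_K(2)[of i]] by (simp only: kinv_K B.T.eqv_def)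
qed

lemma rel_comm: "i < n \<Longrightarrow> j < n \<Longrightarrow> B.T.eqv (kron [n + i, n + j]) (kron [n + j, n + i])"
  unfolding B.T.eqv_def by (rule B.R_I) (auto simp: relsB_def ncgen_kron ncmul_kron)

lemma rel_qcomm: "i < n \<Longrightarrow> j < n \<Longrightarrow>
    B.T.eqv (kron [n + i, j]) (smul (q powi (int (d i) * a i j)) (kron [j, n + i]))"
  unfolding B.T.eqv_def by (rule B.R_I) (auto simp: relsB_def ncgen_kron ncmul_kron)

text \<open>Multiply the relation by the inverse letter \<open>x'\<close> on both sides:
  \<open>x' x y x'\<close> and \<open>x' y x x'\<close> differ by the factor \<open>c\<close>, and
  each collapses to a word of two letters.\<close>

lemma qcomm_inv:
  assumes c: "B.T.eqv (kron [x, y]) (smul c (kron [y, x]))" "c \<noteq> 0" and x: "n \<le> x" "x < 3 * n" and y: "y < 3 * n"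
  shows "B.T.eqv (kron [kinv x, y]) (smul (inverse c) (kron [y, kinv x]))"
proof -
  have x': "n \<le> kinv x" "kinv x < 3 * n" "kinv (kinv x) = x" using kinv[OF x] by auto
  have 1: "B.T.eqv (kron [kinv x, y, x, kinv x]) (kron [kinv x, y])"
    using B.word_cong1[OF rel_inv[OF x], of "[kinv x, y]" "[]"] x' y by simp
  have 2: "B.T.eqv (kron [kinv x, x, y, kinv x]) (smul c (kron [kinv x, y, x, kinv x]))"
    using B.word_cong[OF c(1), of "[kinv x]" "[kinv x]"] x' by simp
  have 3: "B.T.eqv (kron [kinv x, x, y, kinv x]) (kron [y, kinv x])"
    using B.word_cong1[OF rel_inv[OF x'(1,2)], of "[]" "[y, kinv x]"] x' y by simp
  have "B.T.eqv (smul c (kron [kinv x, y])) (kron [y, kinv x])"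
    by (rule B.T.eqv_trans[OF B.T.eqv_trans[OF B.T.eqv_smul[OF B.T.eqv_sym[OF 1]] B.T.eqv_sym[OF 2]] 3])
  from B.T.eqv_smul[OF this, of "inverse c"] show ?thesis using c(2) by simp
qed

text \<open>One formula for all pairs: if \<open>y\<close> is a \<open>K\<close> letter its
  \<open>edeg\<close> vanishes and the letters commute. The inverse letters are reached through
  \<open>qcomm_inv\<close>.\<close>

lemma qcomm_letter:
  assumes x: "n \<le> x" "x < 3 * n" and y: "y < 3 * n"
  shows "B.T.eqv (kron [x, y]) (smul (q powi bil (kdeg n x) (edeg n y)) (kron [y, x]))"
proof -
  have K: "B.T.eqv (kron [x, y]) (smul (q powi bil (kdeg n x) (edeg n y)) (kron [y, x]))"
    if x: "n \<le> x" "x < 2 * n" for x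
  proof -
    obtain i where i: "x = n + i" "i < n" using x le_Suc_ex[of n x] by auto
    consider "y < n" | "n \<le> y" "y < 2 * n" | "2 * n \<le> y" by linarith
    then show ?thesis
    proof cases
      case 1
      then show ?thesis using rel_qcomm[of i y] i by (simp add: kdeg_K bil_edeg)
    next
      case 2
      then obtain j where "y = n + j" "j < n" using le_Suc_ex[of n y] by auto
      then show ?thesis using rel_comm[of i j] i by simp
    next
      case 3
      then obtain j where j: "y = 2 * n + j" "j < n" using y le_Suc_ex[of "2 * n" y] by auto
      have "B.T.eqv (kron [kinv (n + j), n + i]) (smul (inverse 1) (kron [n + i, kinv (n + j)]))"
        by (rule qcomm_inv) (use rel_comm[of j i] i j in auto)
      moreover have "kinv (n + j) = y" using j by (simp add: kinv_def)
      ultimately show ?thesis using i 3 n_pos B.T.eqv_sym by (simp add: add.commute)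
    qed
  qed
  show ?thesis
  proof (cases "x < 2 * n")
    case False
    define z where "z = x - n"
    have z: "n \<le> z" "z < 2 * n" "kinv z = x" using x False by (auto simp: z_def kinv_def)
    have "B.T.eqv (kron [kinv z, y]) (smul (inverse (q powi bil (kdeg n z) (edeg n y))) (kron [y, kinv z]))"
      by (rule qcomm_inv[OF K]) (use z y q_nonzero in auto)
    moreover have "kdeg n x = - kdeg n z" using kdeg_kinv[of z] z by simp
    ultimately show ?thesis using z(3) by (simp add: bil_uminus power_int_minus)
  qed (use K x in auto)
qed

lemma qcomm_letter_word:
  assumes x: "n \<le> x" "x < 3 * n" and v: "v \<in> words (3 * n)"
  shows "B.T.eqv (kron (x # v)) (smul (q powi bil (kdeg n x) (wdeg (edeg n) v)) (kron (v @ [x])))"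
  using v
proof (induction v)
  case (Cons y v)
  let ?c = "q powi bil (kdeg n x) (edeg n y)" and ?c' = "q powi bil (kdeg n x) (wdeg (edeg n) v)"
  have 1: "B.T.eqv (kron (x # y # v)) (smul ?c (kron (y # x # v)))"
    using B.word_cong[OF qcomm_letter[OF x, of y], of "[]" v] Cons.prems by simp
  have 2: "B.T.eqv (kron (y # x # v)) (smul ?c' (kron (y # v @ [x])))"
    using B.word_cong[OF Cons.IH, of "[y]" "[]"] Cons.prems by simp
  show ?case using B.T.eqv_trans[OF 1 B.T.eqv_smul[OF 2, of ?c]]
    by (simp add: bil_add power_int_add q_nonzero)
qed simp

lemma qcomm_words:
  assumes u: "u \<in> words (3 * n)" "Efree n u" and v: "v \<in> words (3 * n)"
  shows "B.T.eqv (kron (u @ v)) (smul (q powi bil (wdeg (kdeg n) u) (wdeg (edeg n) v)) (kron (v @ u)))"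
  using u
proof (induction u)
  case (Cons x u)
  let ?c = "q powi bil (kdeg n x) (wdeg (edeg n) v)" and ?c' = "q powi bil (wdeg (kdeg n) u) (wdeg (edeg n) v)"
  have 1: "B.T.eqv (kron (x # u @ v)) (smul ?c' (kron (x # v @ u)))"
    using B.word_cong[OF Cons.IH, of "[x]" "[]"] Cons.prems by simp
  have 2: "B.T.eqv (kron (x # v @ u)) (smul ?c (kron (v @ x # u)))"
    using B.word_cong[OF qcomm_letter_word[of x v], of "[]" u] Cons.prems v by simp
  show ?case using B.T.eqv_trans[OF 1 B.T.eqv_smul[OF 2, of ?c']]
    by (simp add: bil_add power_int_add q_nonzero mult.commute)
qed simp

text \<open>Induction on the length: total degree 0 forces the inverse of the leading letter to
  occur later, and since \<open>K\<close> letters commute the two can be brought together and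
  cancelled.\<close>

lemma Efree_one:
  "u \<in> words (3 * n) \<Longrightarrow> Efree n u \<Longrightarrow> wdeg (kdeg n) u = 0 \<Longrightarrow> B.T.eqv (kron u) (kron [])"
proof (induction "length u" arbitrary: u rule: less_induct)
  case less
  show ?case
  proof (cases u)
    case (Cons x w)
    have x: "n \<le> x" "x < 3 * n" using less.prems Cons by auto
    have "kinv x \<in> set w"
    proof (rule ccontr)
      assume no: "kinv x \<notin> set w"
      obtain i where i: "i < n" "x = n + i \<or> x = 2 * n + i"
        using x by (metis K_cases)
      define s where "s = kdeg n x i"
      \<comment> \<open>Relative to the sign \<open>s\<close> of \<open>x\<close> in coordinate
        \<open>i\<close>, only \<open>kinv x\<close> contributes negatively. Without it the rest of
        the word cannot balance \<open>x\<close>.\<close>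
      have "0 \<le> s * wdeg (kdeg n) w i"
      proof -
        have "0 \<le> s * kdeg n y i" if "y \<noteq> kinv x" for y
          using that i by (auto simp: s_def kdeg_def kinv_def)
        then have "\<forall>y\<in>set w. 0 \<le> s * kdeg n y i" using no by metis
        then show ?thesis by (induction w) (auto simp: fun_apply distrib_left)
      qed
      moreover have "kdeg n x i + wdeg (kdeg n) w i = 0"
        using less.prems(3) Cons by (simp add: fun_eq_iff fun_apply)
      then have "wdeg (kdeg n) w i = - s" by (simp add: s_def)
      moreover have "s * s = 1" using i by (auto simp: s_def kdeg_def)
      ultimately show False by simp
    qed
    then obtain w1 w2 where w: "w = w1 @ kinv x # w2" by (meson split_list)
    have in_words: "w1 \<in> words (3 * n)" "w2 \<in> words (3 * n)" "Efree n w1" "Efree n w2"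
      using less.prems Cons w by auto
    have kd: "wdeg (kdeg n) (w1 @ w2) = 0"
      using less.prems(3) kdeg_kinv[OF x] by (simp add: Cons w algebra_simps)
    have e0: "wdeg (edeg n) w1 = 0" using in_words by (simp add: Efree_wdeg[symmetric])
    have 1: "B.T.eqv (kron u) (kron (w1 @ [x, kinv x] @ w2))"
      using B.word_cong1[of "x # w1" "w1 @ [x]" "[]" "kinv x # w2"] qcomm_letter_word[OF x in_words(1)]
        in_words kinv[OF x] by (simp add: e0 Cons w)
    have 2: "B.T.eqv (kron (w1 @ [x, kinv x] @ w2)) (kron (w1 @ w2))"
      using B.word_cong1[OF rel_inv[OF x], of w1 w2] in_words by simp
    have 3: "B.T.eqv (kron (w1 @ w2)) (kron [])"
      by (rule less.hyps) (use in_words kd in \<open>auto simp: Cons w\<close>)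
    show ?thesis by (rule B.T.eqv_trans[OF B.T.eqv_trans[OF 1 2] 3])
  qed simp
qed

lemma Efree_eqv:
  assumes u: "u \<in> words (3 * n)" "Efree n u" and v: "v \<in> words (3 * n)" "Efree n v"
    and k: "wdeg (kdeg n) u = wdeg (kdeg n) v"
  shows "B.T.eqv (kron u) (kron v)"
proof -
  \<comment> \<open>An inverse of \<open>v\<close> up to the order of its letters, which is
    irrelevant because \<open>Efree_one\<close> looks only at the degree.\<close>
  let ?v = "map kinv v"
  have v': "?v \<in> words (3 * n) \<and> Efree n ?v \<and> wdeg (kdeg n) ?v = - wdeg (kdeg n) v"
    using v by (induction v) (auto simp: kinv kdeg_kinv)
  have 1: "B.T.eqv (kron (u @ ?v @ v)) (kron u)"
    using B.word_cong1[OF Efree_one[of "?v @ v"], of u "[]"] u v v' by simp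
  have 2: "B.T.eqv (kron (u @ ?v @ v)) (kron v)"
    using B.word_cong1[OF Efree_one[of "u @ ?v"], of "[]" v] u v v' k by simp
  show ?thesis by (rule B.T.eqv_trans[OF B.T.eqv_sym[OF 1] 2])
qed

lemma split_edeg:
  assumes "wdeg (edeg n) w = edeg n j" "j < n"
  obtains w1 w2 where "w = w1 @ j # w2" "Efree n w1" "Efree n w2"
proof -
  have ejj: "edeg n j j = 1" using assms(2) by (simp add: edeg_def)
  have "\<not> Efree n w"
  proof
    assume "Efree n w"
    then have "wdeg (edeg n) w j = 0" by (simp add: Efree_wdeg fun_apply)
    then show False using assms(1) ejj by simp
  qed
  then have "\<exists>x\<in>set w. x < n" by (auto simp: Efree_def not_le)
  then obtain w1 x w2 where w: "w = w1 @ x # w2" "x < n" "\<forall>z\<in>set w2. \<not> z < n"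
    using split_list_last_prop[of w "\<lambda>x. x < n"] by blast
  then have w2: "Efree n w2" by (auto simp: Efree_def not_less)
  have s: "wdeg (edeg n) w1 k + edeg n x k = edeg n j k" for k
    using fun_cong[OF assms(1), of k] w2 by (simp add: w(1) Efree_wdeg fun_apply)
  have xj: "x = j" using s[of x] wdeg_edeg_nonneg[of n w1 x] w(2) by (auto simp: edeg_def split: if_splits)
  have "wdeg (edeg n) w1 = 0"
    by (rule ext) (use s in \<open>simp add: xj fun_apply\<close>)
  then show ?thesis using that[of w1 w2] w(1) w2 xj by (simp add: Efree_wdeg)
qed

text \<open>The word contains \<open>E_j\<close> once and otherwise only \<open>K\<close> letters.
  Moving those before it to the right costs a power of \<open>q\<close>; the collected
  \<open>K\<close> word has degree 0 and equals 1.\<close>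

lemma weight_one_eqv:
  assumes w: "w \<in> words (3 * n)" "wdeg (edeg n) w = edeg n j" "wdeg (kdeg n) w = 0" and j: "j < n"
  shows "\<exists>c. B.T.eqv (kron w) (smul c (kron [j]))"
proof -
  obtain w1 w2 where w': "w = w1 @ j # w2" "Efree n w1" "Efree n w2" using split_edeg[OF w(2) j] by metis
  have ww: "w1 \<in> words (3 * n)" "w2 \<in> words (3 * n)" using w(1) w' by auto
  define c where "c = q powi bil (wdeg (kdeg n) w1) (wdeg (edeg n) [j])"
  have 1: "B.T.eqv (kron w) (smul c (kron (j # w1 @ w2)))"
    using B.word_cong[OF qcomm_words[of w1 "[j]"], of "[]" w2] ww w' j by (simp add: c_def)
  have 2: "B.T.eqv (kron (j # w1 @ w2)) (kron [j])"
    using B.word_cong1[OF Efree_one[of "w1 @ w2"], of "[j]" "[]"] ww w' j w(3) by simp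
  show ?thesis using B.T.eqv_trans[OF 1 B.T.eqv_smul[OF 2, of c]] by blast
qed

section \<open>The coproduct of the Borel part\<close>

lemma DB_E: "x < n \<Longrightarrow> DB n x = kron ([x], []) + kron ([n + x], [x])"
  and DB_K: "n \<le> x \<Longrightarrow> DB n x = kron ([x], [x])"
  by (simp_all add: DB_def ncgen_kron ncone_kron tens_kron)

lemma Delta_Efree: "Efree n w \<Longrightarrow> ncDelta chi1 (DB n) (kron w) = (kron (w, w) :: 'k ncp2)"
proof (induction w)
  case (Cons x w)
  then show ?case
    by (simp add: B.Delta_kron B.delta_word_Cons DB_K mul2_kron)
qed (simp add: B.Delta_kron delta_word_def ncone_kron tens_kron)

lemma left_pair_pow: "(mul2 chi1 (kron ([k], [i])) ^^ m) (kron (u, v)) = kron (replicate m k @ u, replicate m i @ v)"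
  by (induction m) (auto simp: mul2_kron)

lemma right_pair_pow: "((\<lambda>y. mul2 chi1 y (kron ([k], [i]))) ^^ m) (kron (u, v)) = kron (u @ replicate m k, v @ replicate m i)"
  by (induction m) (auto simp: mul2_kron replicate_append_same)

lemma replicate_words: "x < N \<Longrightarrow> replicate k x \<in> words N"
  by (induction k) auto

text \<open>The product is the ordinary one here; the factor \<open>K_i\<close> in
  \<open>K_i \<otimes> E_i\<close> supplies the q-commutation. \<open>srr_primitive\<close> leaves
  \<open>r \<otimes> 1\<close> and the Serre sum of the elements \<open>K \<otimes> E\<close>. In
  the latter all left legs are the same \<open>K\<close> monomial modulo the ideal, so it is this
  monomial tensor \<open>r\<close>.\<close>

lemma DB_serre:
  assumes ij: "i < n" "j < n" "i \<noteq> j"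
  shows "ncDelta chi1 (DB n) (serre q a d i j) \<in> B.I2"
proof -
  let ?t = "q ^ d i" and ?m = "nat (1 - a i j)"
  let ?S = "srr (mul2 chi1) ?t 1 ?m"
  define r where "r = serre q a d i j"
  have rI: "r \<in> B.I" by (rule B.R_I) (use ij in \<open>auto simp: r_def relsB_def relsU_def\<close>)
  let ?a = "kron ([i], []) :: 'k ncp2" and ?b = "kron ([n + i], [i]) :: 'k ncp2"
  let ?c = "kron ([j], []) :: 'k ncp2" and ?d = "kron ([n + j], [j]) :: 'k ncp2"
  have 1: "ncDelta chi1 (DB n) r = ?S (?a + ?b) (?c + ?d)"
    unfolding r_def serre_srr using ij
    by (subst B.Delta_srr) (auto simp: B.Delta_gen DB_E)
  have t: "?t powi (1 - int ?m) = q powi (int (d i) * a i j)" by (rule q_serre_power[OF ij])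
  have K: "B.T2.eqv (kron ([n + x, y], [z])) (smul (q powi (int (d x) * a x y)) (kron ([y, n + x], [z])))"
    if "x < n" "y < n" "z < n" for x y z
    using B.tens_cong[OF rel_qcomm[OF that(1,2), unfolded B.T.eqv_def], of "kron [z]" "kron [z]"] that
    by (simp add: tens_kron tens_smul_left B.T2.eqv_def ncideal.zero)
  have 2: "B.T2.eqv (?S (?a + ?b) (?c + ?d)) (?S ?a ?c + ?S ?b ?d)"
  proof (rule B.T2.srr_primitive)
    show "B.T2.eqv (mul2 chi1 ?b ?a) (smul (?t\<^sup>2) (mul2 chi1 ?a ?b))"
      using K[of i i i] ij by (simp add: mul2_kron q_square)
    show "B.T2.eqv (mul2 chi1 ?b ?c) (smul (?t powi (1 - int ?m)) (mul2 chi1 ?c ?b))"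
      unfolding t using K[of i j i] ij by (simp add: mul2_kron)
    show "B.T2.eqv (mul2 chi1 ?d ?a) (smul (?t powi (1 - int ?m)) (mul2 chi1 ?a ?d))"
      unfolding t using K[of j i j] ij d_sym[of j i] by (simp add: mul2_kron)
  qed (use ij in \<open>auto simp: q_nonzero qint_q_nonzero\<close>)
  have 3: "?S ?a ?c = tens r ncone"
    using srr_tens_one[of "ncgen i" n "ncgen j" chi1 ?t 1 ?m] ij
    by (simp add: r_def serre_srr ncgen_kron ncone_kron tens_kron)
  let ?K = "\<lambda>v. replicate (?m - v) (n + i) @ (n + j) # replicate v (n + i)"
  let ?E = "\<lambda>v. replicate (?m - v) i @ j # replicate v i"
  have S: "?S ?b ?d = (\<Sum>v\<le>?m. smul (qcf ?t ?m v) (tens (kron (?K v)) (kron (?E v))))"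
    unfolding srr_def by (rule sum.cong) (auto simp: left_pair_pow right_pair_pow tens_kron)
  have 4: "B.T2.eqv (?S ?b ?d) (\<Sum>v\<le>?m. smul (qcf ?t ?m v) (tens (kron (?K 0)) (kron (?E v))))"
    unfolding S
  proof (intro B.T2.eqv_sum B.T2.eqv_smul)
    fix v assume v: "v \<in> {..?m}"
    have "B.T.eqv (kron (?K v)) (kron (?K 0))"
    proof (rule Efree_eqv)
      have "mset (?K v) = mset (?K 0)" using v by (auto simp: multiset_eq_iff)
      then show "wdeg (kdeg n) (?K v) = wdeg (kdeg n) (?K 0)" by (rule wdeg_mset)
    qed (use ij in \<open>auto simp: replicate_words Efree_def\<close>)
    then show "B.T2.eqv (tens (kron (?K v)) (kron (?E v))) (tens (kron (?K 0)) (kron (?E v)))"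
      unfolding B.T2.eqv_def B.T.eqv_def
      by (rule B.tens_cong) (use ij in \<open>auto simp: replicate_words ncideal.zero\<close>)
  qed
  have 5: "(\<Sum>v\<le>?m. smul (qcf ?t ?m v) (tens (kron (?K 0)) (kron (?E v)))) = tens (kron (?K 0)) r"
  proof -
    have ts: "tens f (\<Sum>v\<in>A. g v) = (\<Sum>v\<in>A. tens f (g v))" for f :: "'k ncp" and g :: "nat \<Rightarrow> 'k ncp" and A
      by (induction A rule: infinite_finite_induct) (auto simp: tens_add_right)
    show ?thesis unfolding r_def serre_words by (simp add: ts tens_smul_right)
  qed
  have "tens (kron (?K 0)) r \<in> B.I2"
    by (rule ncideal2.right) (use ij rI in \<open>auto simp: replicate_words\<close>)
  then have "?S ?b ?d \<in> B.I2" unfolding B.T2.eqv_mem[OF 4] 5 .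
  moreover have "tens r ncone \<in> B.I2" by (rule ncideal2.left) (use rI in auto)
  ultimately have "?S ?a ?c + ?S ?b ?d \<in> B.I2" unfolding 3 by (intro ncideal2.add)
  then show ?thesis unfolding r_def[symmetric] 1 B.T2.eqv_mem[OF 2] .
qed

lemma DB_Efree:
  assumes "B.T.eqv (kron u) (kron v)" "u \<in> words (3 * n)" "v \<in> words (3 * n)" "Efree n u" "Efree n v"
  shows "ncDelta chi1 (DB n) (kron u - kron v) \<in> B.I2"
  using B.tens_cong[of "kron u" "kron v" "kron u" "kron v"] assms
  by (simp add: B.Delta_diff Delta_Efree B.T.eqv_def tens_kron)

lemma DB_hopf: "r \<in> relsB n q a d \<Longrightarrow> ncDelta chi1 (DB n) r \<in> B.I2"
proof (induction rule: relsB_cases)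
  case (serre i j)
  then show ?case by (simp add: DB_serre)
next
  case (inv_right i)
  then show ?case using B.R_I[OF rel_inv_K(1)[of i]] unfolding inv_right(2)
    by (intro DB_Efree) (auto simp: B.T.eqv_def)
next
  case (inv_left i)
  then show ?case using B.R_I[OF rel_inv_K(2)[of i]] unfolding inv_left(2)
    by (intro DB_Efree) (auto simp: B.T.eqv_def)
next
  case (comm i j)
  then show ?case using rel_comm[of i j] unfolding comm(3)
    by (intro DB_Efree) auto
next
  case (qcomm i j)
  let ?c = "q powi (int (d i) * a i j)"
  have "ncDelta chi1 (DB n) r = (kron ([n + i, j], [n + i]) + kron ([n + i, n + j], [n + i, j]))
      - smul ?c (kron ([j, n + i], [n + i]) + kron ([n + j, n + i], [j, n + i]))"
    using qcomm by (simp add: B.Delta_diff B.Delta_smul B.Delta_kron delta_word_def DB_E DB_K ncone_kron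
        tens_kron mul2_kron mul2_add_left mul2_add_right)
  also have "\<dots> = (tens (kron [n + i, j]) (kron [n + i]) - tens (smul ?c (kron [j, n + i])) (kron [n + i]))
      + (tens (kron [n + i, n + j]) (kron [n + i, j]) - tens (kron [n + j, n + i]) (smul ?c (kron [j, n + i])))"
    by (simp add: tens_kron tens_smul_left tens_smul_right fv.scale_right_distrib)
  also have "\<dots> \<in> B.I2"
    using rel_qcomm[OF qcomm(1,2)] rel_comm[OF qcomm(1,2)] qcomm
    by (intro ncideal2.add B.tens_cong) (auto simp: B.T.eqv_def ncideal.zero)
  finally show ?case .
qed

lemma ev_supp_zero: "(\<And>w. w \<in> supp f \<Longrightarrow> p w = 0) \<Longrightarrow> ev p f = 0"
  by (simp add: ev_def)

lemma ev_kron_diff: "ev p (kron u - smul c (kron v)) = p u - c * p v"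
  using ev_diff[of "kron u" UNIV "smul c (kron v)" p] fv.subspace_scale[OF subspace_fsupp, of "kron v" UNIV c]
  by (simp add: ev_smul)

lemma ev_kron_diff1: "ev p (kron u - kron v) = p u - p v"
  using ev_kron_diff[of p u 1 v] by simp

sublocale B: hopf_presentation "3 * n" "relsB n q a d" chi1 "DB n" "epsB n"
proof unfold_locales
  show "r \<in> relsB n q a d \<Longrightarrow> ncDelta chi1 (DB n) r \<in> B.I2" for r by (rule DB_hopf)
  show "r \<in> relsB n q a d \<Longrightarrow> ncEps (epsB n) r = 0" for r
  proof (induction rule: relsB_cases)
    case (serre i j)
    then show ?case by (simp add: eps_serre epsB_def)
  qed (auto simp: ncEps_ev epsB_def ev_kron_diff ev_kron_diff1)
qed

end

section \<open>Classification of the automorphisms\<close>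

lemma fsupp_homog: "f \<in> fs N \<Longrightarrow> homog g \<gamma> f \<Longrightarrow> f \<in> fsupp {w \<in> words N. wdeg g w = \<gamma>}"
  by (auto simp: fs_fsupp fsupp_def homog_def)

lemma homog_eq_zero: "homog g \<gamma> f \<Longrightarrow> (\<And>w. w \<in> supp f \<Longrightarrow> wdeg g w \<noteq> \<gamma>) \<Longrightarrow> f = (0 :: 'k::field ncp)"
  by (auto simp: homog_def supp_def fun_eq_iff fun_apply)

lemma cmp_mul_left:
  assumes h: "h \<in> fs N" "homog g 0 h" and f: "f \<in> fs N"
  shows "cmp g \<gamma> (ncmul h f) = ncmul h (cmp g \<gamma> (f :: 'k::field ncp))"
  using fsupp_homog[OF h]
proof (induction rule: fsupp_induct)
  case (kron u)
  show ?case using f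
    by (induction rule: fs_induct) (use kron in \<open>auto simp: ncmul_add_right ncmul_smul_right ncmul_kron
      cmp_add cmp_smul cmp_kron\<close>)
qed (auto simp: ncmul_add_left ncmul_smul_left cmp_add cmp_smul)

lemma cmp_mul_right:
  assumes h: "h \<in> fs N" "homog g 0 h" and f: "f \<in> fs N"
  shows "cmp g \<gamma> (ncmul f h) = ncmul (cmp g \<gamma> (f :: 'k::field ncp)) h"
  using fsupp_homog[OF h]
proof (induction rule: fsupp_induct)
  case (kron u)
  show ?case using f
    by (induction rule: fs_induct) (use kron in \<open>auto simp: ncmul_add_left ncmul_smul_left ncmul_kron
      cmp_add cmp_smul cmp_kron\<close>)
qed (auto simp: ncmul_add_right ncmul_smul_right cmp_add cmp_smul)

context presentation
begin

lemma eqv_multiple: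
  assumes "f \<in> fsupp A" "\<And>w. w \<in> A \<Longrightarrow> \<exists>c. T.eqv (kron w) (smul c z)"
  shows "\<exists>c. T.eqv f (smul c z)"
  using assms(1)
proof (induction rule: fsupp_induct)
  case zero
  show ?case by (rule exI[of _ 0]) simp
next
  case (add f g)
  then obtain b c where "T.eqv f (smul b z)" "T.eqv g (smul c z)" by blast
  from T.eqv_add[OF this] show ?case by (auto simp: fv.scale_left_distrib[symmetric])
next
  case (smul c f)
  then obtain b where "T.eqv f (smul b z)" by blast
  from T.eqv_smul[OF this, of c] show ?case by auto
qed (use assms(2) in auto)

lemma ideal_smul_cancel: "smul c f \<in> I \<Longrightarrow> c \<noteq> 0 \<Longrightarrow> f \<in> I"
  using ncideal.smul[of "smul c f" N R "inverse c"] by simp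

definition cmp2 :: "(nat \<Rightarrow> 'g::monoid_add) \<Rightarrow> 'g \<Rightarrow> 'g \<Rightarrow> 'k ncp2 \<Rightarrow> 'k ncp2" where
  "cmp2 g \<gamma> \<delta> = pw (\<lambda>(u, v). if wdeg g u = \<gamma> \<and> wdeg g v = \<delta> then 1 else 0)"

lemma cmp2_tens: "cmp2 g \<gamma> \<delta> (tens f h) = tens (cmp g \<gamma> f) (cmp g \<delta> h)"
  by (auto simp: cmp2_def cmp_def pw_def tens_def fun_eq_iff)


lemma cmp2_ideal:
  assumes g: "graded g" and F: "F \<in> I2"
  shows "cmp2 g \<gamma> \<delta> F \<in> I2"
  using F
proof (induction rule: ncideal2.induct)
  case (left f h)
  then show ?case by (simp add: cmp2_tens cmp_ideal[OF g] ncideal2.left)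
next
  case (right f h)
  then show ?case by (simp add: cmp2_tens cmp_ideal[OF g] ncideal2.right)
qed (auto simp: cmp2_def pw_add pw_smul intro: ncideal2.zero ncideal2.add ncideal2.smul)

end

context quantum_data
begin

lemma U_graded: "U.graded (g :: nat \<Rightarrow> 'g::comm_monoid_add)"
  unfolding U.graded_def
proof
  fix r assume "r \<in> relsU n q a d"
  then have "mhomog r" by (auto simp: relsU_def mhomog_serre)
  then show "\<exists>\<gamma>. homog g \<gamma> r" by (rule mhomog_homog)
qed

lemma homog_kron_diff: "wdeg g u = wdeg g v \<Longrightarrow> homog g (wdeg g u) (kron u - smul c (kron v) :: 'k ncp)"
  by (rule homog_diff) (simp_all add: homog_def)

lemma homog_kron_diff1: "wdeg g u = wdeg g v \<Longrightarrow> homog g (wdeg g u) (kron u - kron v :: 'k ncp)"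
  using homog_kron_diff[of g u v 1] by simp

text \<open>Serre elements and commutation relators are balanced in any commutative grading. The
  relators \<open>K_i K_i^-1 - 1\<close> and their mirror images ask for opposite degrees on
  \<open>K_i\<close> and its inverse.\<close>

lemma B_graded:
  assumes g: "\<And>i. i < n \<Longrightarrow> g (n + i) + g (2 * n + i) = (0 :: 'g::ab_group_add)"
  shows "B.graded g"
  unfolding B.graded_def
proof
  fix r assume "r \<in> relsB n q a d"
  then show "\<exists>\<gamma>. homog g \<gamma> r"
  proof (induction rule: relsB_cases)
    case (serre i j)
    then show ?case by (simp add: mhomog_homog mhomog_serre)
  next
    case (inv_right i)
    then show ?case using homog_kron_diff1[of g "[n + i, 2 * n + i]" "[]"] g by auto
  next
    case (inv_left i)
    then show ?case using homog_kron_diff1[of g "[2 * n + i, n + i]" "[]"] g by (auto simp: add.commute)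
  next
    case (comm i j)
    then show ?case using homog_kron_diff1[of g "[n + i, n + j]" "[n + j, n + i]"] by (auto simp: add.commute)
  next
    case (qcomm i j)
    then show ?case using homog_kron_diff[of g "[n + i, j]" "[j, n + i]"] by (auto simp: add.commute)
  qed
qed

text \<open>The degree seen by the left torus coaction: killing \<open>E\<close> letters in the left
  leg turns the coproduct of \<open>E_i\<close> into \<open>K_i \<otimes> E_i\<close>, so
  \<open>E_i\<close> counts like \<open>K_i\<close>.\<close>

definition ldeg :: "nat \<Rightarrow> nat \<Rightarrow> int" where
  "ldeg x = edeg n x + kdeg n x"

lemma wdeg_ldeg: "wdeg ldeg w = wdeg (edeg n) w + wdeg (kdeg n) w"
  by (induction w) (auto simp: ldeg_def algebra_simps)

lemma B_graded_edeg: "B.graded (edeg n)" and B_graded_kdeg: "B.graded (kdeg n)" and B_graded_ldeg: "B.graded ldeg"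
  by (rule B_graded; simp add: ldeg_def kdeg_K kdeg_K')+

text \<open>The coefficient of \<open>K^\<mu>\<close> under the Hopf projection to the group algebra
  of the torus that kills every \<open>E_i\<close>.\<close>

definition pK :: "(nat \<Rightarrow> int) \<Rightarrow> nat list \<Rightarrow> 'k" where
  "pK \<mu> w = (if Efree n w \<and> wdeg (kdeg n) w = \<mu> then 1 else 0)"

lemma serre_not_Efree: "j < n \<Longrightarrow> w \<in> supp (serre q a d i j) \<Longrightarrow> \<not> Efree n w"
proof
  assume j: "j < n" and w: "w \<in> supp (serre q a d i j)" and e: "Efree n w"
  have "j \<in># mset w" unfolding serre_mset[OF w] by simp
  then show False using j e by (auto simp: Efree_def)
qed

lemma ev_ideal:
  assumes "\<And>r u v. r \<in> relsB n q a d \<Longrightarrow> u \<in> words (3 * n) \<Longrightarrow> v \<in> words (3 * n) \<Longrightarrow> ev (\<lambda>w. p (u @ w @ v)) r = 0"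
    and "f \<in> B.I"
  shows "ev p f = 0"
  using assms(2)
proof (induction rule: B.ideal_induct)
  case (word u r v)
  then show ?case using subsetD[OF relsB_fs, of r n q a d]
    by (simp add: ev_word_mul[of r "3 * n"] assms(1))
qed (auto simp: ev_add[of _ "words (3 * n)"] ev_smul B.I_fs simp flip: fs_fsupp)

lemma kdeg_cancel: "i < n \<Longrightarrow> kdeg n (i + n) + kdeg n (i + 2 * n) = 0"
  using kdeg_K[of i n] kdeg_K'[of i n] by (simp add: add.commute)

lemma pK_ideal: "f \<in> B.I \<Longrightarrow> ev (pK \<mu>) f = 0"
proof (rule ev_ideal)
  fix r u v assume "r \<in> relsB n q a d"
  then show "ev (\<lambda>w. pK \<mu> (u @ w @ v)) r = 0"
  proof (induction rule: relsB_cases)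
    case (serre i j)
    then show ?case by (auto intro!: ev_supp_zero simp: pK_def serre_not_Efree)
  qed (auto simp: ev_kron_diff ev_kron_diff1 pK_def kdeg_cancel add_ac)
qed

text \<open>\<open>pE j\<close> and \<open>cK j\<close> are matrix entries of the two-dimensional representation
  in which \<open>E_j\<close> acts as a matrix unit and the other \<open>E_i\<close> act as zero.\<close>

definition cK :: "nat \<Rightarrow> nat list \<Rightarrow> 'k" where
  "cK j w = (if Efree n w then q powi bil (wdeg (kdeg n) w) (edeg n j) else 0)"

fun pE :: "nat \<Rightarrow> nat list \<Rightarrow> 'k" where
  "pE j [] = 0"
| "pE j (x # w) = (if x < n then if x = j \<and> Efree n w then 1 else 0 else q powi bil (kdeg n x) (edeg n j) * pE j w)"

text \<open>Multiplication of upper triangular matrices: \<open>cK j\<close> and the indicator of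
  \<open>Efree\<close> are the diagonal entries, \<open>pE j\<close> is the corner.\<close>

lemma pE_append: "pE j (u @ v) = cK j u * pE j v + pE j u * (if Efree n v then 1 else 0)"
  by (induction u) (auto simp: cK_def bil_add power_int_add q_nonzero distrib_left)

lemma pE_two: "\<not> Efree n u \<Longrightarrow> \<not> Efree n v \<Longrightarrow> pE j (u @ v) = 0"
  by (simp add: pE_append cK_def)

lemma not_Efree: "x \<in> set w \<Longrightarrow> x < n \<Longrightarrow> \<not> Efree n w"
  unfolding Efree_def by force

text \<open>Since \<open>i \<noteq> j\<close> and \<open>1 - a i j \<ge> 1\<close>, every word of a
  Serre element contains two \<open>E\<close> letters, and a product with two strictly triangular
  factors vanishes.\<close>

lemma serre_pE:
  assumes ij: "i < n" "j < n" "i \<noteq> j" and w: "w \<in> supp (serre q a d i j)"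
  shows "pE k (u @ w @ v) = 0"
proof -
  have m: "nat (1 - a i j) \<ge> 1" using a_off[OF ij] by simp
  then have mem: "i \<in># mset w" "j \<in># mset w" unfolding serre_mset[OF w] by auto
  then obtain w1 w2 where w12: "w = w1 @ j # w2" by (metis split_list set_mset_mset)
  have "i \<in> set w1 \<or> i \<in> set w2" using mem w12 ij by auto
  then show ?thesis
  proof
    assume "i \<in> set w1"
    then have "\<not> Efree n (u @ w1)" "\<not> Efree n (j # w2 @ v)" using ij by (auto dest: not_Efree)
    from pE_two[OF this, of k] show ?thesis by (simp add: w12)
  next
    assume "i \<in> set w2"
    then have "\<not> Efree n (u @ w1 @ [j])" "\<not> Efree n (w2 @ v)" using ij by (auto dest: not_Efree)
    from pE_two[OF this, of k] show ?thesis by (simp add: w12)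
  qed
qed

lemma pE_ideal: "j < n \<Longrightarrow> f \<in> B.I \<Longrightarrow> ev (pE j) f = 0"
proof (rule ev_ideal)
  fix r u v assume j: "j < n" and "r \<in> relsB n q a d"
  from this(2) show "ev (\<lambda>w. pE j (u @ w @ v)) r = 0"
  proof (induction rule: relsB_cases)
    case (serre i k)
    then show ?case by (auto intro!: ev_supp_zero simp: serre_pE)
  next
    case (qcomm i k)
    then show ?case using j by (auto simp: ev_kron_diff pE_append cK_def kdeg_K bil_edeg)
  qed (use j in \<open>auto simp: ev_kron_diff1 pE_append cK_def kdeg_K kdeg_K' bil_add bil_uminus power_int_add
      power_int_minus q_nonzero\<close>)
qed

lemma B_gen_notin: "j < n \<Longrightarrow> kron [j] \<notin> B.I"
  using pE_ideal[of j "kron [j]"] by auto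

text \<open>Gives the algebra map from the positive part to the Borel algebra, along which
  nonvanishing of the generators and uniqueness of the parameters are pulled back.\<close>

lemma U_ideal_subset: "f \<in> U.I \<Longrightarrow> f \<in> B.I"
proof (induction rule: ncideal.induct)
  case (gen u r v)
  have "fs n \<subseteq> (fs (3 * n) :: 'k ncp set)" by (rule fs_mono) simp
  then show ?case using gen by (intro ncideal.gen) (auto simp: relsB_def)
qed (auto intro: ncideal.intros)

lemma U_gen_notin: "j < n \<Longrightarrow> kron [j] \<notin> U.I"
  using B_gen_notin U_ideal_subset by blast

lemma gen_eqv_unique:
  assumes "f - f' \<in> B.I" "f = smul \<alpha> (kron [j])" "f' = smul \<beta> (kron [k])" "\<alpha> \<noteq> 0" "j < n" "k < n"
  shows "j = k \<and> \<alpha> = \<beta>"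
proof -
  have "B.T.eqv (smul \<alpha> (kron [j])) (smul \<beta> (kron [k]))" using assms by (simp add: B.T.eqv_def)
  from B.cmp_eqv[OF B_graded_edeg this, of "edeg n j"]
  have e: "B.T.eqv (smul \<alpha> (kron [j])) (smul \<beta> (if edeg n k = edeg n j then kron [k] else 0))"
    by (simp add: cmp_smul cmp_kron cong: if_cong)
  have jk: "j = k"
  proof (rule ccontr)
    assume "j \<noteq> k"
    then have "edeg n k \<noteq> edeg n j" using edeg_inj[of n] assms by (auto simp: inj_on_def)
    then have "smul \<alpha> (kron [j]) \<in> B.I" using e by (simp add: B.T.eqv_def)
    then show False using B.ideal_smul_cancel assms B_gen_notin by blast
  qed
  then have "smul (\<alpha> - \<beta>) (kron [j]) \<in> B.I" using assms by (simp add: fv.scale_left_diff_distrib)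
  then have "\<alpha> - \<beta> = 0" using B.ideal_smul_cancel B_gen_notin assms by blast
  then show ?thesis using jk by simp
qed

text \<open>The diagonal entries give \<open>2 d (\<sigma> i) = 2 d i\<close>; with equal root
  lengths the form determines the Cartan matrix.\<close>

lemma isometry_autdiagr:
  assumes \<sigma>: "\<sigma> permutes {..<n}"
    and iso: "\<And>i j. i < n \<Longrightarrow> j < n \<Longrightarrow> bil (edeg n (\<sigma> i)) (edeg n (\<sigma> j)) = int (d i) * a i j"
  shows "\<sigma> \<in> autdiagr n a"
proof -
  have sn: "\<sigma> i < n" if "i < n" for i using permutes_in_image[OF \<sigma>, of i] that by simp
  have e: "int (d (\<sigma> i)) * a (\<sigma> i) (\<sigma> j) = int (d i) * a i j" if "i < n" "j < n" for i j
    using iso[OF that] bil_edeg[OF sn sn] that by simp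
  have "d (\<sigma> i) = d i" if "i < n" for i using e[OF that that] a_diag sn that by simp
  then have "a (\<sigma> i) (\<sigma> j) = a i j" if "i < n" "j < n" for i j
    using e[OF that] d_pos[OF that(1)] that by simp
  then show ?thesis using \<sigma> by (simp add: autdiagr_def)
qed

lemma U_weight_one: "w \<in> words n \<Longrightarrow> wdeg (edeg n) w = edeg n j \<Longrightarrow> j < n \<Longrightarrow> w = [j]"
proof -
  assume w: "w \<in> words n" "wdeg (edeg n) w = edeg n j" "j < n"
  obtain w1 w2 where w': "w = w1 @ j # w2" "Efree n w1" "Efree n w2" using split_edeg[OF w(2,3)] by metis
  have "u = []" if "Efree n u" "u \<in> words n" for u using that by (cases u) auto
  then show ?thesis using w w' by auto
qed

end

lemma supp_words: "u \<in> supp f \<Longrightarrow> f \<in> fs N \<Longrightarrow> u \<in> words N"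
  by (auto simp: fs_fsupp fsupp_def)

context quantum_data
begin

section \<open>Automorphisms of the positive part\<close>

lemma U_classification:
  assumes "\<phi> \<in> HopfAutU n q a d"
  shows "\<exists>\<sigma>\<in>autdiagr n a. \<exists>\<alpha>\<in>torus n. \<forall>i<n.
    U.T.eqv (algebra_aut.psiw n (relsU n q a d) \<phi> [i]) (smul (\<alpha> i) (kron [\<sigma> i]))"
proof -
  have alg: "is_alg_aut n (relsU n q a d) \<phi>"
    and br: "preserves_braiding n (relsU n q a d) (chiU q a d) \<phi>"
    using assms by (auto simp: HopfAutU_def)
  interpret A: algebra_aut n "relsU n q a d" \<phi> by unfold_locales (rule alg)
  let ?g = "edeg n"
  let ?chi = "chiU q a d"
  define x where "x = (\<lambda>i. A.psiw [i])"
  have xfs: "x i \<in> fs n" if "i < n" for i using that by (simp add: x_def A.psiw_fs)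
  have xI: "x i \<notin> U.I" if "i < n" for i
    using A.psi_I_iff[of "kron [i]"] U_gen_notin[OF that] that by (simp add: x_def)
  \<comment> \<open>The braiding acts on \<open>E_i \<otimes> E_j\<close> with the scalar
    \<open>q^(d_i a_ij)\<close>, and on a tensor of components of weights \<beta> and \<gamma> with
    \<open>q\<close> to the power \<open>bil \<beta> \<gamma>\<close>. If the exponents differed,
    the component \<open>?t\<close> would vanish in the quotient although both of its factors are
    nonzero there.\<close>
  have bil_eq: "bil \<beta> \<gamma> = int (d i) * a i j"
    if ij: "i < n" "j < n" and \<beta>: "cmp ?g \<beta> (x i) \<notin> U.I" and \<gamma>: "cmp ?g \<gamma> (x j) \<notin> U.I" for i j \<beta> \<gamma>
  proof (rule ccontr)
    assume ne: "bil \<beta> \<gamma> \<noteq> int (d i) * a i j"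
    let ?t = "tens (cmp ?g \<gamma> (x j)) (cmp ?g \<beta> (x i))"
    let ?c = "q powi (int (d i) * a i j)" and ?c' = "q powi bil \<beta> \<gamma>"
    have 1: "smul ?c (tens (x j) (x i)) - pw (\<lambda>(u, v). chiw ?chi v u) (tens (x j) (x i)) \<in> U.I2"
      using U.braid_psi[OF alg br, of "kron ([i], [j])"] ij
      by (simp add: braid_kron U.lift2_smul U.lift2_kron braid_tens x_def chiU_word bil_edeg)
    have "pw (\<lambda>(u, v). chiw ?chi v u) ?t = smul ?c' ?t"
    proof (rule pw_const)
      fix p assume "p \<in> supp ?t"
      then obtain u v where p: "p = (u, v)" "u \<in> supp (cmp ?g \<gamma> (x j))" "v \<in> supp (cmp ?g \<beta> (x i))"
        by (cases p) (auto simp: supp_def tens_def)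
      have "u \<in> words n" "v \<in> words n"
        using supp_words[OF p(2) cmp_fs[OF xfs]] supp_words[OF p(3) cmp_fs[OF xfs]] ij by auto
      moreover have "wdeg ?g u = \<gamma>" "wdeg ?g v = \<beta>" using p homog_cmp[of ?g] unfolding homog_def by blast+
      ultimately show "(\<lambda>(u, v). chiw ?chi v u) p = ?c'" by (simp add: p chiU_word)
    qed
    moreover have "U.cmp2 ?g \<gamma> \<beta> (pw f F) = pw f (U.cmp2 ?g \<gamma> \<beta> F)" for f and F :: "'k ncp2"
      by (auto simp: U.cmp2_def pw_def)
    ultimately have "U.cmp2 ?g \<gamma> \<beta> (smul ?c (tens (x j) (x i)) - pw (\<lambda>(u, v). chiw ?chi v u) (tens (x j) (x i)))
        = smul ?c ?t - smul ?c' ?t"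
      unfolding U.cmp2_tens[symmetric] by (simp add: U.cmp2_def pw_diff pw_smul)
    then have "smul (?c - ?c') ?t \<in> U.I2"
      using U.cmp2_ideal[OF U_graded 1, where g = ?g and \<gamma> = \<gamma> and \<delta> = \<beta>] by (simp add: fv.scale_left_diff_distrib)
    moreover have "?c - ?c' \<noteq> 0" using ne q_powi by auto
    ultimately have "?t \<in> U.I2"
      using ncideal2.smul[of "smul (?c - ?c') ?t" n _ "inverse (?c - ?c')"] by simp
    then show False using U.tens_ideal[of "cmp ?g \<gamma> (x j)" "cmp ?g \<beta> (x i)"] xfs ij \<beta> \<gamma> by simp
  qed
  \<comment> \<open>A component outside the ideal is nonzero, so its degree is that of a word and
    lies in the positive cone.\<close>
  have weight: "\<exists>w. \<gamma> = wdeg ?g w" if "cmp ?g \<gamma> f \<notin> U.I" for \<gamma> :: "nat \<Rightarrow> int" and f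
    using that homog_eq_zero[OF homog_cmp[of ?g \<gamma> f]] by (metis U.T.J_closed(4))
  have "\<exists>\<beta>. cmp ?g \<beta> (x i) \<notin> U.I" if "i < n" for i
    using U.exists_cmp[OF xfs[OF that] xI[OF that]] by blast
  then obtain \<beta> where \<beta>: "\<And>i. i < n \<Longrightarrow> cmp ?g (\<beta> i) (x i) \<notin> U.I" by metis
  have hom: "U.T.eqv (x i) (cmp ?g (\<beta> i) (x i))" if i: "i < n" for i
  proof (rule U.eqv_cmp[OF xfs[OF i]], rule ccontr)
    fix \<gamma> assume ne: "\<gamma> \<noteq> \<beta> i" and \<gamma>: "cmp ?g \<gamma> (x i) \<notin> U.I"
    \<comment> \<open>Expanding gives four pairings of weights of the same image, all equal to
      \<open>d i * a i i\<close>.\<close>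
    have "bil (\<beta> i - \<gamma>) (\<beta> i - \<gamma>) = 0"
      using bil_eq[OF i i] \<beta>[OF i] \<gamma> by (simp add: bil_diff)
    then have "\<beta> i k = \<gamma> k" if "k < n" for k
      using bil_pos[OF that, of "\<beta> i - \<gamma>"] by (auto simp: fun_apply)
    moreover have "\<beta> i k = \<gamma> k" if "n \<le> k" for k
      using weight[OF \<beta>[OF i]] weight[OF \<gamma>] wdeg_edeg_ge[OF that] by metis
    ultimately have "\<beta> i = \<gamma>" by (metis ext not_le)
    then show False using ne by simp
  qed
  have "\<exists>l<n. \<beta> l = ?g j" if j: "j < n" for j
  proof (rule A.weight_of_generator[OF U_graded, where y = "\<lambda>i. cmp ?g (\<beta> i) (x i)"])
    show "0 \<le> \<beta> i k" if "i < n" for i k using weight[OF \<beta>[OF that]] wdeg_edeg_nonneg by metis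
    show "?g j j = 1" using j by (simp add: edeg_def)
    show "?g j k = 0" if "k \<noteq> j" for k using that by (simp add: edeg_def)
    show "cmp ?g (\<beta> i) (x i) \<in> fs n \<and> U.T.eqv (A.psiw [i]) (cmp ?g (\<beta> i) (x i))" if "i < n" for i
      using hom[OF that] xfs[OF that] by (simp add: x_def)
  qed (use j U_gen_notin homog_cmp in auto)
  then obtain \<sigma> where \<sigma>: "\<sigma> permutes {..<n}" "\<And>i. i < n \<Longrightarrow> \<beta> i = ?g (\<sigma> i)"
    using permutation_of_weights[OF _ edeg_inj, of n \<beta>] by metis
  have sn: "\<sigma> i < n" if "i < n" for i using permutes_in_image[OF \<sigma>(1), of i] that by simp
  have aut: "\<sigma> \<in> autdiagr n a"
    by (rule isometry_autdiagr[OF \<sigma>(1)]) (use bil_eq \<beta> \<sigma>(2) in auto)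
  have "\<exists>c. U.T.eqv (x i) (smul c (kron [\<sigma> i])) \<and> c \<noteq> 0" if i: "i < n" for i
  proof -
    have "\<exists>c. U.T.eqv (cmp ?g (\<beta> i) (x i)) (smul c (kron [\<sigma> i]))"
    proof (rule U.eqv_multiple[OF fsupp_homog[OF _ homog_cmp]])
      fix w assume "w \<in> {w \<in> words n. wdeg ?g w = \<beta> i}"
      then have "w = [\<sigma> i]" using U_weight_one[of w "\<sigma> i"] \<sigma>(2) sn i by auto
      then show "\<exists>c. U.T.eqv (kron w) (smul c (kron [\<sigma> i]))" by (intro exI[of _ 1]) simp
    qed (use xfs i in auto)
    then obtain c where c: "U.T.eqv (cmp ?g (\<beta> i) (x i)) (smul c (kron [\<sigma> i]))" by blast
    have e: "U.T.eqv (x i) (smul c (kron [\<sigma> i]))" by (rule U.T.eqv_trans[OF hom[OF i] c])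
    moreover have "c \<noteq> 0"
    proof
      assume "c = 0"
      then have "x i \<in> U.I" using e by (simp add: U.T.eqv_zero_iff)
      then show False using xI[OF i] by simp
    qed
    ultimately show ?thesis by blast
  qed
  then obtain c where c: "\<And>i. i < n \<Longrightarrow> U.T.eqv (x i) (smul (c i) (kron [\<sigma> i])) \<and> c i \<noteq> 0" by metis
  show ?thesis
  proof (intro bexI[OF _ aut] bexI[of _ "\<lambda>i\<in>{..<n}. c i"] allI impI)
    show "(\<lambda>i\<in>{..<n}. c i) \<in> torus n" using c by (auto simp: torus_def)
  qed (use c in \<open>auto simp: x_def\<close>)
qed

section \<open>The torus coactions on the Borel part\<close>

lemma slice_mul:
  assumes "F \<in> fs2 N" "u \<in> words N" "v \<in> words N"
  shows "sliceR p (mul2 chi1 (kron (u, v)) F) = ncmul (kron u) (sliceR (\<lambda>w. p (v @ w)) F :: 'k ncp)"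
    and "sliceL p (mul2 chi1 (kron (u, v)) F) = ncmul (kron v) (sliceL (\<lambda>w. p (u @ w)) F :: 'k ncp)"
proof -
  have "sliceR p (mul2 chi1 (kron (u, v)) F) = ncmul (kron u) (sliceR (\<lambda>w. p (v @ w)) F :: 'k ncp)
    \<and> sliceL p (mul2 chi1 (kron (u, v)) F) = ncmul (kron v) (sliceL (\<lambda>w. p (u @ w)) F :: 'k ncp)"
    using assms(1)
  proof (induction rule: fs2_induct)
    case (add F G)
    have "kron (u, v) \<in> (fs2 N :: 'k ncp2 set)" using assms by simp
    with add show ?case by (simp add: slice_add[of _ N] mul2_add_right ncmul_add_right)
  next
    case (kron z)
    then show ?case by (cases z) (simp add: mul2_kron sliceR_def sliceL_def ncmul_smul_right ncmul_kron)
  qed (auto simp: mul2_smul_right slice_smul ncmul_smul_right)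
  then show "sliceR p (mul2 chi1 (kron (u, v)) F) = ncmul (kron u) (sliceR (\<lambda>w. p (v @ w)) F :: 'k ncp)"
    and "sliceL p (mul2 chi1 (kron (u, v)) F) = ncmul (kron v) (sliceL (\<lambda>w. p (u @ w)) F :: 'k ncp)" by auto
qed

lemma slice_null [simp]: "sliceR (\<lambda>w. 0) F = 0" "sliceL (\<lambda>w. 0) F = 0"
  by (auto simp: sliceR_def sliceL_def lin_def fun_eq_iff fun_apply case_prod_beta)

lemma pK_E: "x < n \<Longrightarrow> pK \<mu> (x # w) = 0" and pK_K: "n \<le> x \<Longrightarrow> pK \<mu> (x # w) = pK (\<mu> - kdeg n x) w"
  by (auto simp: pK_def algebra_simps)

text \<open>Applying \<open>pK \<mu>\<close> to one leg of the coproduct is a torus coaction, hence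
  the projection to a degree. Of the two terms \<open>E_x \<otimes> 1\<close> and
  \<open>K_x \<otimes> E_x\<close> the right slice keeps only the former and the left slice only the
  latter.\<close>

lemma slice_delta_word:
  "w \<in> words (3 * n) \<Longrightarrow> sliceR (pK \<mu>) (delta_word chi1 (DB n) w) = cmp (kdeg n) \<mu> (kron w)
    \<and> sliceL (pK \<mu>) (delta_word chi1 (DB n) w) = cmp ldeg \<mu> (kron w)"
proof (induction w arbitrary: \<mu>)
  case Nil
  show ?case by (auto simp: delta_word_def ncone_kron tens_kron sliceR_def sliceL_def cmp_kron pK_def)
next
  case (Cons x w)
  let ?G = "delta_word chi1 (DB n) w :: 'k ncp2"
  have G: "?G \<in> fs2 (3 * n)" using Cons.prems by (simp add: B.delta_word_fs2)
  show ?case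
  proof (cases "x < n")
    case True
    have fs2: "mul2 chi1 (kron ([x], [])) ?G \<in> fs2 (3 * n)" "mul2 chi1 (kron ([n + x], [x])) ?G \<in> fs2 (3 * n)"
      using G True by (auto intro!: mul2_in_fs2)
    have l: "ldeg x = kdeg n (n + x)" using True by (simp add: ldeg_def kdeg_K)
    show ?thesis using Cons True G fs2
      by (auto simp: B.delta_word_Cons DB_E mul2_add_left slice_add[of _ "3 * n"] slice_mul[of _ "3 * n"]
          pK_E pK_K cmp_kron ncmul_kron l algebra_simps)
  next
    case False
    then have "ldeg x = kdeg n x" by (simp add: ldeg_def)
    then show ?thesis using Cons False G
      by (auto simp: B.delta_word_Cons DB_K slice_mul[of _ "3 * n"] pK_K cmp_kron ncmul_kron algebra_simps)
  qed
qed

lemma slice_Delta: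
  assumes "f \<in> fs (3 * n)"
  shows "sliceR (pK \<mu>) (B.\<Delta> f) = cmp (kdeg n) \<mu> f" "sliceL (pK \<mu>) (B.\<Delta> f) = cmp ldeg \<mu> f"
proof -
  have "sliceR (pK \<mu>) (B.\<Delta> f) = cmp (kdeg n) \<mu> f \<and> sliceL (pK \<mu>) (B.\<Delta> f) = cmp ldeg \<mu> f"
    using assms
    by (induction rule: fs_induct) (auto simp: B.Delta_zero B.Delta_add B.Delta_smul B.Delta_kron B.Delta_fs2
        slice_add[of _ "3 * n"] slice_smul slice_delta_word cmp_add cmp_smul)
  then show "sliceR (pK \<mu>) (B.\<Delta> f) = cmp (kdeg n) \<mu> f" "sliceL (pK \<mu>) (B.\<Delta> f) = cmp ldeg \<mu> f" by auto
qed

lemma qcomm_homog: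
  assumes h: "h \<in> fs (3 * n)" "homog (edeg n) 0 h" "homog (kdeg n) \<mu> h"
    and f: "f \<in> fs (3 * n)" "homog (edeg n) \<beta> f"
  shows "B.T.eqv (ncmul h f) (smul (q powi bil \<mu> \<beta>) (ncmul f h))"
proof -
  have "h \<in> fsupp {u \<in> words (3 * n). Efree n u \<and> wdeg (kdeg n) u = \<mu>}"
    using h by (auto simp: fs_fsupp fsupp_def homog_def Efree_wdeg)
  then show ?thesis
  proof (induction rule: fsupp_induct)
    case (kron u)
    show ?case using fsupp_homog[OF f]
    proof (induction rule: fsupp_induct)
      case (kron v)
      then show ?case using \<open>u \<in> _\<close> qcomm_words[of u v] by (auto simp: ncmul_kron)
    next
      case (add f g)
      from B.T.eqv_add[OF add(3,4)] show ?case
        by (simp add: ncmul_add_left ncmul_add_right fv.scale_right_distrib)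
    next
      case (smul c f)
      from B.T.eqv_smul[OF smul(2), of c] show ?case
        by (simp add: ncmul_smul_left ncmul_smul_right mult.commute)
    qed simp
  next
    case (add f g)
    from B.T.eqv_add[OF add(3,4)] show ?case
      by (simp add: ncmul_add_left ncmul_add_right fv.scale_right_distrib)
  next
    case (smul c f)
    from B.T.eqv_smul[OF smul(2), of c] show ?case
      by (simp add: ncmul_smul_left ncmul_smul_right mult.commute)
  qed simp
qed

lemma pK_cmp: "f \<in> fs N \<Longrightarrow> ev (pK \<mu>) (cmp (edeg n) 0 f) = ev (pK \<mu>) f"
  by (induction rule: fs_induct)
    (auto simp: cmp_add cmp_smul ev_add[of _ "words N"] ev_smul cmp_kron pK_def Efree_wdeg simp flip: fs_fsupp)

lemma ev_eqv: "B.T.eqv f g \<Longrightarrow> f \<in> fs (3 * n) \<Longrightarrow> g \<in> fs (3 * n) \<Longrightarrow> ev (pK \<mu>) f = ev (pK \<mu>) g"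
  using pK_ideal[of "f - g" \<mu>] ev_diff[of f "words (3 * n)" g "pK \<mu>"] by (simp add: B.T.eqv_def fs_fsupp)

lemma homog_sub: "homog (kdeg n) \<mu> f \<Longrightarrow> homog ldeg \<nu> f \<Longrightarrow> homog (edeg n) (\<nu> - \<mu>) f"
  by (auto simp: homog_def wdeg_ldeg)

end

section \<open>Automorphisms of the Borel part\<close>

locale borel_aut = quantum_data q n a d for q :: "'k::field_char_0" and n a d +
  fixes \<phi>
  assumes phi: "\<phi> \<in> HopfAutB n q a d"
begin

lemma alg: "is_alg_aut (3 * n) (relsB n q a d) \<phi>"
  and coalg: "is_coalg_map (3 * n) (relsB n q a d) chi1 (DB n) (epsB n) \<phi>"
  using phi by (auto simp: HopfAutB_def)

sublocale A: algebra_aut "3 * n" "relsB n q a d" \<phi>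
  by unfold_locales (rule alg)

abbreviation img :: "nat \<Rightarrow> 'k ncp" where
  "img x \<equiv> A.psiw [x]"

lemma img_fs: "x < 3 * n \<Longrightarrow> img x \<in> fs (3 * n)"
  by (simp add: A.psiw_fs)

text \<open>Slicing \<open>g \<otimes> g\<close> on either side shows that the component of
  \<open>g\<close> at \<mu> is its \<open>pK \<mu>\<close> value times \<open>g\<close>, for
  \<open>kdeg\<close> and for \<open>ldeg\<close>. A nonzero component forces the value 1, so
  \<open>g\<close> is homogeneous for both degrees and its \<open>edeg\<close> is 0.\<close>

lemma grouplike_image:
  assumes x: "n \<le> x" "x < 3 * n"
  shows "\<exists>\<mu> h. h \<in> fs (3 * n) \<and> B.T.eqv (img x) h \<and> homog (edeg n) 0 h \<and> homog (kdeg n) \<mu> h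
    \<and> ev (pK \<mu>) (img x) = 1 \<and> ncEps (epsB n) (img x) = 1"
proof -
  define g where "g = img x"
  have g: "g \<in> fs (3 * n)" using x by (simp add: g_def img_fs)
  have eps: "ncEps (epsB n) g = 1"
    using B.coalg_psi(2)[OF alg coalg, of "kron [x]"] x by (simp add: g_def ncEps_ev epsB_def)
  have gI: "g \<notin> B.I" using B.eps_I[of g] eps by auto
  have D: "B.\<Delta> g - tens g g \<in> B.I2"
    using B.coalg_psi(1)[OF alg coalg, of "kron [x]"] x
    by (simp add: Delta_Efree B.lift2_kron g_def)
  have s: "cmp (kdeg n) \<mu> g - smul (ev (pK \<mu>) g) g \<in> B.I" "cmp ldeg \<mu> g - smul (ev (pK \<mu>) g) g \<in> B.I" for \<mu>
    using B.slice_ideal[OF pK_ideal D, of \<mu>] g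
    by (simp_all add: slice_diff[of _ "3 * n"] B.Delta_fs2 slice_tens[of _ "3 * n"] slice_Delta)
  obtain \<mu> where \<mu>: "cmp (kdeg n) \<mu> g \<notin> B.I" using B.exists_cmp[OF g gI, of "kdeg n"] by blast
  define c where "c = ev (pK \<mu>) g"
  have e1: "B.T.eqv (cmp (kdeg n) \<mu> g) (smul c g)" using s(1)[of \<mu>] by (simp add: c_def B.T.eqv_def)
  have e2: "B.T.eqv (cmp ldeg \<mu> g) (smul c g)" using s(2)[of \<mu>] by (simp add: c_def B.T.eqv_def)
  have c0: "c \<noteq> 0" using e1 \<mu> by (auto simp: B.T.eqv_zero_iff)
  \<comment> \<open>Projections are idempotent: applied to \<open>e1\<close>, this one shows that
    \<open>c\<close> fixes a vector that is nonzero in the quotient.\<close>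
  have "B.T.eqv (cmp (kdeg n) \<mu> g) (smul c (cmp (kdeg n) \<mu> g))"
    using B.cmp_eqv[OF B_graded_kdeg e1, of \<mu>] by (simp add: cmp_homog[OF homog_cmp] cmp_smul)
  then have "smul (1 - c) (cmp (kdeg n) \<mu> g) \<in> B.I"
    by (simp add: B.T.eqv_def fv.scale_left_diff_distrib)
  then have c1: "c = 1" using B.ideal_smul_cancel[of "1 - c"] \<mu> by auto
  \<comment> \<open>Projecting for both degrees yields a single representative that is homogeneous
    for both.\<close>
  define h where "h = cmp (kdeg n) \<mu> (cmp ldeg \<mu> g)"
  have k: "B.T.eqv g (cmp (kdeg n) \<mu> g)" using B.T.eqv_sym[OF e1] c1 by simp
  have "B.T.eqv (cmp (kdeg n) \<mu> g) h"
    unfolding h_def by (rule B.cmp_eqv[OF B_graded_kdeg]) (use B.T.eqv_sym[OF e2] c1 in simp)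
  then have "B.T.eqv g h" by (rule B.T.eqv_trans[OF k])
  moreover have hk: "homog (kdeg n) \<mu> h" unfolding h_def by (rule homog_cmp)
  moreover have "homog ldeg \<mu> h" unfolding h_def by (intro homog_cmp_other homog_cmp)
  then have "homog (edeg n) 0 h" using homog_sub[OF hk] by force
  moreover have "h \<in> fs (3 * n)" using g by (simp add: h_def)
  ultimately show ?thesis using eps c1 unfolding c_def g_def by blast
qed

text \<open>For a \<open>K\<close> letter, the weight of its image; \<open>kimg\<close> is a
  representative homogeneous of that weight. Both are fixed by choice so that later statements can
  refer to them.\<close>

definition kw :: "nat \<Rightarrow> nat \<Rightarrow> int" where
  "kw x = (SOME \<mu>. \<exists>h. h \<in> fs (3 * n) \<and> B.T.eqv (img x) h \<and> homog (edeg n) 0 h \<and> homog (kdeg n) \<mu> h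
    \<and> ev (pK \<mu>) (img x) = 1 \<and> ncEps (epsB n) (img x) = 1)"

definition kimg :: "nat \<Rightarrow> 'k ncp" where
  "kimg x = (SOME h. h \<in> fs (3 * n) \<and> B.T.eqv (img x) h \<and> homog (edeg n) 0 h \<and> homog (kdeg n) (kw x) h
    \<and> ev (pK (kw x)) (img x) = 1 \<and> ncEps (epsB n) (img x) = 1)"

lemma kimg:
  assumes "n \<le> x" "x < 3 * n"
  shows "kimg x \<in> fs (3 * n)" "B.T.eqv (img x) (kimg x)" "homog (edeg n) 0 (kimg x)"
    "homog (kdeg n) (kw x) (kimg x)" "ev (pK (kw x)) (img x) = 1" "ncEps (epsB n) (img x) = 1"
  using someI_ex[OF someI_ex[OF grouplike_image[OF assms], folded kw_def], folded kimg_def] by auto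

lemma psi_letters: "x < 3 * n \<Longrightarrow> y < 3 * n \<Longrightarrow> B.T.eqv (A.psiw [x, y]) (ncmul (img x) (img y))"
  using A.psi_mul[of "kron [x]" "kron [y]"] by (simp add: ncmul_kron)

lemma img_inverse:
  assumes x: "n \<le> x" "x < 3 * n"
  shows "B.T.eqv (ncmul (img x) (img (kinv x))) ncone"
proof -
  have "B.T.eqv (A.psiw [x, kinv x]) (A.psiw [])"
    using A.psi_eqv[OF _ _ rel_inv[OF x]] kinv[OF x] x by simp
  moreover have "B.T.eqv (A.psiw []) ncone" using A.psi_one by (simp add: ncone_kron)
  ultimately have "B.T.eqv (A.psiw [x, kinv x]) ncone" using B.T.eqv_trans by blast
  moreover have "B.T.eqv (A.psiw [x, kinv x]) (ncmul (img x) (img (kinv x)))"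
    using psi_letters kinv[OF x] x by simp
  ultimately show ?thesis using B.T.eqv_trans B.T.eqv_sym by blast
qed

text \<open>\<phi> preserves \<open>K_j E_i = q^(d_j a_ji) E_i K_j\<close>. The image of
  \<open>K_j\<close> has \<open>edeg\<close> 0, so the relation passes to each component of the
  image of \<open>E_i\<close>, while the commutation rule for the weight \<open>kw (n + j)\<close>
  gives another power of \<open>q\<close>. As the image of \<open>K_j\<close> is invertible, the
  exponents agree.\<close>

lemma skew_weight:
  assumes i: "i < n" and j: "j < n" and X: "cmp (edeg n) \<beta> (img i) \<notin> B.I"
  shows "bil (kw (n + j)) \<beta> = int (d j) * a j i"
proof (rule ccontr)
  assume ne: "bil (kw (n + j)) \<beta> \<noteq> int (d j) * a j i"
  let ?c = "q powi (int (d j) * a j i)" and ?c' = "q powi bil (kw (n + j)) \<beta>"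
  define X where "X = cmp (edeg n) \<beta> (img i)"
  define h where "h = kimg (n + j)"
  have nj: "n \<le> n + j" "n + j < 3 * n" and i3: "i < 3 * n" using i j by auto
  note h = kimg[OF nj, folded h_def]
  have Xfs: "X \<in> fs (3 * n)" using img_fs i3 by (simp add: X_def)
  have 1: "B.T.eqv (ncmul (img (n + j)) (img i)) (smul ?c (ncmul (img i) (img (n + j))))"
  proof -
    have "B.T.eqv (A.psiw [n + j, i]) (smul ?c (A.psiw [i, n + j]))"
      using A.psi_eqv[OF _ _ rel_qcomm[OF j i]] i3 nj by (simp add: lin_smul)
    then show ?thesis
      using B.T.eqv_trans[OF B.T.eqv_trans[OF B.T.eqv_sym[OF psi_letters[OF nj(2) i3]]] B.T.eqv_smul[OF psi_letters[OF i3 nj(2)]]]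
      by blast
  qed
  have 2: "B.T.eqv (ncmul h (img i)) (smul ?c (ncmul (img i) h))"
  proof -
    have "B.T.eqv (ncmul h (img i)) (ncmul (img (n + j)) (img i))"
      by (rule B.T.eqv_mul_right[OF B.T.eqv_sym[OF h(2)] img_fs[OF i3]])
    moreover have "B.T.eqv (smul ?c (ncmul (img i) (img (n + j)))) (smul ?c (ncmul (img i) h))"
      by (rule B.T.eqv_smul[OF B.T.eqv_mul_left[OF h(2) img_fs[OF i3]]])
    ultimately show ?thesis using 1 B.T.eqv_trans by blast
  qed
  have 3: "B.T.eqv (ncmul h X) (smul ?c (ncmul X h))"
    using B.cmp_eqv[OF B_graded_edeg 2, of \<beta>]
    by (simp add: cmp_smul cmp_mul_left[OF h(1) h(3) img_fs[OF i3]] cmp_mul_right[OF h(1) h(3) img_fs[OF i3]] X_def)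
  have 4: "B.T.eqv (ncmul h X) (smul ?c' (ncmul X h))"
    by (rule qcomm_homog[OF h(1,3,4) Xfs]) (simp add: X_def homog_cmp)
  have "B.T.eqv (smul ?c (ncmul X h)) (smul ?c' (ncmul X h))"
    by (rule B.T.eqv_trans[OF B.T.eqv_sym[OF 3] 4])
  then have "smul (?c - ?c') (ncmul X h) \<in> B.I" by (simp add: B.T.eqv_def fv.scale_left_diff_distrib)
  moreover have "?c - ?c' \<noteq> 0" using ne q_powi by auto
  ultimately have "ncmul X h \<in> B.I" by (rule B.ideal_smul_cancel)
  \<comment> \<open>Cancels \<open>h\<close> against the image of the inverse letter.\<close>
  then have "ncmul (ncmul X h) (img (kinv (n + j))) \<in> B.I"
    by (rule B.I_mul_right) (use kinv[OF nj] img_fs in auto)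
  moreover have "B.T.eqv (ncmul X (ncmul h (img (kinv (n + j))))) (ncmul X ncone)"
  proof (rule B.T.eqv_mul_left[OF _ Xfs])
    have "B.T.eqv (ncmul h (img (kinv (n + j)))) (ncmul (img (n + j)) (img (kinv (n + j))))"
      by (rule B.T.eqv_mul_right[OF B.T.eqv_sym[OF h(2)]]) (use kinv[OF nj] img_fs in auto)
    then show "B.T.eqv (ncmul h (img (kinv (n + j)))) ncone"
      using img_inverse[OF nj] B.T.eqv_trans by blast
  qed
  ultimately have "X \<in> B.I" using B.T.eqv_mem Xfs by (simp add: ncmul_assoc)
  then show False using X by (simp add: X_def)
qed

lemma gen_notin: "i < n \<Longrightarrow> img i \<notin> B.I"
  using A.psi_I_iff[of "kron [i]"] B_gen_notin by simp

text \<open>With \<open>X\<close> and \<open>g\<close> the images of \<open>E_i\<close> and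
  \<open>K_i\<close>, the coproduct of \<open>X\<close> is
  \<open>X \<otimes> 1 + g \<otimes> X\<close>. As every \<open>pK \<mu>\<close> vanishes on
  \<open>X\<close>, the right slice at 0 recovers \<open>X\<close> from the left term and the left
  slice at the weight of \<open>g\<close> recovers it from the right term. So \<open>X\<close> has
  \<open>kdeg\<close> 0 and its \<open>ldeg\<close> is the weight of \<open>g\<close>.\<close>

lemma skew_image:
  assumes i: "i < n"
  defines "Y \<equiv> cmp (kdeg n) 0 (cmp ldeg (kw (n + i)) (img i))"
  shows "Y \<in> fs (3 * n)" "B.T.eqv (img i) Y" "homog (kdeg n) 0 Y" "homog (edeg n) (kw (n + i)) Y"
    "\<exists>w. kw (n + i) = wdeg (edeg n) w"
    "\<And>j. j < n \<Longrightarrow> bil (kw (n + j)) (kw (n + i)) = int (d j) * a j i"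
proof -
  define X where "X = img i"
  define g where "g = img (n + i)"
  have ni: "n \<le> n + i" "n + i < 3 * n" and i3: "i < 3 * n" using i by auto
  have Xfs: "X \<in> fs (3 * n)" and gfs: "g \<in> fs (3 * n)" using img_fs i3 ni by (auto simp: X_def g_def)
  \<comment> \<open>A nonzero component of weight 0 would pair to 0 with the weight of the image of
    \<open>K_i\<close>, against \<open>d i * a i i = 2 * d i\<close>.\<close>
  have "cmp (edeg n) 0 X \<in> B.I"
    using skew_weight[OF i i, of 0] d_pos[OF i] a_diag[OF i] by (auto simp: X_def)
  then have evX: "ev (pK \<mu>) X = 0" for \<mu> using pK_cmp[OF Xfs] pK_ideal by metis
  have one: "B.T.eqv (A.psiw []) ncone" using A.psi_one by (simp add: ncone_kron)
  have ofs: "A.psiw [] \<in> fs (3 * n)" by (simp add: A.psiw_fs)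
  have ev1: "ev (pK 0) (A.psiw []) = 1"
    using ev_eqv[OF one ofs] by (simp add: ncone_kron pK_def)
  have D: "B.\<Delta> X - (tens X (A.psiw []) + tens g X) \<in> B.I2"
    using B.coalg_psi(1)[OF alg coalg, of "kron [i]"] i i3 ni
    by (simp add: B.Delta_gen[unfolded ncgen_kron] DB_E B.lift2_add B.lift2_kron X_def g_def)
  have "sliceR (pK 0) (B.\<Delta> X - (tens X (A.psiw []) + tens g X)) \<in> B.I"
    by (rule B.slice_ideal[OF pK_ideal D])
  then have "cmp (kdeg n) 0 X - X \<in> B.I"
    using Xfs gfs ofs
    by (simp add: slice_diff[of _ "3 * n"] slice_add[of _ "3 * n"] B.Delta_fs2 slice_tens[of _ "3 * n"] slice_Delta ev1 evX)
  then have k: "B.T.eqv X (cmp (kdeg n) 0 X)" using B.T.eqv_sym by (simp add: B.T.eqv_def)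
  have "sliceL (pK (kw (n + i))) (B.\<Delta> X - (tens X (A.psiw []) + tens g X)) \<in> B.I"
    by (rule B.slice_ideal[OF pK_ideal D])
  then have "cmp ldeg (kw (n + i)) X - X \<in> B.I"
    using Xfs gfs ofs kimg(5)[OF ni]
    by (simp add: slice_diff[of _ "3 * n"] slice_add[of _ "3 * n"] B.Delta_fs2 slice_tens[of _ "3 * n"] slice_Delta evX g_def)
  then have l: "B.T.eqv X (cmp ldeg (kw (n + i)) X)" using B.T.eqv_sym by (simp add: B.T.eqv_def)
  have YX: "Y = cmp (kdeg n) 0 (cmp ldeg (kw (n + i)) X)" by (simp add: Y_def X_def)
  show Yfs: "Y \<in> fs (3 * n)" using Xfs by (simp add: YX)
  have XY: "B.T.eqv X Y"
    unfolding YX by (rule B.T.eqv_trans[OF k B.cmp_eqv[OF B_graded_kdeg l]])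
  then show "B.T.eqv (img i) Y" by (simp add: X_def)
  show Yk: "homog (kdeg n) 0 Y" unfolding YX by (rule homog_cmp)
  have "homog ldeg (kw (n + i)) Y" unfolding YX by (intro homog_cmp_other homog_cmp)
  then show Ye: "homog (edeg n) (kw (n + i)) Y" using homog_sub[OF Yk] by force
  have YI: "Y \<notin> B.I" using gen_notin[OF i] B.T.eqv_mem[OF XY] by (simp add: X_def)
  show "\<exists>w. kw (n + i) = wdeg (edeg n) w"
    using homog_eq_zero[OF Ye] YI by (metis B.T.J_closed(4))
  have "B.T.eqv (cmp (edeg n) (kw (n + i)) X) Y"
    using B.cmp_eqv[OF B_graded_edeg XY, of "kw (n + i)"] by (simp add: cmp_homog[OF Ye])
  then have "cmp (edeg n) (kw (n + i)) (img i) \<notin> B.I" using B.T.eqv_mem YI by (simp add: X_def)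
  then show "\<And>j. j < n \<Longrightarrow> bil (kw (n + j)) (kw (n + i)) = int (d j) * a j i"
    using skew_weight[OF i] by blast
qed

lemma B_classification:
  "\<exists>\<sigma>\<in>autdiagr n a. \<exists>\<alpha>\<in>torus n. \<forall>i<n. B.T.eqv (img i) (smul (\<alpha> i) (kron [\<sigma> i]))
    \<and> B.T.eqv (img (n + i)) (kron [n + \<sigma> i]) \<and> B.T.eqv (img (2 * n + i)) (kron [2 * n + \<sigma> i])"
proof -
  define Y where "Y i = cmp (kdeg n) 0 (cmp ldeg (kw (n + i)) (img i))" for i
  note Y = skew_image[folded Y_def]
  define y where "y = (\<lambda>x. if x < n then Y x else kimg x)"
  \<comment> \<open>All \<open>3 n\<close> generators take part in the cone argument; the images of
    the \<open>K\<close> letters have \<open>edeg\<close> 0.\<close>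
  define \<beta> where "\<beta> = (\<lambda>x. if x < n then kw (n + x) else 0)"
  have \<beta>nn: "0 \<le> \<beta> x k" if "x < 3 * n" for x k
    using Y(5)[of x] wdeg_edeg_nonneg by (auto simp: \<beta>_def fun_apply)
  have ex: "\<exists>x<n. \<beta> x = edeg n j" if j: "j < n" for j
  proof -
    have "\<exists>x<3 * n. \<beta> x = edeg n j"
    proof (rule A.weight_of_generator[OF B_graded_edeg, where y = y])
      show "y x \<in> fs (3 * n) \<and> B.T.eqv (img x) (y x)" if "x < 3 * n" for x
        using that Y kimg by (auto simp: y_def not_less)
      show "homog (edeg n) (\<beta> x) (y x)" if "x < 3 * n" for x
        using that Y kimg by (auto simp: y_def \<beta>_def not_less)
      show "edeg n j j = 1" using j by (simp add: edeg_def)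
      show "edeg n j k = 0" if "k \<noteq> j" for k using that by (simp add: edeg_def)
    qed (use j B_gen_notin \<beta>nn in auto)
    then obtain x where x: "x < 3 * n" "\<beta> x = edeg n j" by blast
    \<comment> \<open>The \<open>K\<close> letters have weight 0, so the generator found is an
      \<open>E\<close> letter.\<close>
    have "\<beta> x j = 1" using x j by (simp add: edeg_def)
    then have "x < n" by (auto simp: \<beta>_def fun_apply split: if_splits)
    then show ?thesis using x by blast
  qed
  obtain \<sigma> where \<sigma>: "\<sigma> permutes {..<n}" "\<And>i. i < n \<Longrightarrow> \<beta> i = edeg n (\<sigma> i)"
    using permutation_of_weights[OF ex edeg_inj] by metis
  have sn: "\<sigma> i < n" if "i < n" for i using permutes_in_image[OF \<sigma>(1), of i] that by simp
  have kws: "kw (n + i) = edeg n (\<sigma> i)" if "i < n" for i using \<sigma>(2)[OF that] that by (simp add: \<beta>_def)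
  have aut: "\<sigma> \<in> autdiagr n a"
  proof (rule isometry_autdiagr[OF \<sigma>(1)])
    show "bil (edeg n (\<sigma> i)) (edeg n (\<sigma> j)) = int (d i) * a i j" if "i < n" "j < n" for i j
      using Y(6)[OF that(2,1)] that by (simp add: kws)
  qed
  have E: "\<exists>c. B.T.eqv (img i) (smul c (kron [\<sigma> i])) \<and> c \<noteq> 0" if i: "i < n" for i
  proof -
    have "Y i \<in> fsupp {w \<in> words (3 * n). wdeg (edeg n) w = edeg n (\<sigma> i) \<and> wdeg (kdeg n) w = 0}"
      using Y(1,3,4)[OF i] kws[OF i] by (auto simp: fs_fsupp fsupp_def homog_def)
    then have "\<exists>c. B.T.eqv (Y i) (smul c (kron [\<sigma> i]))"
      by (rule B.eqv_multiple) (use weight_one_eqv sn[OF i] in auto)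
    then obtain c where "B.T.eqv (Y i) (smul c (kron [\<sigma> i]))" by blast
    then have c: "B.T.eqv (img i) (smul c (kron [\<sigma> i]))" by (rule B.T.eqv_trans[OF Y(2)[OF i]])
    moreover have "c \<noteq> 0" using c gen_notin[OF i] by (auto simp: B.T.eqv_zero_iff)
    ultimately show ?thesis by blast
  qed
  then obtain c where c: "\<And>i. i < n \<Longrightarrow> B.T.eqv (img i) (smul (c i) (kron [\<sigma> i])) \<and> c i \<noteq> 0" by metis
  have K: "B.T.eqv (img (n + i)) (kron [n + \<sigma> i])" if i: "i < n" for i
  proof -
    have ni: "n \<le> n + i" "n + i < 3 * n" and nsi: "n + \<sigma> i < 3 * n" using i sn[OF i] by auto
    note h = kimg[OF ni]
    have "kimg (n + i) \<in> fsupp {w \<in> words (3 * n). Efree n w \<and> wdeg (kdeg n) w = edeg n (\<sigma> i)}"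
      using h(1,3,4) kws[OF i] by (auto simp: fs_fsupp fsupp_def homog_def Efree_wdeg)
    then have "\<exists>c. B.T.eqv (kimg (n + i)) (smul c (kron [n + \<sigma> i]))"
    proof (rule B.eqv_multiple)
      fix w assume "w \<in> {w \<in> words (3 * n). Efree n w \<and> wdeg (kdeg n) w = edeg n (\<sigma> i)}"
      then have "B.T.eqv (kron w) (kron [n + \<sigma> i])"
        using nsi sn[OF i] by (intro Efree_eqv) (auto simp: kdeg_K)
      then show "\<exists>c. B.T.eqv (kron w) (smul c (kron [n + \<sigma> i]))" by (intro exI[of _ 1]) simp
    qed
    then obtain c where "B.T.eqv (kimg (n + i)) (smul c (kron [n + \<sigma> i]))" by blast
    then have c: "B.T.eqv (img (n + i)) (smul c (kron [n + \<sigma> i]))" by (rule B.T.eqv_trans[OF h(2)])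
    \<comment> \<open>The weight determines the image of \<open>K_i\<close> up to a scalar, and the
      counit, which is 1 on both sides, makes that scalar 1.\<close>
    have "ncEps (epsB n) (img (n + i) - smul c (kron [n + \<sigma> i])) = 0"
      using c by (intro B.eps_I) (simp add: B.T.eqv_def)
    then have "c = 1"
      using h(6) img_fs[OF ni(2)] nsi by (simp add: B.eps_diff B.eps_smul) (simp add: ncEps_ev epsB_def)
    then show ?thesis using c by simp
  qed
  have K': "B.T.eqv (img (2 * n + i)) (kron [2 * n + \<sigma> i])" if i: "i < n" for i
  proof -
    let ?k = "kron [n + \<sigma> i] :: 'k ncp" and ?k' = "kron [2 * n + \<sigma> i] :: 'k ncp" and ?g = "img (2 * n + i)"
    have kfs: "?k' \<in> fs (3 * n)" and gfs: "?g \<in> fs (3 * n)" using sn[OF i] i by (auto intro: img_fs)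
    \<comment> \<open>Uniqueness of inverses: in the quotient \<open>?g\<close> is a right inverse
      and \<open>?k'\<close> a left inverse of \<open>?k\<close>.\<close>
    have "B.T.eqv (ncmul (img (n + i)) ?g) ncone"
      using img_inverse[of "n + i"] i by (simp add: kinv_K)
    then have "B.T.eqv (ncmul ?k ?g) ncone"
      using B.T.eqv_trans[OF B.T.eqv_mul_right[OF B.T.eqv_sym[OF K[OF i]] gfs]] by blast
    then have 1: "B.T.eqv (ncmul ?k' (ncmul ?k ?g)) (ncmul ?k' ncone)"
      by (rule B.T.eqv_mul_left[OF _ kfs])
    have "B.T.eqv (ncmul ?k' ?k) ncone"
      using rel_inv[of "2 * n + \<sigma> i"] sn[OF i] by (simp add: kinv_K ncmul_kron ncone_kron)
    then have 2: "B.T.eqv (ncmul (ncmul ?k' ?k) ?g) (ncmul ncone ?g)"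
      by (rule B.T.eqv_mul_right[OF _ gfs])
    show ?thesis using B.T.eqv_trans[OF B.T.eqv_sym[OF 2] 1[folded ncmul_assoc]] ncone_left[OF gfs] ncone_right[OF kfs] by simp
  qed
  show ?thesis
  proof (intro bexI[OF _ aut] bexI[of _ "\<lambda>i\<in>{..<n}. c i"] allI impI)
    show "(\<lambda>i\<in>{..<n}. c i) \<in> torus n" using c by (auto simp: torus_def)
  qed (use c K K' in auto)
qed

end

section \<open>The automorphism groups\<close>

text \<open>The blocks of letters for \<open>E\<close>, for \<open>K\<close> and for the inverses of
  \<open>K\<close> are permuted in parallel. The positive part sees only the block of
  \<open>E\<close>, so one letter map serves both algebras.\<close>

definition lperm :: "nat \<Rightarrow> (nat \<Rightarrow> nat) \<Rightarrow> nat \<Rightarrow> nat" where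
  "lperm n \<sigma> x = (if x < n then \<sigma> x else if x < 2 * n then n + \<sigma> (x - n)
     else if x < 3 * n then 2 * n + \<sigma> (x - 2 * n) else x)"

definition lscale :: "nat \<Rightarrow> (nat \<Rightarrow> 'k::field) \<Rightarrow> nat \<Rightarrow> 'k" where
  "lscale n \<alpha> x = (if x < n then \<alpha> x else 1)"

lemma lperm_simps:
  assumes "i < n"
  shows "lperm n \<sigma> i = \<sigma> i" "lperm n \<sigma> (n + i) = n + \<sigma> i" "lperm n \<sigma> (2 * n + i) = 2 * n + \<sigma> i"
    "lscale n \<alpha> i = \<alpha> i" "lscale n \<alpha> (n + i) = 1" "lscale n \<alpha> (2 * n + i) = 1"
  using assms by (auto simp: lperm_def lscale_def)

lemma letter_cases:
  fixes x n :: nat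
  assumes "x < 3 * n"
  obtains i where "i < n" "x = i" | i where "i < n" "x = n + i" | i where "i < n" "x = 2 * n + i"
proof -
  consider "x < n" | "n \<le> x" "x < 2 * n" | "2 * n \<le> x" by linarith
  then show ?thesis
    using that(1)[of x] that(2)[of "x - n"] that(3)[of "x - 2 * n"] assms by cases auto
qed

lemma lin_sum_fs: "(\<And>i. i \<in> A \<Longrightarrow> f i \<in> fs N) \<Longrightarrow> lin h (\<Sum>i\<in>A. f i) = (\<Sum>i\<in>A. lin h (f i))"
proof (induction A rule: infinite_finite_induct)
  case (insert x F)
  then have "sum f F \<in> fs N" by (auto intro!: fv.subspace_sum)
  with insert show ?case by (simp add: lin_add[of _ "words N"] fs_fsupp)
qed auto

context algebra_aut
begin

text \<open>An algebra automorphism is determined by its values on the letters, and extensionality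
  settles the values outside the quotient.\<close>

lemma eq_qmono:
  assumes ext: "\<phi> \<in> extensional (Qt N R)"
    and gen: "\<And>x. x < N \<Longrightarrow> s x < N \<and> T.eqv (psiw [x]) (smul (\<alpha> x) (kron [s x]))"
  shows "\<phi> = qmono N R \<alpha> s"
proof
  fix X
  define y where "y = (\<lambda>x. smul (\<alpha> x) (kron [s x]))"
  have y: "y x \<in> fs N \<and> T.eqv (psiw [x]) (y x)" if "x < N" for x using gen[OF that] by (simp add: y_def)
  have pw: "pword y = mword \<alpha> s"
  proof
    show "pword y w = mword \<alpha> s w" for w
      by (induction w) (auto simp: pword_def y_def mword_def ncone_kron ncmul_kron ncmul_smul_left
        ncmul_smul_right mult.commute)
  qed
  show "\<phi> X = qmono N R \<alpha> s X"
  proof (cases "X \<in> Qt N R")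
    case True
    then have f: "rep X \<in> fs N" "cls N R (rep X) = X" using rep_Qt by auto
    have "T.eqv (\<psi> (rep X)) (mono_map \<alpha> s (rep X)) \<and> mono_map \<alpha> s (rep X) \<in> fs N"
      using psi_determined[OF y f(1)] pw by simp
    then have "cls N R (\<psi> (rep X)) = cls N R (mono_map \<alpha> s (rep X))"
      using psi_fs[OF f(1)] by (simp add: cls_eq_iff T.eqv_def)
    then show ?thesis using phi_cls[OF f(1)] f(2) True by (simp add: qmono_def)
  next
    case False
    then show ?thesis using ext by (simp add: qmono_def extensional_def)
  qed
qed

end

context quantum_data
begin

lemma autdiagr:
  assumes "\<sigma> \<in> autdiagr n a"
  shows "\<sigma> permutes {..<n}" "i < n \<Longrightarrow> \<sigma> i < n" "i < n \<Longrightarrow> j < n \<Longrightarrow> a (\<sigma> i) (\<sigma> j) = a i j"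
    "inv \<sigma> \<in> autdiagr n a"
proof -
  show p: "\<sigma> permutes {..<n}" and s: "i < n \<Longrightarrow> j < n \<Longrightarrow> a (\<sigma> i) (\<sigma> j) = a i j" for i j
    using assms by (auto simp: autdiagr_def)
  show "i < n \<Longrightarrow> \<sigma> i < n" using permutes_in_image[OF p, of i] by simp
  have pi: "inv \<sigma> permutes {..<n}" by (rule permutes_inv[OF p])
  have "a (inv \<sigma> i) (inv \<sigma> j) = a i j" if "i < n" "j < n" for i j
    using s[of "inv \<sigma> i" "inv \<sigma> j"] that permutes_in_image[OF pi] permutes_inverses[OF p] by simp
  then show "inv \<sigma> \<in> autdiagr n a" using pi by (simp add: autdiagr_def)
qed

lemma autdiagr_comp:
  assumes \<sigma>: "\<sigma> \<in> autdiagr n a" and \<tau>: "\<tau> \<in> autdiagr n a"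
  shows "\<sigma> \<circ> \<tau> \<in> autdiagr n a"
proof -
  have "a (\<sigma> (\<tau> i)) (\<sigma> (\<tau> j)) = a i j" if "i < n" "j < n" for i j
    using autdiagr(3)[OF \<sigma> autdiagr(2)[OF \<tau>] autdiagr(2)[OF \<tau>]] autdiagr(3)[OF \<tau>] that by simp
  then show ?thesis
    using permutes_compose[OF autdiagr(1)[OF \<tau>] autdiagr(1)[OF \<sigma>]] by (simp add: autdiagr_def)
qed

lemma lperm_less:
  assumes "\<sigma> \<in> autdiagr n a"
  shows "x < n \<Longrightarrow> lperm n \<sigma> x < n" "x < 3 * n \<Longrightarrow> lperm n \<sigma> x < 3 * n"
proof -
  show "x < n \<Longrightarrow> lperm n \<sigma> x < n" using autdiagr(2)[OF assms] by (simp add: lperm_simps)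
  show "x < 3 * n \<Longrightarrow> lperm n \<sigma> x < 3 * n"
    by (erule letter_cases) (auto simp: lperm_simps dest: autdiagr(2)[OF assms])
qed

text \<open>All words of the Serre element contain \<open>1 - a i j\<close> letters \<open>i\<close>
  and one letter \<open>j\<close>, so they are scaled alike; the coefficients depend only on
  \<open>a i j\<close> and \<open>d i\<close>, which \<sigma> preserves.\<close>

lemma mono_serre:
  assumes \<sigma>: "\<sigma> \<in> autdiagr n a" and ij: "i < n" "j < n"
  shows "mono_map (lscale n \<alpha>) (lperm n \<sigma>) (serre q a d i j)
    = smul (\<alpha> i ^ nat (1 - a i j) * \<alpha> j) (serre q a d (\<sigma> i) (\<sigma> j))"
proof -
  let ?m = "nat (1 - a i j)"
  let ?w = "\<lambda>i j v. replicate (?m - v) i @ j # replicate v i"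
  have pa: "prod_list (replicate k (\<alpha> i)) = \<alpha> i ^ k" for k by (induction k) auto
  have w: "mword (lscale n \<alpha>) (lperm n \<sigma>) (?w i j v) = smul (\<alpha> i ^ ?m * \<alpha> j) (kron (?w (\<sigma> i) (\<sigma> j) v))"
    if "v \<le> ?m" for v
  proof -
    have "\<alpha> i ^ ?m = \<alpha> i ^ (?m - v) * \<alpha> i ^ v" using that by (simp add: power_add[symmetric])
    then show ?thesis using ij by (simp add: mword_def lperm_simps pa mult_ac)
  qed
  have "mono_map (lscale n \<alpha>) (lperm n \<sigma>) (serre q a d i j)
      = (\<Sum>v\<le>?m. smul (qcf (q ^ d i) ?m v) (mword (lscale n \<alpha>) (lperm n \<sigma>) (?w i j v)))"
    unfolding serre_words using ij
    by (subst lin_sum_fs[of _ _ n]) (auto simp: replicate_words lin_smul)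
  also have "\<dots> = smul (\<alpha> i ^ ?m * \<alpha> j) (serre q a d (\<sigma> i) (\<sigma> j))"
    unfolding serre_words autdiagr_d[OF \<sigma> ij(1)] autdiagr(3)[OF \<sigma> ij]
    by (simp add: fv.scale_sum_right w mult.commute)
  finally show ?thesis .
qed

lemma serre_relsU: "i < n \<Longrightarrow> j < n \<Longrightarrow> i \<noteq> j \<Longrightarrow> serre q a d i j \<in> relsU n q a d"
  by (auto simp: relsU_def)

lemma autdiagr_inj: "\<sigma> \<in> autdiagr n a \<Longrightarrow> \<sigma> i = \<sigma> j \<longleftrightarrow> i = j"
  using permutes_inj[OF autdiagr(1)] by (auto simp: inj_def)

lemma U_preserves:
  assumes \<sigma>: "\<sigma> \<in> autdiagr n a"
  shows "U.preserves (lscale n \<alpha>) (lperm n \<sigma>)"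
  unfolding U.preserves_def
proof (intro conjI ballI allI impI)
  show "mono_map (lscale n \<alpha>) (lperm n \<sigma>) f \<in> U.I" if "f \<in> U.I" for f
  proof (rule U.mono_map_ideal[OF _ _ that])
    fix r assume "r \<in> relsU n q a d"
    then obtain i j where "i < n" "j < n" "i \<noteq> j" "r = serre q a d i j" by (auto simp: relsU_def)
    then show "mono_map (lscale n \<alpha>) (lperm n \<sigma>) r \<in> U.I"
      using autdiagr(2)[OF \<sigma>] by (simp add: mono_serre[OF \<sigma>] autdiagr_inj[OF \<sigma>] U.R_I serre_relsU ncideal.smul)
  qed (rule lperm_less(1)[OF \<sigma>])
qed (rule lperm_less(1)[OF \<sigma>])

lemma B_preserves:
  assumes \<sigma>: "\<sigma> \<in> autdiagr n a"
  shows "B.preserves (lscale n \<alpha>) (lperm n \<sigma>)"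
  unfolding B.preserves_def
proof (intro conjI ballI allI impI)
  note sn = autdiagr(2)[OF \<sigma>]
  have diff: "mono_map \<gamma> s (kron u - g) = mword \<gamma> s u - mono_map \<gamma> s g"
    if "u \<in> words (3 * n)" "g \<in> fs (3 * n)" for \<gamma> s u and g :: "'k ncp"
    using lin_diff[of "kron u" "words (3 * n)" g] that by (simp add: fs_fsupp)
  show "mono_map (lscale n \<alpha>) (lperm n \<sigma>) f \<in> B.I" if "f \<in> B.I" for f
  proof (rule B.mono_map_ideal[OF _ _ that])
    fix r assume "r \<in> relsB n q a d"
    then show "mono_map (lscale n \<alpha>) (lperm n \<sigma>) r \<in> B.I"
    proof (induction rule: relsB_cases)
      case (serre i j)
      have "serre q a d (\<sigma> i) (\<sigma> j) \<in> B.I"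
        using serre sn serre_relsU[of "\<sigma> i" "\<sigma> j"] by (intro B.R_I) (simp add: relsB_def autdiagr_inj[OF \<sigma>])
      then show ?case using serre by (simp add: mono_serre[OF \<sigma>] ncideal.smul)
    next
      case (inv_right i)
      then show ?case using B.R_I[OF rel_inv_K(1)[OF sn[of i]]]
        by (simp add: diff) (simp add: mword_def lperm_simps)
    next
      case (inv_left i)
      then show ?case using B.R_I[OF rel_inv_K(2)[OF sn[of i]]]
        by (simp add: diff) (simp add: mword_def lperm_simps)
    next
      case (comm i j)
      then show ?case using rel_comm[OF sn[of i] sn[of j]]
        by (simp add: diff B.T.eqv_def) (simp add: mword_def lperm_simps)
    next
      case (qcomm i j)
      have "int (d (\<sigma> i)) * a (\<sigma> i) (\<sigma> j) = int (d i) * a i j"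
        using autdiagr_d[OF \<sigma>] autdiagr(3)[OF \<sigma>] qcomm by simp
      then have "B.T.eqv (smul (\<alpha> j) (kron [n + \<sigma> i, \<sigma> j]))
          (smul (\<alpha> j) (smul (q powi (int (d i) * a i j)) (kron [\<sigma> j, n + \<sigma> i])))"
        using rel_qcomm[OF sn[of i] sn[of j]] qcomm by (intro B.T.eqv_smul) simp
      then show ?case using qcomm
        by (simp add: diff lin_smul B.T.eqv_def) (simp add: mword_def lperm_simps mult.commute)
    qed
  qed (rule lperm_less(2)[OF \<sigma>])
qed (rule lperm_less(2)[OF \<sigma>])

text \<open>A letter picks up \<beta>, is moved by \<tau>, and meets \<alpha> at its new position.
  This is the origin of the twist in \<open>sdmul\<close>.\<close>

lemma letters_comp:
  assumes \<tau>: "\<tau> \<in> autdiagr n a" and x: "x < 3 * n"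
  shows "lperm n \<sigma> (lperm n \<tau> x) = lperm n (\<sigma> \<circ> \<tau>) x"
    "lscale n \<beta> x * lscale n \<alpha> (lperm n \<tau> x) = lscale n (\<lambda>i. \<alpha> (\<tau> i) * \<beta> i) x"
proof -
  show "lperm n \<sigma> (lperm n \<tau> x) = lperm n (\<sigma> \<circ> \<tau>) x"
    using x
  proof (cases rule: letter_cases)
    case (1 i)
    then show ?thesis using autdiagr(2)[OF \<tau>, of i] by (simp add: lperm_simps)
  next
    case (2 i)
    then show ?thesis using autdiagr(2)[OF \<tau>, of i] by (simp add: lperm_simps)
  next
    case (3 i)
    then show ?thesis using autdiagr(2)[OF \<tau>, of i] by (simp add: lperm_simps)
  qed
  show "lscale n \<beta> x * lscale n \<alpha> (lperm n \<tau> x) = lscale n (\<lambda>i. \<alpha> (\<tau> i) * \<beta> i) x"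
    using x
  proof (cases rule: letter_cases)
    case (1 i)
    then show ?thesis using autdiagr(2)[OF \<tau>, of i] by (simp add: lperm_simps mult.commute)
  next
    case (2 i)
    then show ?thesis using autdiagr(2)[OF \<tau>, of i] by (simp add: lperm_simps)
  next
    case (3 i)
    then show ?thesis using autdiagr(2)[OF \<tau>, of i] by (simp add: lperm_simps)
  qed
qed

text \<open>The inverse map sends \<open>E_i\<close> back to the letter
  \<open>inv \<sigma> i\<close> and has to undo the scalar that \<alpha> carries at that index;
  hence the choice of \<beta>.\<close>

lemma letters_inverse:
  assumes \<alpha>: "\<alpha> \<in> torus n" and \<sigma>: "\<sigma> \<in> autdiagr n a" and x: "x < 3 * n"
  defines "\<beta> \<equiv> \<lambda>i. inverse (\<alpha> (inv \<sigma> i))"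
  shows "lscale n \<beta> x * lscale n \<alpha> (lperm n (inv \<sigma>) x) = 1" "lperm n \<sigma> (lperm n (inv \<sigma>) x) = x"
    "lscale n \<alpha> x * lscale n \<beta> (lperm n \<sigma> x) = 1" "lperm n (inv \<sigma>) (lperm n \<sigma> x) = x"
proof -
  note p = autdiagr(1)[OF \<sigma>] and s' = autdiagr(4)[OF \<sigma>]
  have nz: "\<alpha> i \<noteq> 0" if "i < n" for i using \<alpha> that by (simp add: torus_def)
  have id: "lperm n (\<lambda>i. i) x = x" using x by (cases rule: letter_cases) (auto simp: lperm_simps)
  show "lperm n \<sigma> (lperm n (inv \<sigma>) x) = x" "lperm n (inv \<sigma>) (lperm n \<sigma> x) = x"
    using letters_comp(1)[OF s' x, of \<sigma>] letters_comp(1)[OF \<sigma> x, of "inv \<sigma>"] permutes_inv_o[OF p] id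
    by (simp_all add: id_def)
  show "lscale n \<beta> x * lscale n \<alpha> (lperm n (inv \<sigma>) x) = 1"
    unfolding letters_comp(2)[OF s' x] using autdiagr(2)[OF s'] nz by (simp add: lscale_def \<beta>_def)
  show "lscale n \<alpha> x * lscale n \<beta> (lperm n \<sigma> x) = 1"
    unfolding letters_comp(2)[OF \<sigma> x] using nz permutes_inverses[OF p] by (simp add: lscale_def \<beta>_def)
qed

section \<open>The two actions of the semidirect product\<close>

abbreviation "actU \<equiv> \<lambda>(\<alpha>, \<sigma>). qmono n (relsU n q a d) (lscale n \<alpha>) (lperm n \<sigma>)"
abbreviation "actB \<equiv> \<lambda>(\<alpha>, \<sigma>). qmono (3 * n) (relsB n q a d) (lscale n \<alpha>) (lperm n \<sigma>)"

lemma actU_HopfAut: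
  assumes \<alpha>: "\<alpha> \<in> torus n" and \<sigma>: "\<sigma> \<in> autdiagr n a"
  shows "actU (\<alpha>, \<sigma>) \<in> HopfAutU n q a d"
proof -
  have "is_alg_aut n (relsU n q a d) (actU (\<alpha>, \<sigma>))"
    using letters_inverse[OF \<alpha> \<sigma>] unfolding prod.case
    by (intro U.qmono_alg_aut[OF U_preserves[OF \<sigma>] U_preserves[OF autdiagr(4)[OF \<sigma>], of "\<lambda>i. inverse (\<alpha> (inv \<sigma> i))"]]) auto
  moreover have "chiU q a d (lperm n \<sigma> x) (lperm n \<sigma> y) = chiU q a d x y" if "x < n" "y < n" for x y
    using that autdiagr_d[OF \<sigma>] autdiagr(3)[OF \<sigma>] by (simp add: chiU_def lperm_simps)
  moreover have "U.lift2 (mword (lscale n \<alpha>) (lperm n \<sigma>)) (DU x) = smul (lscale n \<alpha> x) (DU (lperm n \<sigma> x))"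
    if "x < n" for x
    using that
    by (simp add: DU_def ncgen_kron ncone_kron tens_kron U.lift2_add U.lift2_kron)
      (simp add: mword_def lperm_simps tens_smul_left tens_smul_right tens_kron fv.scale_right_distrib)
  moreover have "epsU (lperm n \<sigma> x) * lscale n \<alpha> x = epsU x" for x
    by (simp add: epsU_def)
  ultimately have "is_alg_aut n (relsU n q a d) (actU (\<alpha>, \<sigma>))
      \<and> is_coalg_map n (relsU n q a d) (chiU q a d) DU epsU (actU (\<alpha>, \<sigma>))
      \<and> preserves_braiding n (relsU n q a d) (chiU q a d) (actU (\<alpha>, \<sigma>))"
    using U.qmono_coalg[OF U_preserves[OF \<sigma>], of \<alpha>] by simp
  then show ?thesis by (simp add: HopfAutU_def Uplus_def qmono_def)
qed

lemma actB_HopfAut: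
  assumes \<alpha>: "\<alpha> \<in> torus n" and \<sigma>: "\<sigma> \<in> autdiagr n a"
  shows "actB (\<alpha>, \<sigma>) \<in> HopfAutB n q a d"
proof -
  have "is_alg_aut (3 * n) (relsB n q a d) (actB (\<alpha>, \<sigma>))"
    using letters_inverse[OF \<alpha> \<sigma>] unfolding prod.case
    by (intro B.qmono_alg_aut[OF B_preserves[OF \<sigma>] B_preserves[OF autdiagr(4)[OF \<sigma>], of "\<lambda>i. inverse (\<alpha> (inv \<sigma> i))"]]) auto
  moreover have "is_coalg_map (3 * n) (relsB n q a d) chi1 (DB n) (epsB n) (actB (\<alpha>, \<sigma>))"
    unfolding prod.case
  proof (rule B.qmono_coalg(1)[OF B_preserves[OF \<sigma>]])
    fix x assume x: "x < 3 * n"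
    then show "B.lift2 (mword (lscale n \<alpha>) (lperm n \<sigma>)) (DB n x) = smul (lscale n \<alpha> x) (DB n (lperm n \<sigma> x))"
    proof (cases rule: letter_cases)
      case (1 i)
      then show ?thesis using autdiagr(2)[OF \<sigma>]
        by (simp add: DB_E B.lift2_add B.lift2_kron lperm_simps)
          (simp add: mword_def lperm_simps tens_smul_left tens_smul_right tens_kron fv.scale_right_distrib)
    qed (use autdiagr(2)[OF \<sigma>] in \<open>auto simp: DB_K B.lift2_kron mword_def lperm_simps tens_kron\<close>)
    show "epsB n (lperm n \<sigma> x) * lscale n \<alpha> x = epsB n x"
      using x autdiagr(2)[OF \<sigma>] by (cases rule: letter_cases) (auto simp: epsB_def lperm_simps)
  qed (simp add: chi1_def)
  ultimately show ?thesis by (simp add: HopfAutB_def Ub_def qmono_def)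
qed

lemma actU_gen: "i < n \<Longrightarrow> \<sigma> \<in> autdiagr n a \<Longrightarrow>
    actU (\<alpha>, \<sigma>) (qgen n (relsU n q a d) i) = cls n (relsU n q a d) (smul (\<alpha> i) (kron [\<sigma> i]))"
  by (simp add: qgen_def ncgen_kron U.qmono_cls[OF U_preserves] mword_def lperm_simps)

lemma actB_gen: "i < n \<Longrightarrow> \<sigma> \<in> autdiagr n a \<Longrightarrow>
    actB (\<alpha>, \<sigma>) (qgen (3 * n) (relsB n q a d) i) = cls (3 * n) (relsB n q a d) (smul (\<alpha> i) (kron [\<sigma> i]))"
  by (simp add: qgen_def ncgen_kron B.qmono_cls[OF B_preserves] mword_def lperm_simps)

lemma actB_gen_K: "i < n \<Longrightarrow> \<sigma> \<in> autdiagr n a \<Longrightarrow>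
    actB (\<alpha>, \<sigma>) (qgen (3 * n) (relsB n q a d) (n + i)) = qgen (3 * n) (relsB n q a d) (n + \<sigma> i)"
  by (simp add: qgen_def ncgen_kron B.qmono_cls[OF B_preserves] mword_def lperm_simps)

text \<open>Stated with the Borel ideal, which contains that of the positive part, so that it serves
  both algebras. Outside the index range the values are fixed by membership in \<open>torus\<close>
  and \<open>autdiagr\<close>.\<close>

lemma parameters_unique:
  assumes \<alpha>: "\<alpha> \<in> torus n" "\<beta> \<in> torus n" and \<sigma>: "\<sigma> \<in> autdiagr n a" "\<tau> \<in> autdiagr n a"
    and e: "\<And>i. i < n \<Longrightarrow> smul (\<alpha> i) (kron [\<sigma> i]) - smul (\<beta> i) (kron [\<tau> i]) \<in> B.I"
  shows "\<alpha> = \<beta> \<and> \<sigma> = \<tau>"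
proof -
  have u: "\<sigma> i = \<tau> i \<and> \<alpha> i = \<beta> i" if "i < n" for i
    using \<alpha> that autdiagr(2)[OF \<sigma>(1)] autdiagr(2)[OF \<sigma>(2)]
    by (intro gen_eqv_unique[OF e[OF that] refl refl]) (auto simp: torus_def)
  have "\<sigma> i = \<tau> i" for i
    using u[of i] autdiagr(1)[OF \<sigma>(1)] autdiagr(1)[OF \<sigma>(2)] by (cases "i < n") (auto simp: permutes_def)
  moreover have "\<alpha> i = \<beta> i" for i
    using u[of i] \<alpha> by (cases "i < n") (auto simp: torus_def extensional_def)
  ultimately show ?thesis by blast
qed

lemma actU_bij: "bij_betw actU (torus n \<times> autdiagr n a) (HopfAutU n q a d)"
  unfolding bij_betw_def
proof (intro conjI equalityI subsetI)
  show "inj_on actU (torus n \<times> autdiagr n a)"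
  proof (rule inj_onI, clarify)
    fix \<alpha> \<beta> :: "nat \<Rightarrow> 'k" and \<sigma> \<tau>
    assume h: "\<alpha> \<in> torus n" "\<sigma> \<in> autdiagr n a" "\<beta> \<in> torus n" "\<tau> \<in> autdiagr n a"
      and e: "qmono n (relsU n q a d) (lscale n \<alpha>) (lperm n \<sigma>) = qmono n (relsU n q a d) (lscale n \<beta>) (lperm n \<tau>)"
    have "smul (\<alpha> i) (kron [\<sigma> i]) - smul (\<beta> i) (kron [\<tau> i]) \<in> B.I" if i: "i < n" for i
    proof (rule U_ideal_subset)
      have "cls n (relsU n q a d) (smul (\<alpha> i) (kron [\<sigma> i])) = cls n (relsU n q a d) (smul (\<beta> i) (kron [\<tau> i]))"
        using actU_gen[OF i h(2), of \<alpha>] actU_gen[OF i h(4), of \<beta>] e by simp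
      then show "smul (\<alpha> i) (kron [\<sigma> i]) - smul (\<beta> i) (kron [\<tau> i]) \<in> U.I"
        using autdiagr(2)[OF h(2) i] autdiagr(2)[OF h(4) i] by (subst (asm) U.cls_eq_iff) auto
    qed
    then show "\<alpha> = \<beta> \<and> \<sigma> = \<tau>" using parameters_unique h by blast
  qed
  show "f \<in> HopfAutU n q a d" if "f \<in> actU ` (torus n \<times> autdiagr n a)" for f
    using that actU_HopfAut by auto
  fix \<phi> assume \<phi>: "\<phi> \<in> HopfAutU n q a d"
  interpret A: algebra_aut n "relsU n q a d" \<phi> by unfold_locales (use \<phi> in \<open>simp add: HopfAutU_def\<close>)
  obtain \<sigma> \<alpha> where \<sigma>: "\<sigma> \<in> autdiagr n a" "\<alpha> \<in> torus n"
    and g: "\<And>i. i < n \<Longrightarrow> U.T.eqv (A.psiw [i]) (smul (\<alpha> i) (kron [\<sigma> i]))"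
    using U_classification[OF \<phi>] by blast
  have "\<phi> = actU (\<alpha>, \<sigma>)"
    unfolding prod.case
  proof (rule A.eq_qmono)
    show "\<phi> \<in> extensional (Qt n (relsU n q a d))" using \<phi> by (simp add: HopfAutU_def Uplus_def)
  qed (use g \<sigma> in \<open>auto simp: lperm_simps autdiagr(2)\<close>)
  then show "\<phi> \<in> actU ` (torus n \<times> autdiagr n a)" using \<sigma> by blast
qed

lemma actB_bij: "bij_betw actB (torus n \<times> autdiagr n a) (HopfAutB n q a d)"
  unfolding bij_betw_def
proof (intro conjI equalityI subsetI)
  show "inj_on actB (torus n \<times> autdiagr n a)"
  proof (rule inj_onI, clarify)
    fix \<alpha> \<beta> :: "nat \<Rightarrow> 'k" and \<sigma> \<tau>
    assume h: "\<alpha> \<in> torus n" "\<sigma> \<in> autdiagr n a" "\<beta> \<in> torus n" "\<tau> \<in> autdiagr n a"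
      and e: "qmono (3 * n) (relsB n q a d) (lscale n \<alpha>) (lperm n \<sigma>) = qmono (3 * n) (relsB n q a d) (lscale n \<beta>) (lperm n \<tau>)"
    have "smul (\<alpha> i) (kron [\<sigma> i]) - smul (\<beta> i) (kron [\<tau> i]) \<in> B.I" if i: "i < n" for i
    proof -
      have "cls (3 * n) (relsB n q a d) (smul (\<alpha> i) (kron [\<sigma> i])) = cls (3 * n) (relsB n q a d) (smul (\<beta> i) (kron [\<tau> i]))"
        using actB_gen[OF i h(2), of \<alpha>] actB_gen[OF i h(4), of \<beta>] e by simp
      then show ?thesis
        using autdiagr(2)[OF h(2) i] autdiagr(2)[OF h(4) i] by (subst (asm) B.cls_eq_iff) auto
    qed
    then show "\<alpha> = \<beta> \<and> \<sigma> = \<tau>" using parameters_unique h by blast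
  qed
  show "f \<in> HopfAutB n q a d" if "f \<in> actB ` (torus n \<times> autdiagr n a)" for f
    using that actB_HopfAut by auto
  fix \<phi> assume \<phi>: "\<phi> \<in> HopfAutB n q a d"
  interpret A: borel_aut q n a d \<phi> by unfold_locales (rule \<phi>)
  obtain \<sigma> \<alpha> where \<sigma>: "\<sigma> \<in> autdiagr n a" "\<alpha> \<in> torus n"
    and g: "\<And>i. i < n \<Longrightarrow> B.T.eqv (A.img i) (smul (\<alpha> i) (kron [\<sigma> i]))
      \<and> B.T.eqv (A.img (n + i)) (kron [n + \<sigma> i]) \<and> B.T.eqv (A.img (2 * n + i)) (kron [2 * n + \<sigma> i])"
    using A.B_classification by blast
  have "\<phi> = actB (\<alpha>, \<sigma>)"
    unfolding prod.case
  proof (rule A.A.eq_qmono)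
    show "\<phi> \<in> extensional (Qt (3 * n) (relsB n q a d))" using \<phi> by (simp add: HopfAutB_def Ub_def)
    show "lperm n \<sigma> x < 3 * n \<and> B.T.eqv (A.img x) (smul (lscale n \<alpha> x) (kron [lperm n \<sigma> x]))"
      if x: "x < 3 * n" for x
    proof
      show "lperm n \<sigma> x < 3 * n" by (rule lperm_less(2)[OF \<sigma>(1) x])
      show "B.T.eqv (A.img x) (smul (lscale n \<alpha> x) (kron [lperm n \<sigma> x]))"
        using x by (cases rule: letter_cases) (simp_all add: lperm_simps g)
    qed
  qed
  then show "\<phi> \<in> actB ` (torus n \<times> autdiagr n a)" using \<sigma> by blast
qed

lemma act_mult:
  assumes \<sigma>: "\<sigma> \<in> autdiagr n a" and \<tau>: "\<tau> \<in> autdiagr n a"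
  shows "actU (sdmul n (\<alpha>, \<sigma>) (\<beta>, \<tau>)) = compose (Uplus n q a d) (actU (\<alpha>, \<sigma>)) (actU (\<beta>, \<tau>))"
    and "actB (sdmul n (\<alpha>, \<sigma>) (\<beta>, \<tau>)) = compose (Ub n q a d) (actB (\<alpha>, \<sigma>)) (actB (\<beta>, \<tau>))"
proof -
  note st = autdiagr_comp[OF \<sigma> \<tau>]
  let ?\<gamma> = "\<lambda>i\<in>{..<n}. \<alpha> (\<tau> i) * \<beta> i"
  have sc: "lscale n ?\<gamma> x = lscale n \<beta> x * lscale n \<alpha> (lperm n \<tau> x)" "lperm n (\<sigma> \<circ> \<tau>) x = lperm n \<sigma> (lperm n \<tau> x)"
    if "x < 3 * n" for x
    unfolding letters_comp[OF \<tau> that] by (simp_all add: lscale_def)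
  show "actU (sdmul n (\<alpha>, \<sigma>) (\<beta>, \<tau>)) = compose (Uplus n q a d) (actU (\<alpha>, \<sigma>)) (actU (\<beta>, \<tau>))"
  proof
    fix X
    show "actU (sdmul n (\<alpha>, \<sigma>) (\<beta>, \<tau>)) X = compose (Uplus n q a d) (actU (\<alpha>, \<sigma>)) (actU (\<beta>, \<tau>)) X"
    proof (cases "X \<in> Qt n (relsU n q a d)")
      case True
      then show ?thesis
        using U.qmono_comp[OF U_preserves[OF \<sigma>] U_preserves[OF \<tau>] True U_preserves[OF st], of ?\<gamma> \<beta> \<alpha>] sc
        by (simp add: sdmul_def compose_def Uplus_def)
    qed (simp add: sdmul_def compose_def Uplus_def qmono_def)
  qed
  show "actB (sdmul n (\<alpha>, \<sigma>) (\<beta>, \<tau>)) = compose (Ub n q a d) (actB (\<alpha>, \<sigma>)) (actB (\<beta>, \<tau>))"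
  proof
    fix X
    show "actB (sdmul n (\<alpha>, \<sigma>) (\<beta>, \<tau>)) X = compose (Ub n q a d) (actB (\<alpha>, \<sigma>)) (actB (\<beta>, \<tau>)) X"
    proof (cases "X \<in> Qt (3 * n) (relsB n q a d)")
      case True
      then show ?thesis
        using B.qmono_comp[OF B_preserves[OF \<sigma>] B_preserves[OF \<tau>] True B_preserves[OF st], of ?\<gamma> \<beta> \<alpha>] sc
        by (simp add: sdmul_def compose_def Ub_def)
    qed (simp add: sdmul_def compose_def Ub_def qmono_def)
  qed
qed

end

theorem theorem1p7:
  fixes q :: "'k::field_char_0" and n :: nat and a :: "nat \<Rightarrow> nat \<Rightarrow> int" and d :: "nat \<Rightarrow> nat"
  assumes "\<not> algebraic q"
    and "simple_cartan n a"
    and "symmetrizer n a d"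
  shows "\<exists>\<Phi> \<Psi>.
     bij_betw \<Phi> (torus n \<times> autdiagr n a) (HopfAutU n q a d)
   \<and> bij_betw \<Psi> (torus n \<times> autdiagr n a) (HopfAutB n q a d)
   \<and> (\<forall>\<alpha>\<in>torus n. \<forall>\<sigma>\<in>autdiagr n a. \<forall>i<n.
        \<Phi> (\<alpha>, \<sigma>) (qgen n (relsU n q a d) i)
          = qsmul n (relsU n q a d) (\<alpha> i) (qgen n (relsU n q a d) (\<sigma> i))
      \<and> \<Psi> (\<alpha>, \<sigma>) (qgen (3*n) (relsB n q a d) i)
          = qsmul (3*n) (relsB n q a d) (\<alpha> i) (qgen (3*n) (relsB n q a d) (\<sigma> i))
      \<and> \<Psi> (\<alpha>, \<sigma>) (qgen (3*n) (relsB n q a d) (n + i))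
          = qgen (3*n) (relsB n q a d) (n + \<sigma> i))
   \<and> (\<forall>x\<in>torus n \<times> autdiagr n a. \<forall>y\<in>torus n \<times> autdiagr n a.
        \<Phi> (sdmul n x y) = compose (Uplus n q a d) (\<Phi> x) (\<Phi> y)
      \<and> \<Psi> (sdmul n x y) = compose (Ub n q a d) (\<Psi> x) (\<Psi> y))"
proof -
  interpret quantum_data q n a d by unfold_locales (fact assms)+
  show ?thesis
  proof (rule exI[of _ actU], rule exI[of _ actB], intro conjI ballI allI impI)
    show "bij_betw actU (torus n \<times> autdiagr n a) (HopfAutU n q a d)" by (rule actU_bij)
    show "bij_betw actB (torus n \<times> autdiagr n a) (HopfAutB n q a d)" by (rule actB_bij)
  next
    fix \<alpha> :: "nat \<Rightarrow> 'k" and \<sigma> i assume h: "\<sigma> \<in> autdiagr n a" "i < n"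
    note si = autdiagr(2)[OF h]
    show "actU (\<alpha>, \<sigma>) (qgen n (relsU n q a d) i) = qsmul n (relsU n q a d) (\<alpha> i) (qgen n (relsU n q a d) (\<sigma> i))"
      unfolding actU_gen[OF h(2,1)] using si by (simp add: qgen_def ncgen_kron U.qsmul_cls)
    show "actB (\<alpha>, \<sigma>) (qgen (3*n) (relsB n q a d) i)
        = qsmul (3*n) (relsB n q a d) (\<alpha> i) (qgen (3*n) (relsB n q a d) (\<sigma> i))"
      unfolding actB_gen[OF h(2,1)] using si by (simp add: qgen_def ncgen_kron B.qsmul_cls)
    show "actB (\<alpha>, \<sigma>) (qgen (3*n) (relsB n q a d) (n + i)) = qgen (3*n) (relsB n q a d) (n + \<sigma> i)"
      by (rule actB_gen_K[OF h(2,1)])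
  next
    fix x y :: "(nat \<Rightarrow> 'k) \<times> (nat \<Rightarrow> nat)"
    assume "x \<in> torus n \<times> autdiagr n a" "y \<in> torus n \<times> autdiagr n a"
    then show "actU (sdmul n x y) = compose (Uplus n q a d) (actU x) (actU y)"
      and "actB (sdmul n x y) = compose (Ub n q a d) (actB x) (actB y)"
      using act_mult by (cases x; cases y; simp)+
  qed
qed

end
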